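(* Let $k$ be a field of characteristic zero and fix positive integers $r$ and $d$. Then every monomial Artinian level algebra $k[x_1,\dots,x_r]/I$ of codimension $r$ and type $d$ has the Weak Lefschetz Property if and only if at least one of the following holds: (a) $r=1$ or $r=2$; (b) $d=1$; (c) $r=3$ and $d=2$. Furthermore, every monomial Artinian level algebra of codimension $r$ and type $d$ has the Strong Lefschetz Property if and only if (a) or (b) holds.
   Context: $I\subset R=k[x_1,\dots,x_r]$ is a monomial ideal containing no linear forms with $R/I$ Artinian (so $R/I$ has codimension $r$). $A=R/I$ is level of type $d$ if its socle (annihilator of the homogeneous maximal ideal) has dimension $d$ and is concentrated in a single degree. $A$ has the Weak Lefschetz Property (WLP) if there is a linear form $L$ such that $\times L:A_j\to A_{j+1}$ has maximal rank (injective or surjective) for all $j$, and the Strong Lefschetz Property (SLP) if there is a linear form $L$ such that $\times L^s:A_j\to A_{j+s}$ has maximal rank for all $j$ and all $s\ge1$. *)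

theory Defs
  imports "HOL-Library.Poly_Mapping" "HOL-Algebra.Algebra"
begin

type_synonym 'k mpoly = "(nat \<Rightarrow>\<^sub>0 nat) \<Rightarrow>\<^sub>0 'k"

definition mpoly_ring :: "nat \<Rightarrow> ('k::field) mpoly ring"
  where "mpoly_ring r =
    \<lparr>carrier = {p. \<forall>m \<in> Poly_Mapping.keys p. Poly_Mapping.keys m \<subseteq> {..<r}},
     monoid.mult = (*), one = 1, ring.zero = 0, add = (+)\<rparr>"

lemma mpoly_ring_cring: "cring (mpoly_ring r :: ('k::field) mpoly ring)"
proof -
  let ?R = "mpoly_ring r :: 'k mpoly ring"
  have add_closed: "p + q \<in> carrier ?R" if "p \<in> carrier ?R" "q \<in> carrier ?R" for p q
    using that Poly_Mapping.keys_add[of p q] by (fastforce simp: mpoly_ring_def)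
  have mult_closed: "p * q \<in> carrier ?R" if p: "p \<in> carrier ?R" and q: "q \<in> carrier ?R" for p q
  proof -
    have "Poly_Mapping.keys m \<subseteq> {..<r}" if "m \<in> Poly_Mapping.keys (p * q)" for m
    proof -
      obtain a b where m: "m = a + b"
        and a: "a \<in> Poly_Mapping.keys p" and b: "b \<in> Poly_Mapping.keys q"
        using \<open>m \<in> Poly_Mapping.keys (p * q)\<close> keys_mult[of p q] by blast
      have "Poly_Mapping.keys m \<subseteq> Poly_Mapping.keys a \<union> Poly_Mapping.keys b"
        unfolding m by (rule Poly_Mapping.keys_add)
      with p q a b show ?thesis by (fastforce simp: mpoly_ring_def)
    qed
    then show ?thesis by (simp add: mpoly_ring_def)
  qed
  have uminus_closed: "- p \<in> carrier ?R" if "p \<in> carrier ?R" for p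
    using that by (simp add: mpoly_ring_def)
  have one_closed: "1 \<in> carrier ?R" and zero_closed: "0 \<in> carrier ?R"
    by (auto simp: mpoly_ring_def single_one[symmetric] simp del: single_one)
  have ops [simp]: "x \<otimes>\<^bsub>?R\<^esub> y = x * y" "x \<oplus>\<^bsub>?R\<^esub> y = x + y" "\<one>\<^bsub>?R\<^esub> = 1" "\<zero>\<^bsub>?R\<^esub> = 0" for x y
    by (simp_all add: mpoly_ring_def)
  show ?thesis
  proof (rule cringI)
    show "abelian_group ?R"
    proof (rule abelian_groupI)
      fix x assume "x \<in> carrier ?R"
      then show "\<exists>y \<in> carrier ?R. y \<oplus>\<^bsub>?R\<^esub> x = \<zero>\<^bsub>?R\<^esub>"
        using uminus_closed by (intro bexI[of _ "- x"]) auto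
    qed (simp_all add: add_closed zero_closed ac_simps)
    show "Group.comm_monoid ?R"
      by (rule comm_monoidI) (simp_all add: mult_closed one_closed ac_simps)
  qed (simp add: algebra_simps)
qed

definition mono_degree :: "(nat \<Rightarrow>\<^sub>0 nat) \<Rightarrow> nat"
  where "mono_degree m = (\<Sum>i \<in> Poly_Mapping.keys m. Poly_Mapping.lookup m i)"

definition forms :: "nat \<Rightarrow> nat \<Rightarrow> ('k::field) mpoly set"
  where "forms r j =
    {p \<in> carrier (mpoly_ring r). \<forall>m \<in> Poly_Mapping.keys p. mono_degree m = j}"

definition monomials :: "nat \<Rightarrow> ('k::field) mpoly set"
  where "monomials r = {Poly_Mapping.single m 1 | m. Poly_Mapping.keys m \<subseteq> {..<r}}"

definition monomial_ideal :: "nat \<Rightarrow> ('k::field) mpoly set \<Rightarrow> bool"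
  where "monomial_ideal r I \<longleftrightarrow> (\<exists>S \<subseteq> monomials r. I = Idl\<^bsub>mpoly_ring r\<^esub> S)"

definition artinian_ring :: "('a, 'b) ring_scheme \<Rightarrow> bool"
  where "artinian_ring A \<longleftrightarrow> ring A \<and>
    (\<forall>J :: nat \<Rightarrow> 'a set. (\<forall>n. ideal (J n) A \<and> J (Suc n) \<subseteq> J n) \<longrightarrow>
       (\<exists>N. \<forall>n \<ge> N. J n = J N))"

abbreviation quot_alg :: "nat \<Rightarrow> ('k::field) mpoly set \<Rightarrow> 'k mpoly set ring"
  where "quot_alg r I \<equiv> mpoly_ring r Quot I"

abbreviation residue_class :: "nat \<Rightarrow> ('k::field) mpoly set \<Rightarrow> 'k mpoly \<Rightarrow> 'k mpoly set"
  where "residue_class r I f \<equiv> I +>\<^bsub>mpoly_ring r\<^esub> f"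

definition graded_part :: "nat \<Rightarrow> ('k::field) mpoly set \<Rightarrow> nat \<Rightarrow> 'k mpoly set set"
  where "graded_part r I j = residue_class r I ` forms r j"

definition scalars :: "nat \<Rightarrow> ('k::field) mpoly set \<Rightarrow> 'k mpoly set set"
  where "scalars r I = range (\<lambda>c. residue_class r I (Poly_Mapping.single 0 c))"

definition irrelevant_ideal :: "nat \<Rightarrow> ('k::field) mpoly set"
  where "irrelevant_ideal r =
    Idl\<^bsub>mpoly_ring r\<^esub> ((\<lambda>i. Poly_Mapping.single (Poly_Mapping.single i 1) 1) ` {..<r})"

definition socle :: "nat \<Rightarrow> ('k::field) mpoly set \<Rightarrow> 'k mpoly set set"
  where "socle r I = {a \<in> carrier (quot_alg r I).
    \<forall>f \<in> irrelevant_ideal r. residue_class r I f \<otimes>\<^bsub>quot_alg r I\<^esub> a = \<zero>\<^bsub>quot_alg r I\<^esub>}"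

definition level_of_type :: "nat \<Rightarrow> nat \<Rightarrow> ('k::field) mpoly set \<Rightarrow> bool"
  where "level_of_type r d I \<longleftrightarrow>
    ring.dimension (quot_alg r I) d (scalars r I) (socle r I) \<and>
    (\<exists>e. socle r I \<subseteq> graded_part r I e)"

text \<open>The absence of nonzero linear forms in \<open>I\<close>, together with the Artinian property, is what
  makes \<open>r\<close> the codimension of the algebra.\<close>

definition monomial_artinian_level :: "nat \<Rightarrow> nat \<Rightarrow> ('k::field) mpoly set \<Rightarrow> bool"
  where "monomial_artinian_level r d I \<longleftrightarrow>
    monomial_ideal r I \<and> I \<inter> forms r 1 \<subseteq> {0} \<and>
    artinian_ring (quot_alg r I) \<and> level_of_type r d I"

definition maximal_rank :: "nat \<Rightarrow> ('k::field) mpoly set \<Rightarrow> 'k mpoly \<Rightarrow> nat \<Rightarrow> nat \<Rightarrow> bool"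
  where "maximal_rank r I L s j \<longleftrightarrow>
    (let A = quot_alg r I;
         mult_map = (\<lambda>a. (residue_class r I L [^]\<^bsub>A\<^esub> s) \<otimes>\<^bsub>A\<^esub> a)
     in inj_on mult_map (graded_part r I j) \<or>
        mult_map ` graded_part r I j = graded_part r I (j + s))"

definition weak_lefschetz :: "nat \<Rightarrow> ('k::field) mpoly set \<Rightarrow> bool"
  where "weak_lefschetz r I \<longleftrightarrow> (\<exists>L \<in> forms r 1. \<forall>j. maximal_rank r I L 1 j)"

definition strong_lefschetz :: "nat \<Rightarrow> ('k::field) mpoly set \<Rightarrow> bool"
  where "strong_lefschetz r I \<longleftrightarrow> (\<exists>L \<in> forms r 1. \<forall>j. \<forall>s \<ge> 1. maximal_rank r I L s j)"

end

theory Submission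
  imports Defs
begin

text \<open>In terms of monomials, a level algebra of type \<open>d\<close> is a set \<open>G\<close> of exponents consisting of all divisors of \<open>d\<close> monomials
  of the same degree, and multiplication by a form acts on coefficient functions on \<open>G\<close>.

  For \<open>d = 1\<close> the set \<open>G\<close> is a box and the algebra is a tensor product of irreducible \<open>sl\<^sub>2\<close>-modules. In the other
  positive cases it suffices to work over the rationals, since a system of linear equations with rational coefficients has
  the same rank over \<open>k\<close>. After dehomogenising, the kernel is described by polynomials divisible by a power of \<open>x - 1\<close>
  that have few nonzero coefficients; counting sign alternations shows that they vanish or, in the complementary
  range, that the corresponding inhomogeneous system is solvable.

  The Weak Lefschetz Property fails by a dimension count on subspaces for \<open>r \<ge> 3, d \<ge> 3\<close>. For \<open>r \<ge> 4, d = 2\<close> one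
  uses the socle monomials \<open>N * y * z ^ q\<close> and \<open>N * y ^ q * z\<close>, where \<open>N\<close> is the product of the squares of the other
  variables: if \<open>L = x + w\<close> with \<open>w\<close> the part in \<open>y\<close> and \<open>z\<close>, then the alternating sum of the \<open>x ^ (n - s) * w ^ s\<close> is
  a kernel element. For \<open>r = 3, d = 2\<close> the cube of every linear form fails to have maximal rank on the divisors of
  \<open>x * y ^ 3 * z ^ 2\<close> and \<open>x ^ 3 * y * z ^ 2\<close>.\<close>

text \<open>Counting signs needs an ordered field, and \<open>k\<close> need not be one; hence the
  detour through the rationals and the integer coefficients of the chosen linear forms. With two
  socle monomials in three variables the Hilbert function need not be symmetric, so the
  \<open>sl\<^sub>2\<close> argument only gives injectivity on each box separately. This settles
  target degrees up to half the socle degree; past the middle the map is analysed directly. There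
  the number of monomials missing from \<open>G\<close> among those of \<open>z\<close>-degree 0
  decides the side: if few are missing, an alternating sequence would need more nonzero places than
  there are; if many are missing, one keeps just enough of them to obtain a square system, for which
  the same uniqueness gives solvability. On the negative side every linear form has to be excluded,
  also those with vanishing coefficients. So the counts use subspaces and quotients respected by all
  linear forms, and a form in which the coefficient of \<open>y\<close> or \<open>z\<close> vanishes
  is treated separately from the generic one.\<close>

abbreviation lookup where "lookup \<equiv> Poly_Mapping.lookup"
abbreviation keys where "keys \<equiv> Poly_Mapping.keys"
abbreviation single where "single \<equiv> Poly_Mapping.single"

subsection \<open>Linear systems\<close>

text \<open>Gaussian elimination, one equation per induction step: if its coefficient at
  \<open>s0\<close> is nonzero, the equation determines \<open>c s0\<close> and is substituted into
  the others. Functions on finite sets stand in for matrices, since rows and columns will be indexed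
  by monomials, by places of a sequence or by members of a chain of ideals.\<close>

lemma homogeneous_system_nontrivial:
  fixes M :: "'b \<Rightarrow> 'a \<Rightarrow> 'k::field"
  assumes "finite T" "finite S" "card T < card S"
  shows "\<exists>c. (\<forall>s. s \<notin> S \<longrightarrow> c s = 0) \<and> (\<exists>s\<in>S. c s \<noteq> 0) \<and> (\<forall>t\<in>T. (\<Sum>s\<in>S. M t s * c s) = 0)"
  using assms
proof (induction T arbitrary: S M rule: finite_induct)
  case empty
  then obtain s where "s \<in> S" by fastforce
  then show ?case by (intro exI[of _ "\<lambda>x. if x = s then 1 else 0"]) auto
next
  case (insert t T)
  show ?case
  proof (cases "\<forall>s\<in>S. M t s = 0")
    case True
    from insert have "card T < card S" by simp
    with insert.IH[OF insert.prems(1), of M] obtain c where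
      "\<forall>s. s \<notin> S \<longrightarrow> c s = 0" "\<exists>s\<in>S. c s \<noteq> 0" "\<forall>t\<in>T. (\<Sum>s\<in>S. M t s * c s) = 0" by blast
    with True show ?thesis by (intro exI[of _ c]) auto
  next
    case False
    then obtain s0 where s0: "s0 \<in> S" "M t s0 \<noteq> 0" by blast
    define S' where "S' = S - {s0}"
    have S': "finite S'" "card T < card S'" "s0 \<notin> S'" "S = insert s0 S'"
      using insert s0 by (auto simp: S'_def)
    obtain c where c: "\<forall>s. s \<notin> S' \<longrightarrow> c s = 0" "\<exists>s\<in>S'. c s \<noteq> 0"
      "\<forall>u\<in>T. (\<Sum>s\<in>S'. (M u s - M u s0 * M t s / M t s0) * c s) = 0"
      using insert.IH[OF S'(1,2), of "\<lambda>u s. M u s - M u s0 * M t s / M t s0"] by blast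
    define c0 where "c0 = - (\<Sum>s\<in>S'. M t s * c s) / M t s0"
    let ?c = "c(s0 := c0)"
    have sum: "(\<Sum>s\<in>S. M u s * ?c s) = M u s0 * c0 + (\<Sum>s\<in>S'. M u s * c s)" for u
      unfolding S'(4) using S'(1,3) by (auto intro!: arg_cong2[where f="(+)"] sum.cong)
    have "(\<Sum>s\<in>S. M u s * ?c s) = 0" if "u \<in> insert t T" for u
    proof (cases "u = t")
      case True
      have "M t s0 * c0 = - (\<Sum>s\<in>S'. M t s * c s)" using s0 by (simp add: c0_def)
      with True show ?thesis unfolding sum by simp
    next
      case False
      with that c(3) have "(\<Sum>s\<in>S'. (M u s - M u s0 * M t s / M t s0) * c s) = 0" by blast
      then have "(\<Sum>s\<in>S'. M u s * c s) = (\<Sum>s\<in>S'. M u s0 / M t s0 * (M t s * c s))"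
        by (simp add: left_diff_distrib sum_subtractf field_simps)
      also have "\<dots> = M u s0 / M t s0 * (\<Sum>s\<in>S'. M t s * c s)"
        by (simp add: sum_distrib_left)
      finally have "(\<Sum>s\<in>S'. M u s * c s) = - (M u s0 * c0)" by (simp add: c0_def)
      then show ?thesis unfolding sum by simp
    qed
    moreover have "\<exists>s\<in>S. ?c s \<noteq> 0" using c(2) S'(3,4) by fastforce
    moreover have "\<forall>s. s \<notin> S \<longrightarrow> ?c s = 0" using c(1) s0(1) S'(4) by auto
    ultimately show ?thesis by blast
  qed
qed

text \<open>The right-hand side enters as one more unknown \<open>None\<close>. A nontrivial
  solution of the enlarged homogeneous system exists by counting, injectivity prevents its
  \<open>None\<close> coordinate from vanishing, and dividing by that coordinate solves the given
  system.\<close>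

lemma square_system_solvable:
  fixes M :: "'b \<Rightarrow> 'a \<Rightarrow> 'k::field"
  assumes fin: "finite T" "finite S" and card: "card T \<le> card S"
    and inj: "\<And>c. (\<forall>s. s \<notin> S \<longrightarrow> c s = 0) \<Longrightarrow> (\<forall>t\<in>T. (\<Sum>s\<in>S. M t s * c s) = 0) \<Longrightarrow> \<forall>s\<in>S. c s = 0"
  shows "\<exists>c. (\<forall>s. s \<notin> S \<longrightarrow> c s = 0) \<and> (\<forall>t\<in>T. (\<Sum>s\<in>S. M t s * c s) = g t)"
proof -
  define S' where "S' = insert None (Some ` S)"
  have "finite S'" "card T < card S'"
    using fin card by (auto simp: S'_def card_image)
  then obtain c where c: "\<exists>s\<in>S'. c s \<noteq> 0"
    "\<forall>t\<in>T. (\<Sum>s\<in>S'. (case s of None \<Rightarrow> g t | Some s \<Rightarrow> M t s) * c s) = 0"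
    using homogeneous_system_nontrivial[OF fin(1), of S' "\<lambda>t s. case s of None \<Rightarrow> g t | Some s \<Rightarrow> M t s"]
    by blast
  have split: "(\<Sum>s\<in>S'. (case s of None \<Rightarrow> g t | Some s \<Rightarrow> M t s) * c s) =
      g t * c None + (\<Sum>s\<in>S. M t s * c (Some s))" for t
    using fin by (simp add: S'_def sum.reindex)
  define d where "d = (\<lambda>s. if s \<in> S then c (Some s) else 0)"
  have d: "(\<Sum>s\<in>S. M t s * c (Some s)) = (\<Sum>s\<in>S. M t s * d s)" for t
    by (simp add: d_def)
  have eq: "g t * c None + (\<Sum>s\<in>S. M t s * d s) = 0" if "t \<in> T" for t
    using c(2) that unfolding split d by blast
  have "c None \<noteq> 0"
  proof
    assume N: "c None = 0"
    then have "\<forall>s\<in>S. d s = 0" using eq by (intro inj) (auto simp: d_def)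
    then show False using c(1) N by (auto simp: S'_def d_def)
  qed
  moreover have "(\<Sum>s\<in>S. M t s * (- d s / c None)) = (- 1 / c None) * (\<Sum>s\<in>S. M t s * d s)" for t
    by (simp add: sum_distrib_left sum_negf sum_divide_distrib)
  ultimately have "(\<Sum>s\<in>S. M t s * (- d s / c None)) = g t" if "t \<in> T" for t
    using eq[OF that] by (metis (no_types, lifting) add_eq_0_iff minus_divide_left mult.commute
      mult.left_neutral mult_minus_left nonzero_mult_div_cancel_right times_divide_eq_left minus_minus)
  then show ?thesis by (intro exI[of _ "\<lambda>s. - d s / c None"]) (auto simp: d_def)
qed

subsection \<open>Polynomials and linear forms\<close>

lemma single_1_le_iff: "0 < lookup m i \<longleftrightarrow> (\<exists>b. m = single i (1::nat) + b)"
proof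
  assume *: "0 < lookup m i"
  have "m = single i 1 + (m - single i 1)"
    by (rule poly_mapping_eqI) (use * in \<open>auto simp: lookup_add lookup_minus lookup_single when_def\<close>)
  then show "\<exists>b. m = single i 1 + b" by blast
qed (auto simp: lookup_add)

lemma lookup_single_times:
  fixes f :: "('a::cancel_comm_monoid_add \<Rightarrow>\<^sub>0 'k::field)"
  shows "lookup (single a c * f) (a + b) = c * lookup f b"
proof -
  have "lookup (single a c * f) (a + b) = (\<Sum>l. (c when a = l) * (\<Sum>q. lookup f q when a + b = l + q))"
    by (simp add: lookup_mult lookup_single)
  also have "\<dots> = (\<Sum>l. (c * (\<Sum>q. lookup f q when a + b = l + q)) when a = l)"
    by (simp add: when_mult)
  also have "\<dots> = c * (\<Sum>q. lookup f q when a + b = a + q)" by simp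
  also have "\<dots> = c * lookup f b" by simp
  finally show ?thesis .
qed

lemma lookup_single_times_eq_0:
  fixes f :: "('a::cancel_comm_monoid_add \<Rightarrow>\<^sub>0 'k::field)"
  assumes "\<nexists>b. m = a + b"
  shows "lookup (single a c * f) m = 0"
proof (rule ccontr)
  assume "lookup (single a c * f) m \<noteq> 0"
  then have "m \<in> keys (single a c * f)" by (simp add: in_keys_iff)
  then obtain x b where "m = x + b" "x \<in> keys (single a c)"
    using keys_mult by blast
  with assms show False by (auto split: if_splits)
qed

definition lin_form :: "nat \<Rightarrow> (nat \<Rightarrow> 'k) \<Rightarrow> ('k::field) mpoly"
  where "lin_form r a = (\<Sum>i<r. single (single i 1) (a i))"

lemma lookup_lin_form_times:
  "lookup (lin_form r a * f) m =
    (\<Sum>i<r. a i * (if lookup m i = 0 then 0 else lookup f (m - single i 1)))"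
proof -
  have "lookup (single (single i 1) (a i) * f) m =
      a i * (if lookup m i = 0 then 0 else lookup f (m - single i 1))" for i
  proof (cases "lookup m i = 0")
    case True
    then show ?thesis using single_1_le_iff[of m i] by (simp add: lookup_single_times_eq_0)
  next
    case False
    then obtain b where "m = single i 1 + b" using single_1_le_iff[of m i] by auto
    with False show ?thesis by (simp add: lookup_single_times)
  qed
  then show ?thesis by (simp add: lin_form_def sum_distrib_right lookup_sum)
qed

lemma mono_degree_eq: "keys m \<subseteq> {..<r} \<Longrightarrow> mono_degree m = (\<Sum>i<r. lookup m i)"
  unfolding mono_degree_def by (rule sum.mono_neutral_left) (auto simp: in_keys_iff)

lemma mono_degree_add: "mono_degree (a + b) = mono_degree a + mono_degree b"
proof -
  define r where "r = Suc (Max (insert 0 (keys a \<union> keys b)))"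
  have *: "keys a \<union> keys b \<subseteq> {..<r}"
    by (auto simp: r_def less_Suc_eq_le)
  then have "keys (a + b) \<subseteq> {..<r}" using Poly_Mapping.keys_add[of a b] by blast
  with * show ?thesis
    by (simp add: mono_degree_eq[of _ r] lookup_add sum.distrib)
qed

lemma mono_degree_single [simp]: "mono_degree (single i n) = n"
  by (simp add: mono_degree_def)

lemma mono_degree_0 [simp]: "mono_degree 0 = 0"
  by (simp add: mono_degree_def)

lemma mono_degree_minus_single:
  "lookup m i \<noteq> 0 \<Longrightarrow> mono_degree m = Suc (mono_degree (m - single i 1))"
  using single_1_le_iff[of m i] by (auto simp: mono_degree_add)

lemma carrier_mpoly_ring: "p \<in> carrier (mpoly_ring r) \<longleftrightarrow> (\<forall>m\<in>keys p. keys m \<subseteq> {..<r})"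
  by (simp add: mpoly_ring_def)

lemma mpoly_ring_simps [simp]:
  "monoid.mult (mpoly_ring r) = (*)" "ring.add (mpoly_ring r) = (+)"
  "monoid.one (mpoly_ring r) = 1" "ring.zero (mpoly_ring r) = 0"
  by (simp_all add: mpoly_ring_def)

lemma forms_iff: "f \<in> forms r j \<longleftrightarrow> (\<forall>m\<in>keys f. keys m \<subseteq> {..<r} \<and> mono_degree m = j)"
  by (auto simp: forms_def carrier_mpoly_ring)

lemma forms_carrier: "f \<in> forms r j \<Longrightarrow> f \<in> carrier (mpoly_ring r)"
  by (simp add: forms_def)

lemma forms_mult:
  assumes "f \<in> forms r i" "g \<in> forms r j" shows "f * g \<in> forms r (i + j)"
  unfolding forms_iff
proof (intro ballI)
  fix m assume "m \<in> keys (f * g)"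
  then obtain a b where "m = a + b" "a \<in> keys f" "b \<in> keys g" using keys_mult[of f g] by blast
  with assms show "keys m \<subseteq> {..<r} \<and> mono_degree m = i + j"
    using Poly_Mapping.keys_add[of a b] by (fastforce simp: forms_iff mono_degree_add)
qed

lemma forms_add: "f \<in> forms r j \<Longrightarrow> g \<in> forms r j \<Longrightarrow> f + g \<in> forms r j"
  using Poly_Mapping.keys_add[of f g] by (fastforce simp: forms_iff)

lemma forms_0 [simp]: "0 \<in> forms r j"
  by (simp add: forms_iff)

lemma forms_uminus: "f \<in> forms r j \<Longrightarrow> -f \<in> forms r j"
  by (simp add: forms_iff)

lemma forms_diff: "f \<in> forms r j \<Longrightarrow> g \<in> forms r j \<Longrightarrow> f - g \<in> forms r j"
  using forms_add[of f r j "- g"] forms_uminus[of g r j] by simp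

lemma forms_sum: "(\<And>x. x \<in> S \<Longrightarrow> f x \<in> forms r j) \<Longrightarrow> (\<Sum>x\<in>S. f x) \<in> forms r j"
  by (induction S rule: infinite_finite_induct) (auto intro: forms_add)

lemma forms_single: "keys m \<subseteq> {..<r} \<Longrightarrow> mono_degree m = j \<Longrightarrow> single m c \<in> forms r j"
  by (simp add: forms_iff)

lemma forms_power: "f \<in> forms r i \<Longrightarrow> f ^ s \<in> forms r (i * s)"
proof (induction s)
  case 0
  show ?case by (simp add: forms_iff)
next
  case (Suc s)
  then show ?case using forms_mult[of f r i "f ^ s" "i * s"] by simp
qed

lemma forms_1_power: "L \<in> forms r 1 \<Longrightarrow> L ^ s \<in> forms r s"
  using forms_power[of L r 1 s] by simp

lemma lin_form_in_forms: "lin_form r a \<in> forms r 1"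
  unfolding lin_form_def by (intro forms_sum forms_single) auto

lemma mono_degree_1_iff: "mono_degree m = 1 \<longleftrightarrow> (\<exists>i. m = single i 1)"
proof
  assume *: "mono_degree m = 1"
  then obtain i where i: "i \<in> keys m" by (fastforce simp: mono_degree_def)
  then obtain b where b: "m = single i 1 + b" using single_1_le_iff[of m i] by (auto simp: in_keys_iff)
  with * have "mono_degree b = 0" by (simp add: mono_degree_add)
  then have "\<forall>a\<in>keys b. lookup b a = 0" unfolding mono_degree_def by simp
  then have "b = 0" by (metis in_keys_iff lookup_zero poly_mapping_eqI)
  with b show "\<exists>i. m = single i 1" by auto
qed auto

lemma single_1_eq_iff [simp]: "single i (Suc 0) = single l (Suc 0) \<longleftrightarrow> i = l"
  using keys_single[of i "Suc 0"] keys_single[of l "Suc 0"] by (metis nat.distinct(1) singleton_inject)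

lemma linear_form_eq:
  assumes "L \<in> forms r 1" shows "L = lin_form r (\<lambda>i. lookup L (single i 1))"
proof (rule poly_mapping_eqI)
  fix m
  have *: "lookup (lin_form r (\<lambda>i. lookup L (single i 1))) m = (\<Sum>i<r. if m = single i 1 then lookup L m else 0)"
    by (auto simp: lin_form_def lookup_sum lookup_single when_def intro!: sum.cong)
  show "lookup L m = lookup (lin_form r (\<lambda>i. lookup L (single i 1))) m"
  proof (cases "\<exists>i<r. m = single i 1")
    case True
    then obtain i where i: "i < r" "m = single i 1" by blast
    have "(\<Sum>l<r. if m = single l 1 then lookup L m else 0) = (\<Sum>l<r. if l = i then lookup L m else 0)"
    proof (rule sum.cong)
      fix l show "(if m = single l 1 then lookup L m else 0) = (if l = i then lookup L m else 0)"
        using i by auto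
    qed simp
    with i show ?thesis unfolding * by simp
  next
    case False
    then have "m \<notin> keys L" using assms mono_degree_1_iff[of m] by (fastforce simp: forms_iff)
    with False show ?thesis unfolding * by (auto simp: in_keys_iff)
  qed
qed

lemma poly_expand: "finite S \<Longrightarrow> keys f \<subseteq> S \<Longrightarrow> f = (\<Sum>m\<in>S. single m (lookup f m))"
proof (rule poly_mapping_eqI)
  fix k assume *: "finite S" "keys f \<subseteq> S"
  have "lookup (\<Sum>m\<in>S. single m (lookup f m)) k = (\<Sum>m\<in>S. if m = k then lookup f k else 0)"
    by (auto simp: lookup_sum lookup_single when_def intro!: sum.cong)
  with * show "lookup f k = lookup (\<Sum>m\<in>S. single m (lookup f m)) k"
    by (auto simp: in_keys_iff)
qed

text \<open>Multiplication by \<open>P\<close> as a matrix with columns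
  \<open>P * single m 1\<close>, the form in which the results on linear systems apply.\<close>

lemma lookup_times_expand:
  fixes P f :: "('k::field) mpoly"
  assumes "finite S" "keys f \<subseteq> S"
  shows "lookup (P * f) t = (\<Sum>m\<in>S. lookup (P * single m 1) t * lookup f m)"
proof -
  have "P * f = (\<Sum>m\<in>S. single 0 (lookup f m) * (P * single m 1))"
    by (subst poly_expand[OF assms]) (simp add: sum_distrib_left mult.left_commute mult_single)
  then have "lookup (P * f) t = (\<Sum>m\<in>S. lookup (single 0 (lookup f m) * (P * single m 1)) (0 + t))"
    by (simp add: lookup_sum)
  then show ?thesis
    by (simp only: lookup_single_times) (simp add: mult.commute)
qed

text \<open>Multiplication by \<open>P\<close> on \<open>R/I\<close>, where \<open>I\<close> is spanned by the monomials outside \<open>G\<close>.\<close>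

definition lef_inj :: "nat \<Rightarrow> (nat \<Rightarrow>\<^sub>0 nat) set \<Rightarrow> ('k::field) mpoly \<Rightarrow> nat \<Rightarrow> bool"
  where "lef_inj r G P j \<longleftrightarrow>
    (\<forall>f\<in>forms r j. (\<forall>m\<in>G. lookup (P * f) m = 0) \<longrightarrow> (\<forall>m\<in>G. lookup f m = 0))"

definition lef_surj :: "nat \<Rightarrow> (nat \<Rightarrow>\<^sub>0 nat) set \<Rightarrow> ('k::field) mpoly \<Rightarrow> nat \<Rightarrow> nat \<Rightarrow> bool"
  where "lef_surj r G P j k \<longleftrightarrow>
    (\<forall>g\<in>forms r k. \<exists>f\<in>forms r j. \<forall>m\<in>G. lookup (P * f) m = lookup g m)"

section \<open>The quotient by a monomial ideal in terms of coefficients\<close>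

definition avoiding :: "nat \<Rightarrow> (nat \<Rightarrow>\<^sub>0 nat) set \<Rightarrow> ('k::field) mpoly set"
  where "avoiding r G = {p \<in> carrier (mpoly_ring r). \<forall>m\<in>G. lookup p m = 0}"

definition down_closed :: "(nat \<Rightarrow>\<^sub>0 nat) set \<Rightarrow> bool"
  where "down_closed G \<longleftrightarrow> (\<forall>a b. a + b \<in> G \<longrightarrow> a \<in> G)"

lemma lookup_times_vanishes:
  assumes "down_closed G" "\<forall>m\<in>G. lookup p m = 0" "m \<in> G"
  shows "lookup (p * q) m = (0 :: 'k::field)"
proof (rule ccontr)
  assume "lookup (p * q) m \<noteq> 0"
  then have "m \<in> keys (p * q)" by (simp add: in_keys_iff)
  then obtain a b where "m = a + b" "a \<in> keys p" using keys_mult by blast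
  with assms show False by (auto simp: down_closed_def in_keys_iff)
qed

lemma ideal_avoiding:
  assumes "down_closed G"
  shows "ideal (avoiding r G) (mpoly_ring r :: ('k::field) mpoly ring)"
proof -
  interpret R: cring "mpoly_ring r :: 'k mpoly ring" by (rule mpoly_ring_cring)
  show ?thesis
  proof (rule idealI)
    show "ring (mpoly_ring r :: 'k mpoly ring)" by (rule R.ring_axioms)
    show "subgroup (avoiding r G) (add_monoid (mpoly_ring r :: 'k mpoly ring))"
    proof
      show "avoiding r G \<subseteq> carrier (add_monoid (mpoly_ring r :: 'k mpoly ring))"
        by (auto simp: avoiding_def)
      show "x \<otimes>\<^bsub>add_monoid (mpoly_ring r)\<^esub> y \<in> avoiding r G"
        if "x \<in> avoiding r G" "y \<in> avoiding r G" for x y :: "'k mpoly"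
        using that R.add.m_closed[of x y] by (auto simp: avoiding_def lookup_add)
      show "\<one>\<^bsub>add_monoid (mpoly_ring r)\<^esub> \<in> (avoiding r G :: 'k mpoly set)"
        using R.zero_closed by (auto simp: avoiding_def)
      fix x :: "'k mpoly" assume x: "x \<in> avoiding r G"
      then have "\<ominus>\<^bsub>mpoly_ring r\<^esub> x = - x"
        by (intro R.minus_equality) (auto simp: avoiding_def carrier_mpoly_ring)
      then have "inv\<^bsub>add_monoid (mpoly_ring r)\<^esub> x = - x" by (simp add: a_inv_def)
      with x show "inv\<^bsub>add_monoid (mpoly_ring r)\<^esub> x \<in> avoiding r G"
        by (auto simp: avoiding_def carrier_mpoly_ring)
    qed
    fix a x :: "'k mpoly" assume ax: "a \<in> avoiding r G" "x \<in> carrier (mpoly_ring r)"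
    then have "a * x \<in> avoiding r G"
      using R.m_closed[of a x] lookup_times_vanishes[OF assms] by (auto simp: avoiding_def)
    then show "x \<otimes>\<^bsub>mpoly_ring r\<^esub> a \<in> avoiding r G" "a \<otimes>\<^bsub>mpoly_ring r\<^esub> x \<in> avoiding r G"
      by (simp_all add: mult.commute)
  qed
qed

lemma mpoly_ring_minus:
  fixes f g :: "('k::field) mpoly"
  assumes "f \<in> carrier (mpoly_ring r)" "g \<in> carrier (mpoly_ring r)"
  shows "f \<ominus>\<^bsub>mpoly_ring r\<^esub> g = f - g"
proof -
  interpret R: cring "mpoly_ring r :: 'k mpoly ring" by (rule mpoly_ring_cring)
  have "\<ominus>\<^bsub>mpoly_ring r\<^esub> g = - g"
    using assms(2) by (intro R.minus_equality) (auto simp: carrier_mpoly_ring)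
  then show ?thesis by (simp add: a_minus_def)
qed

text \<open>Cosets are thereby identified with coefficient functions on \<open>G\<close>;
  computations in the quotient are reduced to coefficients in this way.\<close>

lemma residue_class_eq_iff:
  fixes f g :: "('k::field) mpoly"
  assumes "down_closed G" "f \<in> carrier (mpoly_ring r)" "g \<in> carrier (mpoly_ring r)"
  shows "residue_class r (avoiding r G) f = residue_class r (avoiding r G) g \<longleftrightarrow>
    (\<forall>m\<in>G. lookup f m = lookup g m)"
proof -
  interpret R: cring "mpoly_ring r :: 'k mpoly ring" by (rule mpoly_ring_cring)
  have "f - g \<in> carrier (mpoly_ring r)" using R.minus_closed[OF assms(2,3)] mpoly_ring_minus[OF assms(2,3)] by simp
  then show ?thesis
    using R.quotient_eq_iff_same_a_r_cos[OF ideal_avoiding[OF assms(1)] assms(2,3)]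
    by (auto simp: mpoly_ring_minus[OF assms(2,3)] avoiding_def lookup_minus)
qed

lemma residue_class_mult:
  fixes f g :: "('k::field) mpoly"
  assumes "down_closed G" "f \<in> carrier (mpoly_ring r)" "g \<in> carrier (mpoly_ring r)"
  shows "residue_class r (avoiding r G) f \<otimes>\<^bsub>quot_alg r (avoiding r G)\<^esub> residue_class r (avoiding r G) g =
    residue_class r (avoiding r G) (f * g)"
proof -
  interpret ideal "avoiding r G" "mpoly_ring r :: 'k mpoly ring" by (rule ideal_avoiding[OF assms(1)])
  show ?thesis using ring_hom_mult[OF rcos_ring_hom assms(2,3)] by simp
qed

lemma residue_class_add:
  fixes f g :: "('k::field) mpoly"
  assumes "down_closed G" "f \<in> carrier (mpoly_ring r)" "g \<in> carrier (mpoly_ring r)"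
  shows "residue_class r (avoiding r G) f \<oplus>\<^bsub>quot_alg r (avoiding r G)\<^esub> residue_class r (avoiding r G) g =
    residue_class r (avoiding r G) (f + g)"
proof -
  interpret ideal "avoiding r G" "mpoly_ring r :: 'k mpoly ring" by (rule ideal_avoiding[OF assms(1)])
  show ?thesis using ring_hom_add[OF rcos_ring_hom assms(2,3)] by simp
qed

lemma residue_class_pow:
  fixes f :: "('k::field) mpoly"
  assumes "down_closed G" "f \<in> carrier (mpoly_ring r)"
  shows "residue_class r (avoiding r G) f [^]\<^bsub>quot_alg r (avoiding r G)\<^esub> s = residue_class r (avoiding r G) (f ^ s)"
proof -
  interpret R: cring "mpoly_ring r :: 'k mpoly ring" by (rule mpoly_ring_cring)
  interpret ideal "avoiding r G" "mpoly_ring r :: 'k mpoly ring" by (rule ideal_avoiding[OF assms(1)])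
  interpret Q: ring "quot_alg r (avoiding r G :: 'k mpoly set)" by (rule quotient_is_ring)
  have c: "f ^ s \<in> carrier (mpoly_ring r)" for s
    by (induction s) (use R.one_closed R.m_closed[OF assms(2)] in auto)
  show ?thesis
  proof (induction s)
    case 0
    show ?case using ring_hom_one[OF rcos_ring_hom] by simp
  next
    case (Suc s)
    then show ?case by (simp add: residue_class_mult[OF assms(1) c assms(2)] mult.commute)
  qed
qed

text \<open>Injectivity on a set of cosets becomes triviality of the kernel because the difference
  of two forms of degree \<open>j\<close> is again such a form. For the image one inclusion is
  automatic, as \<open>L ^ s\<close> raises the degree by \<open>s\<close>.\<close>

lemma maximal_rank_iff:
  fixes L :: "('k::field) mpoly"
  assumes G: "down_closed G" and L: "L \<in> forms r 1"
  shows "maximal_rank r (avoiding r G) L s j \<longleftrightarrow> lef_inj r G (L ^ s) j \<or> lef_surj r G (L ^ s) j (j + s)"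
proof -
  let ?I = "avoiding r G :: 'k mpoly set"
  interpret R: cring "mpoly_ring r :: 'k mpoly ring" by (rule mpoly_ring_cring)
  have Ls: "L ^ s \<in> carrier (mpoly_ring r)" by (rule forms_carrier[OF forms_1_power[OF L]])
  let ?\<mu> = "\<lambda>a. (residue_class r ?I L [^]\<^bsub>quot_alg r ?I\<^esub> s) \<otimes>\<^bsub>quot_alg r ?I\<^esub> a"
  have \<mu>: "?\<mu> (residue_class r ?I f) = residue_class r ?I (L ^ s * f)" if "f \<in> forms r j" for f
    by (simp add: residue_class_pow[OF G forms_carrier[OF L]] residue_class_mult[OF G Ls forms_carrier[OF that]])
  have mc: "L ^ s * f \<in> forms r (j + s)" if "f \<in> forms r j" for f
    using forms_mult[OF forms_1_power[OF L, of s] that] by (simp add: add.commute)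
  have inj: "inj_on ?\<mu> (graded_part r ?I j) \<longleftrightarrow> lef_inj r G (L ^ s) j"
  proof
    assume inj: "inj_on ?\<mu> (graded_part r ?I j)"
    show "lef_inj r G (L ^ s) j" unfolding lef_inj_def
    proof (intro ballI impI)
      fix f m assume f: "f \<in> forms r j" and 0: "\<forall>m\<in>G. lookup (L ^ s * f) m = 0" and m: "m \<in> G"
      have "?\<mu> (residue_class r ?I f) = ?\<mu> (residue_class r ?I 0)"
        unfolding \<mu>[OF f] \<mu>[OF forms_0]
        using 0 residue_class_eq_iff[OF G forms_carrier[OF mc[OF f]] forms_carrier[OF mc[OF forms_0]]] by simp
      then have "residue_class r ?I f = residue_class r ?I 0"
        using inj f forms_0 unfolding inj_on_def graded_part_def by blast
      then show "lookup f m = 0"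
        using m residue_class_eq_iff[OF G forms_carrier[OF f] forms_carrier[OF forms_0]] by simp
    qed
  next
    assume *: "lef_inj r G (L ^ s) j"
    show "inj_on ?\<mu> (graded_part r ?I j)"
    proof (rule inj_onI)
      fix x y assume "x \<in> graded_part r ?I j" "y \<in> graded_part r ?I j" and eq: "?\<mu> x = ?\<mu> y"
      then obtain f g where f: "f \<in> forms r j" "x = residue_class r ?I f"
        and g: "g \<in> forms r j" "y = residue_class r ?I g" unfolding graded_part_def by blast
      have "\<forall>m\<in>G. lookup (L ^ s * f) m = lookup (L ^ s * g) m"
        using eq unfolding f(2) g(2) \<mu>[OF f(1)] \<mu>[OF g(1)]
          residue_class_eq_iff[OF G forms_carrier[OF mc[OF f(1)]] forms_carrier[OF mc[OF g(1)]]] .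
      then have "\<forall>m\<in>G. lookup (L ^ s * (f - g)) m = 0"
        by (simp add: right_diff_distrib lookup_minus)
      then have "\<forall>m\<in>G. lookup (f - g) m = 0"
        using * forms_diff[OF f(1) g(1)] unfolding lef_inj_def by blast
      then show "x = y" unfolding f(2) g(2)
        residue_class_eq_iff[OF G forms_carrier[OF f(1)] forms_carrier[OF g(1)]] by (simp add: lookup_minus)
    qed
  qed
  have sub: "?\<mu> ` graded_part r ?I j \<subseteq> graded_part r ?I (j + s)"
  proof
    fix x assume "x \<in> ?\<mu> ` graded_part r ?I j"
    then obtain f where f: "f \<in> forms r j" "x = ?\<mu> (residue_class r ?I f)"
      unfolding graded_part_def by blast
    show "x \<in> graded_part r ?I (j + s)"
      unfolding f(2) \<mu>[OF f(1)] graded_part_def using mc[OF f(1)] by blast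
  qed
  have surj: "?\<mu> ` graded_part r ?I j = graded_part r ?I (j + s) \<longleftrightarrow> lef_surj r G (L ^ s) j (j + s)"
  proof
    assume eq: "?\<mu> ` graded_part r ?I j = graded_part r ?I (j + s)"
    show "lef_surj r G (L ^ s) j (j + s)" unfolding lef_surj_def
    proof
      fix g :: "'k mpoly" assume g: "g \<in> forms r (j + s)"
      then have "residue_class r ?I g \<in> graded_part r ?I (j + s)" unfolding graded_part_def by blast
      then have "residue_class r ?I g \<in> ?\<mu> ` graded_part r ?I j" unfolding eq .
      then obtain f where f: "f \<in> forms r j" "residue_class r ?I g = ?\<mu> (residue_class r ?I f)"
        unfolding graded_part_def by blast
      from f(2) have "residue_class r ?I (L ^ s * f) = residue_class r ?I g" unfolding \<mu>[OF f(1)] ..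
      then have "\<forall>m\<in>G. lookup (L ^ s * f) m = lookup g m"
        unfolding residue_class_eq_iff[OF G forms_carrier[OF mc[OF f(1)]] forms_carrier[OF g]] .
      with f show "\<exists>f\<in>forms r j. \<forall>m\<in>G. lookup (L ^ s * f) m = lookup g m" by blast
    qed
  next
    assume *: "lef_surj r G (L ^ s) j (j + s)"
    have "graded_part r ?I (j + s) \<subseteq> ?\<mu> ` graded_part r ?I j"
    proof
      fix x assume "x \<in> graded_part r ?I (j + s)"
      then obtain g where g: "g \<in> forms r (j + s)" "x = residue_class r ?I g"
        unfolding graded_part_def by blast
      then obtain f where f: "f \<in> forms r j" "\<forall>m\<in>G. lookup (L ^ s * f) m = lookup g m"
        using * unfolding lef_surj_def by blast
      have "x = ?\<mu> (residue_class r ?I f)" unfolding g(2) \<mu>[OF f(1)]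
        using residue_class_eq_iff[OF G forms_carrier[OF mc[OF f(1)]] forms_carrier[OF g(1)]] f(2) by simp
      with f show "x \<in> ?\<mu> ` graded_part r ?I j" unfolding graded_part_def by blast
    qed
    with sub show "?\<mu> ` graded_part r ?I j = graded_part r ?I (j + s)" by blast
  qed
  show ?thesis unfolding maximal_rank_def Let_def inj surj ..
qed

subsection \<open>Monomial level algebras\<close>

lemma keys_add_nat: "keys (a + b) = keys a \<union> keys (b :: nat \<Rightarrow>\<^sub>0 nat)"
  by (auto simp: in_keys_iff lookup_add)

text \<open>\<open>G\<close> consists of the standard monomials, those divisible by no generator. A
  polynomial avoiding \<open>G\<close> lies in the ideal term by term, because each of its exponents
  is a multiple of that of a generator.\<close>

lemma monomial_ideal_imp_avoiding:
  fixes I :: "('k::field) mpoly set"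
  assumes "monomial_ideal r I"
  shows "\<exists>G \<subseteq> {m. keys m \<subseteq> {..<r}}. down_closed G \<and> I = avoiding r G"
proof -
  interpret R: cring "mpoly_ring r :: 'k mpoly ring" by (rule mpoly_ring_cring)
  obtain S where S: "S \<subseteq> monomials r" "I = Idl\<^bsub>mpoly_ring r\<^esub> S"
    using assms unfolding monomial_ideal_def by blast
  have Sc: "S \<subseteq> carrier (mpoly_ring r)"
    using S(1) by (auto simp: monomials_def carrier_mpoly_ring)
  then interpret I: ideal I "mpoly_ring r :: 'k mpoly ring"
    unfolding S(2) by (rule R.genideal_ideal)
  define N where "N = {m. keys m \<subseteq> {..<r} \<and> (\<exists>a b. m = a + b \<and> single a 1 \<in> S)}"
  define G where "G = {m. keys m \<subseteq> {..<r}} - N"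
  have dc: "down_closed G"
    unfolding down_closed_def
  proof (intro allI impI)
    fix a b assume "a + b \<in> G"
    moreover have "a + b \<in> N" if "a \<in> N" "keys b \<subseteq> {..<r}"
    proof -
      obtain c d where "keys a \<subseteq> {..<r}" "a = c + d" "single c 1 \<in> S" using \<open>a \<in> N\<close> unfolding N_def by blast
      then have "keys (a + b) \<subseteq> {..<r}" "a + b = c + (d + b)" "single c 1 \<in> S"
        using that(2) by (auto simp: keys_add_nat add.assoc)
      then show ?thesis unfolding N_def by blast
    qed
    ultimately show "a \<in> G" by (auto simp: G_def keys_add_nat)
  qed
  have "I \<subseteq> avoiding r G"
    unfolding S(2)
  proof (rule R.genideal_minimal[OF ideal_avoiding[OF dc]])
    show "S \<subseteq> avoiding r G"
    proof
      fix p assume p: "p \<in> S"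
      then obtain m where m: "p = single m 1" "keys m \<subseteq> {..<r}" using S(1) by (auto simp: monomials_def)
      have "m \<in> N" unfolding N_def using p m add.right_neutral[of m, symmetric] by blast
      then have "m \<notin> G" by (simp add: G_def)
      then show "p \<in> avoiding r G" using m Sc p
        by (auto simp: avoiding_def lookup_single when_def)
    qed
  qed
  moreover have "p \<in> I" if p: "p \<in> avoiding r G" for p
  proof -
    have mem: "single m (lookup p m) \<in> I" if "m \<in> keys p" for m
    proof -
      have "keys m \<subseteq> {..<r}" using p that unfolding avoiding_def carrier_mpoly_ring by blast
      moreover have "m \<notin> G" using p that unfolding avoiding_def in_keys_iff by blast
      ultimately have "m \<in> N" by (simp add: G_def)
      then obtain a b where ab: "m = a + b" "single a 1 \<in> S" "keys m \<subseteq> {..<r}" unfolding N_def by blast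
      have "single a 1 \<in> I" using R.genideal_self[OF Sc] ab(2) S(2) by blast
      moreover have "single b (lookup p m) \<in> carrier (mpoly_ring r)"
        using ab by (auto simp: carrier_mpoly_ring keys_add_nat)
      ultimately have "single a 1 \<otimes>\<^bsub>mpoly_ring r\<^esub> single b (lookup p m) \<in> I" by (rule I.I_r_closed)
      then show ?thesis by (simp add: mult_single ab(1))
    qed
    have "(\<Sum>m\<in>S. single m (lookup p m)) \<in> I" if "finite S" "S \<subseteq> keys p" for S
      using that
    proof (induction S rule: finite_induct)
      case empty
      show ?case using I.zero_closed by simp
    next
      case (insert m S)
      then show ?case using I.a_closed[of "single m (lookup p m)"] mem[of m] by simp
    qed
    from this[of "keys p"] have *: "(\<Sum>m\<in>keys p. single m (lookup p m)) \<in> I" by simp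
    show ?thesis by (subst poly_expand[OF finite_keys order_refl]) (rule *)
  qed
  ultimately show ?thesis using dc by (intro exI[of _ G]) (auto simp: G_def)
qed

lemma monomial_ideal_avoiding:
  assumes dc: "down_closed G"
  shows "monomial_ideal r (avoiding r G :: ('k::field) mpoly set)"
proof -
  interpret R: cring "mpoly_ring r :: 'k mpoly ring" by (rule mpoly_ring_cring)
  interpret I: ideal "avoiding r G" "mpoly_ring r :: 'k mpoly ring" by (rule ideal_avoiding[OF dc])
  define S :: "'k mpoly set" where "S = {single m 1 | m. keys m \<subseteq> {..<r} \<and> m \<notin> G}"
  have Sm: "S \<subseteq> monomials r" by (auto simp: S_def monomials_def)
  have Sa: "S \<subseteq> avoiding r G"
    by (auto simp: S_def avoiding_def carrier_mpoly_ring lookup_single when_def)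
  then have Sc: "S \<subseteq> carrier (mpoly_ring r)" using I.a_subset by blast
  interpret J: ideal "Idl\<^bsub>mpoly_ring r\<^esub> S" "mpoly_ring r :: 'k mpoly ring"
    by (rule R.genideal_ideal[OF Sc])
  have "avoiding r G \<subseteq> Idl\<^bsub>mpoly_ring r\<^esub> S"
  proof
    fix p :: "'k mpoly" assume p: "p \<in> avoiding r G"
    have mem: "single m (lookup p m) \<in> Idl\<^bsub>mpoly_ring r\<^esub> S" if "m \<in> keys p" for m
    proof -
      have "keys m \<subseteq> {..<r}" "m \<notin> G" using p that by (auto simp: avoiding_def carrier_mpoly_ring in_keys_iff)
      then have "single m 1 \<in> S" unfolding S_def by blast
      then have "single m 1 \<in> Idl\<^bsub>mpoly_ring r\<^esub> S" using R.genideal_self[OF Sc] by blast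
      moreover have "single 0 (lookup p m) \<in> carrier (mpoly_ring r)" by (auto simp: carrier_mpoly_ring)
      ultimately have "single m 1 \<otimes>\<^bsub>mpoly_ring r\<^esub> single 0 (lookup p m) \<in> Idl\<^bsub>mpoly_ring r\<^esub> S"
        by (rule J.I_r_closed)
      then show ?thesis by (simp add: mult_single)
    qed
    have "(\<Sum>m\<in>K. single m (lookup p m)) \<in> Idl\<^bsub>mpoly_ring r\<^esub> S" if "finite K" "K \<subseteq> keys p" for K
      using that
    proof (induction K rule: finite_induct)
      case empty
      show ?case using J.zero_closed by simp
    next
      case (insert m K)
      then show ?case using J.a_closed[of "single m (lookup p m)"] mem[of m] by simp
    qed
    from this[of "keys p"] have *: "(\<Sum>m\<in>keys p. single m (lookup p m)) \<in> Idl\<^bsub>mpoly_ring r\<^esub> S" by simp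
    show "p \<in> Idl\<^bsub>mpoly_ring r\<^esub> S" by (subst poly_expand[OF finite_keys order_refl]) (rule *)
  qed
  then have "avoiding r G = Idl\<^bsub>mpoly_ring r\<^esub> S"
    using R.genideal_minimal[OF ideal_avoiding[OF dc] Sa] by (rule antisym)
  then show ?thesis unfolding monomial_ideal_def by (intro exI[of _ S] conjI Sm)
qed

section \<open>The socle and its dimension\<close>

definition restr :: "(nat \<Rightarrow>\<^sub>0 nat) set \<Rightarrow> ('k::field) mpoly \<Rightarrow> 'k mpoly"
  where "restr G p = (\<Sum>m\<in>keys p \<inter> G. single m (lookup p m))"

lemma lookup_restr: "lookup (restr G p) m = (if m \<in> G then lookup p m else 0)"
proof -
  have "lookup (restr G p) m = (\<Sum>k\<in>keys p \<inter> G. if k = m then lookup p m else 0)"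
    by (auto simp: restr_def lookup_sum lookup_single when_def intro!: sum.cong)
  then show ?thesis by (auto simp: in_keys_iff)
qed

lemma keys_restr: "keys (restr G p) = keys p \<inter> G"
  by (auto simp: in_keys_iff lookup_restr split: if_splits)

lemma restr_forms: "f \<in> forms r j \<Longrightarrow> restr G f \<in> forms r j"
  by (auto simp: forms_iff keys_restr)

lemma carrier_quot:
  "carrier (quot_alg r (avoiding r G :: ('k::field) mpoly set)) =
    residue_class r (avoiding r G) ` carrier (mpoly_ring r)"
  unfolding FactRing_def partial_object.simps A_RCOSETS_def' by blast

lemma zero_quot:
  assumes "down_closed G"
  shows "\<zero>\<^bsub>quot_alg r (avoiding r G :: ('k::field) mpoly set)\<^esub> = residue_class r (avoiding r G) 0"
proof -
  interpret R: cring "mpoly_ring r :: 'k mpoly ring" by (rule mpoly_ring_cring)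
  interpret ideal "avoiding r G" "mpoly_ring r :: 'k mpoly ring" by (rule ideal_avoiding[OF assms])
  interpret h: ring_hom_ring "mpoly_ring r :: 'k mpoly ring" "quot_alg r (avoiding r G)" "residue_class r (avoiding r G)"
    by (rule rcos_ring_hom_ring)
  show ?thesis using h.hom_zero unfolding mpoly_ring_simps by (rule sym)
qed

definition corners :: "nat \<Rightarrow> (nat \<Rightarrow>\<^sub>0 nat) set \<Rightarrow> (nat \<Rightarrow>\<^sub>0 nat) set"
  where "corners r G = {m \<in> G. \<forall>i<r. m + single i 1 \<notin> G}"

text \<open>Multiplication by a variable only shifts exponents, so nothing cancels: an element is
  killed by all variables exactly if each of its standard monomials leaves \<open>G\<close> under
  each variable.\<close>

lemma socle_avoiding:
  assumes G: "down_closed G" "G \<subseteq> {m. keys m \<subseteq> {..<r}}"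
  shows "socle r (avoiding r G :: ('k::field) mpoly set) =
    residue_class r (avoiding r G) ` {p. keys p \<subseteq> corners r G}"
proof
  let ?I = "avoiding r G :: 'k mpoly set"
  interpret R: cring "mpoly_ring r :: 'k mpoly ring" by (rule mpoly_ring_cring)
  define V :: "'k mpoly set" where "V = (\<lambda>i. single (single i 1) 1) ` {..<r}"
  have Vc: "V \<subseteq> carrier (mpoly_ring r)" by (auto simp: V_def carrier_mpoly_ring)
  have irr: "irrelevant_ideal r = Idl\<^bsub>mpoly_ring r\<^esub> V" by (simp add: irrelevant_ideal_def V_def)
  have zc: "(0 :: 'k mpoly) \<in> carrier (mpoly_ring r)" by (simp add: carrier_mpoly_ring)
  show "socle r ?I \<subseteq> residue_class r ?I ` {p. keys p \<subseteq> corners r G}"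
  proof
    fix x assume x: "x \<in> socle r ?I"
    then obtain p where p: "p \<in> carrier (mpoly_ring r)" "x = residue_class r ?I p"
      by (auto simp: socle_def carrier_quot)
    have "m + single i 1 \<notin> G" if m: "m \<in> keys p" "i < r" for m i
    proof -
      let ?x = "single (single i 1) 1 :: 'k mpoly"
      have xi: "?x \<in> V" using m(2) by (auto simp: V_def)
      then have "?x \<in> irrelevant_ideal r" unfolding irr using R.genideal_self[OF Vc] by blast
      then have "residue_class r ?I ?x \<otimes>\<^bsub>quot_alg r ?I\<^esub> residue_class r ?I p = \<zero>\<^bsub>quot_alg r ?I\<^esub>"
        using x unfolding p(2) socle_def by blast
      then have "residue_class r ?I (?x * p) = residue_class r ?I 0"
        using residue_class_mult[OF G(1) _ p(1), of ?x] xi Vc zero_quot[OF G(1)] by fastforce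
      moreover have "?x * p \<in> carrier (mpoly_ring r)" using R.m_closed[of ?x p] xi Vc p(1) by auto
      ultimately have "\<forall>m\<in>G. lookup (?x * p) m = 0"
        using residue_class_eq_iff[OF G(1) _ zc] by fastforce
      moreover have "lookup (?x * p) (single i 1 + m) \<noteq> 0"
        unfolding lookup_single_times using m(1) by (simp add: in_keys_iff)
      ultimately show ?thesis by (metis add.commute)
    qed
    then have "keys (restr G p) \<subseteq> corners r G" by (auto simp: keys_restr corners_def)
    moreover have "restr G p \<in> carrier (mpoly_ring r)" using p(1) by (auto simp: carrier_mpoly_ring keys_restr)
    then have "x = residue_class r ?I (restr G p)"
      unfolding p(2) residue_class_eq_iff[OF G(1) p(1)] using residue_class_eq_iff[OF G(1) p(1)]
      by (simp add: lookup_restr)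
    ultimately show "x \<in> residue_class r ?I ` {p. keys p \<subseteq> corners r G}" by blast
  qed
  show "residue_class r ?I ` {p. keys p \<subseteq> corners r G} \<subseteq> socle r ?I"
  proof clarify
    fix p :: "'k mpoly" assume p: "keys p \<subseteq> corners r G"
    then have pc: "p \<in> carrier (mpoly_ring r)" using G(2) by (auto simp: carrier_mpoly_ring corners_def)
    have "a = 0" if "a + b = 0" for a b :: "nat \<Rightarrow>\<^sub>0 nat"
      using that keys_add_nat[of a b] by simp
    then have "down_closed {0}" unfolding down_closed_def by blast
    moreover have "single i (Suc 0) \<noteq> 0" for i :: nat
      by (metis lookup_single_eq lookup_zero nat.distinct(1))
    \<comment> \<open>\<open>avoiding r {0}\<close> is the ideal of polynomials without constant
      term; it contains the variables, hence the irrelevant ideal.\<close>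
    ultimately have "Idl\<^bsub>mpoly_ring r\<^esub> V \<subseteq> avoiding r {0}"
      by (intro R.genideal_minimal ideal_avoiding) (use Vc in \<open>auto simp: avoiding_def V_def lookup_single when_def\<close>)
    then have ii: "f \<in> carrier (mpoly_ring r)" "0 \<notin> keys f" if "f \<in> irrelevant_ideal r" for f :: "'k mpoly"
      using that unfolding irr avoiding_def by (auto simp: in_keys_iff)
    have "residue_class r ?I f \<otimes>\<^bsub>quot_alg r ?I\<^esub> residue_class r ?I p = \<zero>\<^bsub>quot_alg r ?I\<^esub>"
      if f: "f \<in> irrelevant_ideal r" for f
    proof -
      have "lookup (f * p) m = 0" if "m \<in> G" for m
      proof (rule ccontr)
        assume "lookup (f * p) m \<noteq> 0"
        then obtain a b where ab: "m = a + b" "a \<in> keys f" "b \<in> keys p"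
          using keys_mult[of f p] by (auto simp: in_keys_iff)
        with ii[OF f] have "a \<noteq> 0" by blast
        then obtain i where i: "lookup a i \<noteq> 0" by (metis lookup_zero poly_mapping_eqI)
        then obtain a' where a': "a = single i 1 + a'" using single_1_le_iff[of a i] by auto
        have "i \<in> keys a" using i by (simp add: in_keys_iff)
        then have "i < r" using ab(2) ii(1)[OF f] unfolding carrier_mpoly_ring by blast
        moreover have "m = (b + single i 1) + a'" by (simp add: ab a' ac_simps)
        then have "b + single i 1 \<in> G" using G(1) that unfolding down_closed_def by blast
        ultimately show False using p ab(3) by (auto simp: corners_def)
      qed
      moreover have "f * p \<in> carrier (mpoly_ring r)" using R.m_closed[OF ii(1)[OF f] pc] by simp
      ultimately have "residue_class r ?I (f * p) = residue_class r ?I 0"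
        using residue_class_eq_iff[OF G(1) _ zc] by fastforce
      then show ?thesis unfolding zero_quot[OF G(1)] residue_class_mult[OF G(1) ii(1)[OF f] pc] .
    qed
    then show "residue_class r ?I p \<in> socle r ?I"
      unfolding socle_def using pc by (auto simp: carrier_quot)
  qed
qed

lemma const_carrier: "single 0 c \<in> carrier (mpoly_ring r)"
  by (auto simp: carrier_mpoly_ring)

text \<open>Uniqueness of the dimension is a statement over a subfield, hence this verification. The
  assumption \<open>0 \<in> G\<close> keeps distinct constants distinct in the quotient.\<close>

lemma subfield_scalars:
  assumes G: "down_closed G" "0 \<in> G"
  shows "subfield (scalars r (avoiding r G)) (quot_alg r (avoiding r G :: ('k::field) mpoly set))"
proof -
  let ?I = "avoiding r G :: 'k mpoly set" and ?Q = "quot_alg r (avoiding r G :: 'k mpoly set)"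
  let ?c = "\<lambda>c::'k. residue_class r ?I (single 0 c)"
  interpret R: cring "mpoly_ring r :: 'k mpoly ring" by (rule mpoly_ring_cring)
  interpret ideal "avoiding r G" "mpoly_ring r :: 'k mpoly ring" by (rule ideal_avoiding[OF G(1)])
  interpret Q: cring ?Q by (rule quotient_is_cring[OF mpoly_ring_cring])
  have mul: "?c a \<otimes>\<^bsub>?Q\<^esub> ?c b = ?c (a * b)" for a b
    by (simp add: residue_class_mult[OF G(1) const_carrier const_carrier] mult_single)
  have add: "?c a \<oplus>\<^bsub>?Q\<^esub> ?c b = ?c (a + b)" for a b
    by (simp add: residue_class_add[OF G(1) const_carrier const_carrier] single_add)
  have one: "\<one>\<^bsub>?Q\<^esub> = ?c 1" using ring_hom_one[OF rcos_ring_hom] by simp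
  have zero: "\<zero>\<^bsub>?Q\<^esub> = ?c 0" using zero_quot[OF G(1)] by simp
  have inj: "?c a = ?c b \<longleftrightarrow> a = b" for a b
    using residue_class_eq_iff[OF G(1) const_carrier const_carrier, of r a b] G(2)
    by (auto simp: lookup_single when_def)
  have cc: "?c a \<in> carrier ?Q" for a unfolding carrier_quot using const_carrier by blast
  have neg: "\<ominus>\<^bsub>?Q\<^esub> ?c a = ?c (- a)" for a
    using cc by (intro Q.minus_equality) (auto simp: add zero)
  have sub: "subring (scalars r ?I) ?Q"
    by (rule Q.subringI) (use cc in \<open>auto simp: scalars_def mul add one neg simp del: single_one\<close>)
  show ?thesis
  proof (rule Q.subfieldI)
    show "subcring (scalars r ?I) ?Q" by (rule Q.subcringI'[OF sub])
    show "Units (?Q\<lparr>carrier := scalars r ?I\<rparr>) = scalars r ?I - {\<zero>\<^bsub>?Q\<^esub>}"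
    proof
      show "Units (?Q\<lparr>carrier := scalars r ?I\<rparr>) \<subseteq> scalars r ?I - {\<zero>\<^bsub>?Q\<^esub>}"
        by (auto simp: Units_def scalars_def mul one zero inj simp del: single_one single_zero)
      show "scalars r ?I - {\<zero>\<^bsub>?Q\<^esub>} \<subseteq> Units (?Q\<lparr>carrier := scalars r ?I\<rparr>)"
      proof
        fix x assume "x \<in> scalars r ?I - {\<zero>\<^bsub>?Q\<^esub>}"
        then obtain a where a: "x = ?c a" "a \<noteq> 0" unfolding scalars_def zero by blast
        then have "?c (inverse a) \<otimes>\<^bsub>?Q\<^esub> x = \<one>\<^bsub>?Q\<^esub>" "x \<otimes>\<^bsub>?Q\<^esub> ?c (inverse a) = \<one>\<^bsub>?Q\<^esub>"
          by (simp_all add: mul one del: single_one)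
        then show "x \<in> Units (?Q\<lparr>carrier := scalars r ?I\<rparr>)"
          unfolding Units_def using a(1) by (auto simp: scalars_def)
      qed
    qed
  qed
qed

text \<open>Adding a monomial to \<open>M\<close> is a \<open>line_extension\<close> of the span,
  and a proper one because the coefficient at the new monomial vanishes on the old span.\<close>

lemma dimension_monomial_span:
  assumes G: "down_closed G" "G \<subseteq> {m. keys m \<subseteq> {..<r}}" and M: "finite M" "M \<subseteq> G"
  shows "ring.dimension (quot_alg r (avoiding r G :: ('k::field) mpoly set)) (card M) (scalars r (avoiding r G))
    (residue_class r (avoiding r G) ` {p. keys p \<subseteq> M})"
  using M
proof (induction M rule: finite_induct)
  let ?I = "avoiding r G :: 'k mpoly set" and ?Q = "quot_alg r (avoiding r G :: 'k mpoly set)"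
  interpret R: cring "mpoly_ring r :: 'k mpoly ring" by (rule mpoly_ring_cring)
  interpret ideal "avoiding r G" "mpoly_ring r :: 'k mpoly ring" by (rule ideal_avoiding[OF G(1)])
  interpret Q: ring ?Q by (rule quotient_is_ring)
  have car: "p \<in> carrier (mpoly_ring r)" if "keys p \<subseteq> G" for p :: "'k mpoly"
    using that G(2) by (auto simp: carrier_mpoly_ring)
  {
    case empty
    then show ?case using Q.zero_dim[of "scalars r ?I"] by (simp add: zero_quot[OF G(1)])
  next
    case (insert m M)
    let ?E = "residue_class r ?I ` {p. keys p \<subseteq> M}"
    let ?v = "residue_class r ?I (single m 1)"
    have mc: "single m (1::'k) \<in> carrier (mpoly_ring r)" by (rule car) (use insert in simp)
    have vn: "?v \<notin> ?E"
    proof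
      assume "?v \<in> ?E"
      then obtain p where p: "keys p \<subseteq> M" "?v = residue_class r ?I p" by blast
      then have "lookup (single m 1) m = lookup p m"
        using residue_class_eq_iff[OF G(1) mc car[of p]] insert by blast
      moreover have "lookup p m = 0" using p(1) insert(2) by (auto simp: in_keys_iff)
      ultimately show False by simp
    qed
    have "Q.line_extension (scalars r ?I) ?v ?E = residue_class r ?I ` {p. keys p \<subseteq> insert m M}"
    proof
      show "Q.line_extension (scalars r ?I) ?v ?E \<subseteq> residue_class r ?I ` {p. keys p \<subseteq> insert m M}"
      proof
        fix x assume "x \<in> Q.line_extension (scalars r ?I) ?v ?E"
        then obtain c p where p: "keys p \<subseteq> M" and
          x: "x = residue_class r ?I (single 0 c) \<otimes>\<^bsub>?Q\<^esub> ?v \<oplus>\<^bsub>?Q\<^esub> residue_class r ?I p"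
          unfolding Q.line_extension_mem_iff scalars_def by blast
        have "x = residue_class r ?I (single m c + p)"
          unfolding x residue_class_mult[OF G(1) const_carrier mc]
          by (subst residue_class_add[OF G(1)]) (use p insert in \<open>auto intro!: car simp: mult_single split: if_splits\<close>)
        moreover have "keys (single m c + p) \<subseteq> insert m M"
          using Poly_Mapping.keys_add[of "single m c" p] p by (auto split: if_splits)
        ultimately show "x \<in> residue_class r ?I ` {p. keys p \<subseteq> insert m M}" by blast
      qed
      show "residue_class r ?I ` {p. keys p \<subseteq> insert m M} \<subseteq> Q.line_extension (scalars r ?I) ?v ?E"
      proof clarify
        fix p :: "'k mpoly" assume p: "keys p \<subseteq> insert m M"
        have eq: "p = single m (lookup p m) + restr M p"
          by (rule poly_mapping_eqI) (use p insert(2) in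
              \<open>auto simp: lookup_add lookup_single lookup_restr when_def in_keys_iff\<close>)
        have "residue_class r ?I p = residue_class r ?I (single 0 (lookup p m)) \<otimes>\<^bsub>?Q\<^esub> ?v \<oplus>\<^bsub>?Q\<^esub>
            residue_class r ?I (restr M p)"
          unfolding residue_class_mult[OF G(1) const_carrier mc] using insert
          by (subst eq, subst residue_class_add[OF G(1)]) (auto intro!: car simp: mult_single keys_restr split: if_splits)
        moreover have "keys (restr M p) \<subseteq> M" by (simp add: keys_restr)
        ultimately show "residue_class r ?I p \<in> Q.line_extension (scalars r ?I) ?v ?E"
          unfolding Q.line_extension_mem_iff scalars_def by blast
      qed
    qed
    moreover have "?v \<in> carrier ?Q" unfolding carrier_quot using mc by blast
    ultimately show ?case
      using Q.Suc_dim[OF _ vn insert.IH] insert by simp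
  }
qed

section \<open>The Artinian condition as finiteness of the monomial basis\<close>

lemma add_diff_if_le: "(\<And>i. lookup a i \<le> lookup c i) \<Longrightarrow> c = a + (c - (a :: nat \<Rightarrow>\<^sub>0 nat))"
  by (rule poly_mapping_eqI) (simp add: lookup_add lookup_minus)

lemma finite_bounded_exponents: "finite {m :: nat \<Rightarrow>\<^sub>0 nat. keys m \<subseteq> {..<r} \<and> (\<forall>i<r. lookup m i \<le> B)}"
proof -
  let ?F = "{f. \<forall>i. (i \<in> {..<r} \<longrightarrow> f i \<in> {..B}) \<and> (i \<notin> {..<r} \<longrightarrow> f i = (0::nat))}"
  have "finite ?F" by (rule finite_set_of_finite_funs) auto
  moreover have "lookup ` {m. keys m \<subseteq> {..<r} \<and> (\<forall>i<r. lookup m i \<le> B)} \<subseteq> ?F"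
    by (auto simp: in_keys_iff)
  moreover have "inj_on lookup {m :: nat \<Rightarrow>\<^sub>0 nat. keys m \<subseteq> {..<r} \<and> (\<forall>i<r. lookup m i \<le> B)}"
    by (auto intro!: inj_onI poly_mapping_eqI)
  ultimately show ?thesis by (meson finite_imageD finite_subset)
qed

text \<open>For each variable the ideals generated by its powers form a descending chain in the
  quotient; the one for the power \<open>n\<close> consists of the polynomials avoiding the
  monomials of \<open>G\<close> with exponent below \<open>n\<close>. Once the chain is stationary,
  a power of the variable is outside \<open>G\<close>, and bounded exponents leave finitely many
  monomials.\<close>

lemma artinian_imp_finite:
  assumes G: "down_closed G" "G \<subseteq> {m. keys m \<subseteq> {..<r}}"
    and A: "artinian_ring (quot_alg r (avoiding r G :: ('k::field) mpoly set))"
  shows "finite G"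
proof -
  let ?I = "avoiding r G :: 'k mpoly set"
  interpret R: cring "mpoly_ring r :: 'k mpoly ring" by (rule mpoly_ring_cring)
  have "\<exists>N. single i N \<notin> G" if i: "i < r" for i
  proof -
    define H where "H n = {m \<in> G. lookup m i < n}" for n
    have H: "down_closed (H n)" for n
      using G(1) by (auto simp: H_def down_closed_def lookup_add)
    define J where "J n = residue_class r ?I ` avoiding r (H n)" for n
    have "ideal (J n) (quot_alg r ?I)" for n
      unfolding J_def by (rule R.ring_ideal_imp_quot_ideal[OF ideal_avoiding[OF G(1)] ideal_avoiding[OF H]])
    moreover have "J (Suc n) \<subseteq> J n" for n
      unfolding J_def by (rule image_mono) (auto simp: avoiding_def H_def)
    ultimately obtain N where N: "\<forall>n\<ge>N. J n = J N" using A unfolding artinian_ring_def by meson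
    have "single i N \<notin> G"
    proof
      assume iN: "single i N \<in> G"
      let ?p = "single (single i N) 1 :: 'k mpoly"
      have pc: "?p \<in> carrier (mpoly_ring r)" using iN G(2) by (auto simp: carrier_mpoly_ring)
      have "?p \<in> avoiding r (H N)" using pc by (auto simp: avoiding_def H_def lookup_single when_def)
      then have "residue_class r ?I ?p \<in> J (Suc N)" using N unfolding J_def by (metis image_eqI le_Suc_eq order_refl)
      then obtain q where q: "q \<in> avoiding r (H (Suc N))" "residue_class r ?I ?p = residue_class r ?I q"
        unfolding J_def by blast
      then have "lookup ?p (single i N) = lookup q (single i N)"
        using residue_class_eq_iff[OF G(1) pc, of q] iN by (auto simp: avoiding_def)
      moreover have "lookup q (single i N) = 0" using q(1) iN by (auto simp: avoiding_def H_def)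
      ultimately show False by simp
    qed
    then show ?thesis by blast
  qed
  then obtain N where N: "\<And>i. i < r \<Longrightarrow> single i (N i) \<notin> G" by metis
  have "lookup m i \<le> (\<Sum>i<r. N i)" if m: "m \<in> G" and i: "i < r" for m i
  proof -
    have "lookup m i < N i"
    proof (rule ccontr)
      assume "\<not> lookup m i < N i"
      then have "m = single i (N i) + (m - single i (N i))"
        by (intro add_diff_if_le) (auto simp: lookup_single when_def)
      with m G(1) have "single i (N i) \<in> G" unfolding down_closed_def by metis
      with N[OF i] show False by blast
    qed
    also have "N i \<le> (\<Sum>i<r. N i)" using i by (intro member_le_sum) auto
    finally show ?thesis by simp
  qed
  then have "G \<subseteq> {m. keys m \<subseteq> {..<r} \<and> (\<forall>i<r. lookup m i \<le> (\<Sum>i<r. N i))}" using G(2) by blast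
  then show ?thesis using finite_bounded_exponents by (rule finite_subset)
qed

text \<open>A chain with infinitely many strict steps provides \<open>card G + 1\<close> elements,
  each lost at the next step. They satisfy a nontrivial linear relation modulo the ideal, and the
  term of least index in it is a combination of elements of smaller ideals, hence was not
  lost.\<close>

lemma finite_imp_artinian:
  assumes G: "down_closed G" "finite G"
  shows "artinian_ring (quot_alg r (avoiding r G :: ('k::field) mpoly set))"
proof -
  let ?I = "avoiding r G :: 'k mpoly set" and ?Q = "quot_alg r (avoiding r G :: 'k mpoly set)"
  interpret R: cring "mpoly_ring r :: 'k mpoly ring" by (rule mpoly_ring_cring)
  interpret I: ideal ?I "mpoly_ring r" by (rule ideal_avoiding[OF G(1)])
  interpret h: ring_hom_ring "mpoly_ring r :: 'k mpoly ring" ?Q "residue_class r ?I"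
    by (rule I.rcos_ring_hom_ring)
  have "\<exists>N. \<forall>n\<ge>N. J n = J N" if J: "\<And>n. ideal (J n) ?Q" "\<And>n. J (Suc n) \<subseteq> J n" for J :: "nat \<Rightarrow> 'k mpoly set set"
  proof (rule ccontr)
    assume no: "\<nexists>N. \<forall>n\<ge>N. J n = J N"
    have mono: "J n \<subseteq> J m" if "m \<le> n" for m n using J(2) that by (rule lift_Suc_antimono_le)
    define P where "P n = {p \<in> carrier (mpoly_ring r). residue_class r ?I p \<in> J n}" for n
    have P: "ideal (P n) (mpoly_ring r)" for n unfolding P_def by (rule h.ideal_vimage[OF J(1)])
    have Pmono: "P n \<subseteq> P m" if "m \<le> n" for m n using mono[OF that] by (auto simp: P_def)
    have ex: "\<exists>n\<ge>N. J (Suc n) \<noteq> J n" for N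
    proof (rule ccontr)
      assume *: "\<not> (\<exists>n\<ge>N. J (Suc n) \<noteq> J n)"
      have "J n = J N" if "n \<ge> N" for n
        using that by (induction n rule: dec_induct) (use * in auto)
      with no show False by blast
    qed
    have inf: "infinite {n. J (Suc n) \<noteq> J n}"
      unfolding infinite_nat_iff_unbounded_le using ex by blast
    obtain S where S: "finite S" "card S = Suc (card G)" "S \<subseteq> {n. J (Suc n) \<noteq> J n}"
      using infinite_arbitrarily_large[OF inf, of "Suc (card G)"] by blast
    have "\<exists>p. p \<in> P n - P (Suc n)" if "n \<in> S" for n
    proof -
      obtain x where x: "x \<in> J n" "x \<notin> J (Suc n)" using S(3) J(2) \<open>n \<in> S\<close> by blast
      then have "x \<in> carrier ?Q" using ideal.Icarr[OF J(1)] by blast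
      with x show ?thesis unfolding carrier_quot P_def by blast
    qed
    then obtain p where p: "\<And>n. n \<in> S \<Longrightarrow> p n \<in> P n - P (Suc n)" by metis
    obtain c where c: "\<exists>n\<in>S. c n \<noteq> 0" "\<forall>m\<in>G. (\<Sum>n\<in>S. lookup (p n) m * c n) = 0"
      using homogeneous_system_nontrivial[OF G(2) S(1), of "\<lambda>m n. lookup (p n) m"] S(2) by auto
    define n0 where "n0 = Min {n \<in> S. c n \<noteq> 0}"
    have "n0 \<in> {n \<in> S. c n \<noteq> 0}" unfolding n0_def by (rule Min_in) (use S(1) c(1) in auto)
    then have n0: "n0 \<in> S" "c n0 \<noteq> 0" by auto
    have min: "n0 \<le> n" if "n \<in> S" "c n \<noteq> 0" for n
      unfolding n0_def by (rule Min_le) (use that S(1) in auto)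
    interpret P': ideal "P (Suc n0)" "mpoly_ring r :: 'k mpoly ring" by (rule P)
    have scal: "single 0 a * q \<in> P (Suc n0)" if "q \<in> P (Suc n0)" for a q
      using P'.I_l_closed[OF that const_carrier[of a]] by simp
    have mem: "single 0 (c n) * p n \<in> P (Suc n0)" if "n \<in> S - {n0}" for n
    proof (cases "c n = 0")
      case True
      then show ?thesis using P'.zero_closed by simp
    next
      case False
      then have "Suc n0 \<le> n" using min[of n] that by auto
      then have "p n \<in> P (Suc n0)" using p[of n] that Pmono by blast
      then show ?thesis by (rule scal)
    qed
    have "(\<Sum>n\<in>K. single 0 (c n) * p n) \<in> P (Suc n0)" if "finite K" "K \<subseteq> S - {n0}" for K
      using that
    proof (induction K rule: finite_induct)
      case empty
      show ?case using P'.zero_closed by simp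
    next
      case (insert n K)
      then show ?case using P'.a_closed[of "single 0 (c n) * p n"] mem[of n] by simp
    qed
    then have q: "(\<Sum>n\<in>S - {n0}. single 0 (c n) * p n) \<in> P (Suc n0)" (is "?q \<in> _") using S(1) by simp
    define a where "a = - inverse (c n0)"
    have aq: "single 0 a * ?q \<in> P (Suc n0)" by (rule scal[OF q])
    have scalar: "lookup (single 0 b * f) m = b * lookup f m" for b :: 'k and f :: "'k mpoly" and m
      using lookup_single_times[of 0 b f m] by simp
    have "lookup (p n0) m = lookup (single 0 a * ?q) m" if "m \<in> G" for m
    proof -
      have "lookup ?q m = (\<Sum>n\<in>S - {n0}. lookup (p n) m * c n)"
        unfolding lookup_sum scalar by (simp add: mult.commute)
      also have "\<dots> = - (lookup (p n0) m * c n0)"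
        using c(2) that sum.remove[OF S(1) n0(1), of "\<lambda>n. lookup (p n) m * c n"]
        by (simp add: eq_neg_iff_add_eq_0 add.commute)
      finally show ?thesis unfolding scalar a_def using n0(2) by simp
    qed
    moreover have pc: "p n0 \<in> carrier (mpoly_ring r)" using p[OF n0(1)] unfolding P_def by blast
    moreover have qc: "single 0 a * ?q \<in> carrier (mpoly_ring r)" using aq unfolding P_def by blast
    ultimately have eq: "residue_class r ?I (p n0) = residue_class r ?I (single 0 a * ?q)"
      unfolding residue_class_eq_iff[OF G(1) pc qc] by blast
    have "residue_class r ?I (p n0) \<in> J (Suc n0)" unfolding eq using aq unfolding P_def by blast
    then have "p n0 \<in> P (Suc n0)" using pc unfolding P_def by blast
    with p[OF n0(1)] show False by blast
  qed
  then show ?thesis unfolding artinian_ring_def using I.quotient_is_ring by blast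
qed

section \<open>Level algebras and their socle monomials\<close>

definition below :: "(nat \<Rightarrow>\<^sub>0 nat) set \<Rightarrow> (nat \<Rightarrow>\<^sub>0 nat) set"
  where "below C = {m. \<exists>c\<in>C. \<forall>i. lookup m i \<le> lookup c i}"

lemma below_iff: "m \<in> below C \<longleftrightarrow> (\<exists>c\<in>C. \<exists>b. c = m + b)"
proof
  assume "m \<in> below C"
  then obtain c where "c \<in> C" "\<And>i. lookup m i \<le> lookup c i" unfolding below_def by blast
  then show "\<exists>c\<in>C. \<exists>b. c = m + b" using add_diff_if_le[of m c] by blast
next
  assume "\<exists>c\<in>C. \<exists>b. c = m + b"
  then show "m \<in> below C" by (auto simp: below_def lookup_add) (metis le_add1 lookup_add)
qed

lemma down_closed_below: "down_closed (below C)"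
  unfolding down_closed_def below_iff by (metis add.assoc)

lemma below_keys: "C \<subseteq> {m. keys m \<subseteq> {..<r}} \<Longrightarrow> below C \<subseteq> {m. keys m \<subseteq> {..<r}}"
  unfolding below_iff subset_iff by (auto simp: keys_add_nat)

lemma finite_below:
  assumes "finite C" "C \<subseteq> {m. keys m \<subseteq> {..<r}}" shows "finite (below C)"
proof -
  have "below C \<subseteq> {m. keys m \<subseteq> {..<r} \<and> (\<forall>i<r. lookup m i \<le> (\<Sum>c\<in>C. \<Sum>i<r. lookup c i))}"
  proof
    fix m assume m: "m \<in> below C"
    then obtain c where c: "c \<in> C" "\<And>i. lookup m i \<le> lookup c i" unfolding below_def by blast
    have "lookup m i \<le> (\<Sum>c\<in>C. \<Sum>i<r. lookup c i)" if "i < r" for i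
    proof -
      have "lookup m i \<le> lookup c i" by (rule c(2))
      also have "\<dots> \<le> (\<Sum>i<r. lookup c i)" using that by (intro member_le_sum) auto
      also have "\<dots> \<le> (\<Sum>c\<in>C. \<Sum>i<r. lookup c i)" using c(1) assms(1) by (intro member_le_sum) auto
      finally show ?thesis .
    qed
    then show "m \<in> {m. keys m \<subseteq> {..<r} \<and> (\<forall>i<r. lookup m i \<le> (\<Sum>c\<in>C. \<Sum>i<r. lookup c i))}"
      using below_keys[OF assms(2)] m by blast
  qed
  then show ?thesis using finite_bounded_exponents by (rule finite_subset)
qed

lemma mono_degree_mono: "(\<And>i. lookup a i \<le> lookup c i) \<Longrightarrow> mono_degree a \<le> mono_degree c"
  using add_diff_if_le[of a c] mono_degree_add[of a "c - a"] by simp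

text \<open>The set \<open>C\<close> consists of the socle monomials.\<close>

lemma level_imp_below:
  fixes I :: "('k::field) mpoly set"
  assumes lev: "monomial_artinian_level r d I" and r: "r \<ge> 1"
  shows "\<exists>C e. finite C \<and> card C = d \<and> C \<subseteq> {m. keys m \<subseteq> {..<r} \<and> mono_degree m = e} \<and> I = avoiding r (below C)"
proof -
  obtain G where G: "down_closed G" "G \<subseteq> {m. keys m \<subseteq> {..<r}}" and I: "I = avoiding r G"
    using lev monomial_ideal_imp_avoiding unfolding monomial_artinian_level_def by blast
  have fin: "finite G"
    using artinian_imp_finite[OF G] lev unfolding monomial_artinian_level_def I by blast
  \<comment> \<open>Otherwise the ideal is the whole ring and contains the first variable, which
    exists because \<open>r \<ge> 1\<close>.\<close>
  have "0 \<in> G"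
  proof (rule ccontr)
    assume "0 \<notin> G"
    then have "m \<notin> G" for m using G(1) unfolding down_closed_def by (metis add.left_neutral)
    then have "single (single 0 1) 1 \<in> I \<inter> forms r 1"
      using r unfolding I by (auto simp: avoiding_def carrier_mpoly_ring intro!: forms_single)
    then have "single (single 0 1) 1 = (0 :: 'k mpoly)" using lev unfolding monomial_artinian_level_def by blast
    then show False by (metis lookup_single_eq lookup_zero one_neq_zero)
  qed
  have lt: "level_of_type r d I" using lev unfolding monomial_artinian_level_def by blast
  let ?C = "corners r G"
  have CG: "?C \<subseteq> G" by (auto simp: corners_def)
  have finC: "finite ?C" using CG fin by (rule finite_subset)
  interpret ideal "avoiding r G" "mpoly_ring r :: 'k mpoly ring" by (rule ideal_avoiding[OF G(1)])
  interpret Q: ring "quot_alg r (avoiding r G :: 'k mpoly set)" by (rule quotient_is_ring)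
  have "Q.dimension (card ?C) (scalars r I) (socle r I)"
    unfolding I socle_avoiding[OF G] by (rule dimension_monomial_span[OF G finC CG])
  moreover have "Q.dimension d (scalars r I) (socle r I)" using lt unfolding level_of_type_def I by blast
  ultimately have card: "card ?C = d"
    using Q.dimension_is_inj[OF subfield_scalars[OF G(1) \<open>0 \<in> G\<close>]] unfolding I by blast
  obtain e where e: "socle r I \<subseteq> graded_part r I e" using lt unfolding level_of_type_def by blast
  have deg: "mono_degree m = e" if m: "m \<in> ?C" for m
  proof -
    have mc: "single m (1::'k) \<in> carrier (mpoly_ring r)" using m CG G(2) by (auto simp: carrier_mpoly_ring)
    have "residue_class r I (single m 1) \<in> socle r I"
      unfolding I socle_avoiding[OF G] using m by (intro imageI) auto
    then obtain f where f: "f \<in> forms r e" "residue_class r I (single m 1) = residue_class r I f"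
      using e unfolding graded_part_def by blast
    then have "lookup f m = 1"
      using residue_class_eq_iff[OF G(1) mc forms_carrier[OF f(1)]] m CG unfolding I by fastforce
    then have "m \<in> keys f" by (simp add: in_keys_iff)
    then show ?thesis using f(1) by (auto simp: forms_iff)
  qed
  \<comment> \<open>Multiplying by variables inside \<open>G\<close> has to stop, since degrees in
    the finite set \<open>G\<close> are bounded, and it can stop only at a corner.\<close>
  have up: "\<exists>c\<in>?C. \<exists>b. c = m + b" if "m \<in> G" for m
    using that
  proof (induction "Max (mono_degree ` G) - mono_degree m" arbitrary: m rule: less_induct)
    case less
    show ?case
    proof (cases "m \<in> ?C")
      case True
      then show ?thesis by (metis add.right_neutral)
    next
      case False
      then obtain i where i: "i < r" "m + single i 1 \<in> G" using less.prems by (auto simp: corners_def)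
      have "mono_degree (m + single i 1) \<le> Max (mono_degree ` G)" using i(2) fin by simp
      then have "Max (mono_degree ` G) - mono_degree (m + single i 1) < Max (mono_degree ` G) - mono_degree m"
        by (simp add: mono_degree_add)
      from less.hyps[OF this i(2)] show ?thesis by (metis add.assoc)
    qed
  qed
  have "G = below ?C"
    using up CG G(1) unfolding below_iff set_eq_iff down_closed_def by blast
  then show ?thesis using finC card deg CG G(2) I by (intro exI[of _ ?C] exI[of _ e]) auto
qed

text \<open>Monomials of equal degree do not divide one another properly, so \<open>C\<close> is the
  full set of corners. The assumption \<open>all\<close> puts every variable into \<open>G\<close>,
  which excludes linear forms from the ideal.\<close>

lemma level_below:
  assumes C: "finite C" "card C = d" "C \<subseteq> {m. keys m \<subseteq> {..<r} \<and> mono_degree m = e}"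
    and all: "\<And>i. i < r \<Longrightarrow> \<exists>c\<in>C. lookup c i \<noteq> 0"
  shows "monomial_artinian_level r d (avoiding r (below C) :: ('k::field) mpoly set)"
proof -
  let ?G = "below C"
  have Ck: "C \<subseteq> {m. keys m \<subseteq> {..<r}}" using C(3) by blast
  have G: "down_closed ?G" "?G \<subseteq> {m. keys m \<subseteq> {..<r}}" "finite ?G"
    using down_closed_below below_keys[OF Ck] finite_below[OF C(1) Ck] by auto
  have CG: "C \<subseteq> ?G" by (auto simp: below_def)
  have corners: "corners r ?G = C"
  proof
    show "corners r ?G \<subseteq> C"
    proof
      fix m assume m: "m \<in> corners r ?G"
      then obtain c b where cb: "c \<in> C" "c = m + b" by (auto simp: corners_def below_iff)
      have "b = 0"
      proof (rule ccontr)
        assume "b \<noteq> 0"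
        then obtain i where i: "lookup b i \<noteq> 0" by (metis lookup_zero poly_mapping_eqI)
        then obtain b' where b': "b = single i 1 + b'" using single_1_le_iff[of b i] by auto
        have "i \<in> keys c" using i cb(2) by (simp add: keys_add_nat in_keys_iff)
        then have "i < r" using Ck cb(1) by blast
        moreover have "m + single i 1 \<in> ?G" unfolding below_iff using cb b' by (metis add.assoc)
        ultimately show False using m by (auto simp: corners_def)
      qed
      then show "m \<in> C" using cb by simp
    qed
    show "C \<subseteq> corners r ?G"
    proof
      fix c assume c: "c \<in> C"
      have "c + single i 1 \<notin> ?G" for i
      proof
        assume "c + single i 1 \<in> ?G"
        then obtain c' b where "c' \<in> C" "c' = c + single i 1 + b" unfolding below_iff by blast
        then have "mono_degree c' = mono_degree c + 1 + mono_degree b" "mono_degree c' = e"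
          using C(3) by (auto simp: mono_degree_add)
        then show False using C(3) c by auto
      qed
      then show "c \<in> corners r ?G" using c CG by (auto simp: corners_def)
    qed
  qed
  have "f = 0" if f: "f \<in> avoiding r ?G" "f \<in> forms r 1" for f :: "'k mpoly"
  proof (rule poly_mapping_eqI)
    fix m
    show "lookup f m = lookup 0 m"
    proof (rule ccontr)
      assume "lookup f m \<noteq> lookup 0 m"
      then have m: "m \<in> keys f" by (simp add: in_keys_iff)
      then have *: "keys m \<subseteq> {..<r}" "mono_degree m = 1" using f(2) by (auto simp: forms_iff)
      then obtain i where i: "m = single i 1" unfolding mono_degree_1_iff by blast
      with * have "i < r" by simp
      then obtain c where "c \<in> C" "lookup c i \<noteq> 0" using all by blast
      then have "m \<in> ?G" unfolding below_def i by (auto simp: lookup_single when_def intro!: bexI[of _ c])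
      with m f(1) show False by (auto simp: avoiding_def in_keys_iff)
    qed
  qed
  moreover have "level_of_type r d (avoiding r ?G :: 'k mpoly set)"
    unfolding level_of_type_def
  proof
    show "ring.dimension (quot_alg r (avoiding r ?G)) d (scalars r (avoiding r ?G)) (socle r (avoiding r ?G :: 'k mpoly set))"
      unfolding socle_avoiding[OF G(1,2)] corners
      using dimension_monomial_span[OF G(1,2) C(1) CG] C(2) by blast
    have "{p. keys p \<subseteq> C} \<subseteq> forms r e" using C(3) by (fastforce simp: forms_iff)
    then show "\<exists>e. socle r (avoiding r ?G :: 'k mpoly set) \<subseteq> graded_part r (avoiding r ?G) e"
      unfolding socle_avoiding[OF G(1,2)] corners graded_part_def by blast
  qed
  ultimately show ?thesis unfolding monomial_artinian_level_def
    using monomial_ideal_avoiding[OF G(1)] finite_imp_artinian[OF G(1,3)] by blast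
qed

subsection \<open>Counting obstructions\<close>

definition graded :: "(nat \<Rightarrow>\<^sub>0 nat) set \<Rightarrow> nat \<Rightarrow> (nat \<Rightarrow>\<^sub>0 nat) set"
  where "graded G j = {m \<in> G. mono_degree m = j}"

lemma scale_lookup: "lookup (single 0 c * f) m = c * lookup f (m :: nat \<Rightarrow>\<^sub>0 nat)" for c :: "'k::field"
  using lookup_single_times[of 0 c f m] by simp

lemma scale_forms: "f \<in> forms r j \<Longrightarrow> single 0 c * f \<in> forms r j"
  using forms_mult[of "single 0 c" r 0 f j] by (simp add: forms_single)

lemma lookup_times_restr:
  assumes "down_closed G" "m \<in> G"
  shows "lookup (P * restr G f) m = lookup (P * f) m"
proof -
  have "lookup ((f - restr G f) * P) m = 0"
    by (rule lookup_times_vanishes[OF assms(1) _ assms(2)]) (simp add: lookup_minus lookup_restr)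
  then show ?thesis by (simp add: algebra_simps lookup_minus)
qed

lemma forms_lookup_0: "f \<in> forms r j \<Longrightarrow> mono_degree m \<noteq> j \<Longrightarrow> lookup f m = 0"
  by (auto simp: forms_iff in_keys_iff)

text \<open>Inside the algebra the span of \<open>S\<close> is mapped into the span of
  \<open>N\<close>, so a smaller \<open>N\<close> forces a kernel element supported on
  \<open>S\<close>.\<close>

lemma not_inj_by_count:
  fixes P :: "('k::field) mpoly"
  assumes fin: "finite S" "finite N" and card: "card N < card S"
    and S: "S \<subseteq> graded G j" "G \<subseteq> {m. keys m \<subseteq> {..<r}}"
    and nb: "\<And>s t. s \<in> S \<Longrightarrow> t \<in> G - N \<Longrightarrow> lookup (P * single s 1) t = 0"
  shows "\<not> lef_inj r G P j"
proof
  assume inj: "lef_inj r G P j"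
  obtain c where c: "\<exists>s\<in>S. c s \<noteq> 0" "\<forall>t\<in>N. (\<Sum>s\<in>S. lookup (P * single s 1) t * c s) = 0"
    using homogeneous_system_nontrivial[OF fin(2,1) card, of "\<lambda>t s. lookup (P * single s 1) t"] by blast
  define f where "f = (\<Sum>s\<in>S. single s (c s))"
  have lf: "lookup f s = (if s \<in> S then c s else 0)" for s
    using fin(1) by (simp add: f_def lookup_sum lookup_single when_def)
  have kf: "keys f \<subseteq> S" by (auto simp: in_keys_iff lf split: if_splits)
  have "f \<in> forms r j" using kf S by (fastforce simp: forms_iff graded_def)
  moreover have "lookup (P * f) t = 0" if "t \<in> G" for t
  proof -
    have "lookup (P * f) t = (\<Sum>s\<in>S. lookup (P * single s 1) t * c s)"
      unfolding lookup_times_expand[OF fin(1) kf] by (simp add: lf)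
    also have "\<dots> = 0" using c(2) nb that by (cases "t \<in> N") auto
    finally show ?thesis .
  qed
  ultimately have "\<forall>m\<in>G. lookup f m = 0" using inj unfolding lef_inj_def by blast
  moreover obtain s where s: "s \<in> S" "c s \<noteq> 0" using c(1) by blast
  then have "s \<in> G" using S(1) by (auto simp: graded_def)
  ultimately have "lookup f s = 0" by blast
  with s show False by (simp add: lf)
qed

text \<open>The dual count: the coordinates of \<open>P * f\<close> at \<open>S\<close> are
  controlled by those of \<open>f\<close> at \<open>N\<close>. Preimages of the monomials in
  \<open>S\<close> would have a nontrivial combination vanishing on \<open>N\<close>, and its image
  would have to vanish on \<open>S\<close>.\<close>

lemma not_surj_by_count:
  fixes P :: "('k::field) mpoly"
  assumes fin: "finite S" "finite N" and card: "card N < card S"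
    and S: "S \<subseteq> graded G k" "G \<subseteq> {m. keys m \<subseteq> {..<r}}"
    and nb: "\<And>f t. f \<in> forms r j \<Longrightarrow> \<forall>m\<in>N. lookup f m = 0 \<Longrightarrow> t \<in> S \<Longrightarrow> lookup (P * f) t = 0"
  shows "\<not> lef_surj r G P j k"
proof
  assume surj: "lef_surj r G P j k"
  have "\<exists>f\<in>forms r j. \<forall>m\<in>G. lookup (P * f) m = lookup (single t 1) m" if "t \<in> S" for t
  proof -
    have "single t 1 \<in> forms r k" using that S by (intro forms_single) (auto simp: graded_def)
    then show ?thesis using surj unfolding lef_surj_def by blast
  qed
  then obtain f where f: "\<And>t. t \<in> S \<Longrightarrow> f t \<in> forms r j"
    "\<And>t m. t \<in> S \<Longrightarrow> m \<in> G \<Longrightarrow> lookup (P * f t) m = lookup (single t 1) m" by metis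
  obtain c where c: "\<exists>t\<in>S. c t \<noteq> 0" "\<forall>m\<in>N. (\<Sum>t\<in>S. lookup (f t) m * c t) = 0"
    using homogeneous_system_nontrivial[OF fin(2,1) card, of "\<lambda>m t. lookup (f t) m"] by blast
  define F where "F = (\<Sum>t\<in>S. single 0 (c t) * f t)"
  have "F \<in> forms r j" unfolding F_def by (intro forms_sum scale_forms f)
  moreover have "\<forall>m\<in>N. lookup F m = 0" using c(2) unfolding F_def lookup_sum scale_lookup by (simp add: mult.commute)
  ultimately have 0: "lookup (P * F) t = 0" if "t \<in> S" for t using nb that by blast
  have "lookup (P * F) t = c t" if "t \<in> S" for t
  proof -
    have tG: "t \<in> G" using that S by (auto simp: graded_def)
    have "P * F = (\<Sum>u\<in>S. single 0 (c u) * (P * f u))" by (simp add: F_def sum_distrib_left mult.left_commute)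
    then have "lookup (P * F) t = (\<Sum>u\<in>S. c u * lookup (P * f u) t)" by (simp add: lookup_sum scale_lookup)
    also have "\<dots> = (\<Sum>u\<in>S. if u = t then c u else 0)"
      by (rule sum.cong) (auto simp: f(2) tG lookup_single when_def)
    finally show ?thesis using that fin(1) by simp
  qed
  with 0 c(1) show False by auto
qed

text \<open>A surjection from a space of dimension at most that of its target has no kernel.
  Concretely, the kernel element \<open>f0\<close> together with preimages of all target monomials
  are too many vectors to be independent in degree \<open>j\<close>.\<close>

lemma not_inj_imp_not_surj:
  fixes P :: "('k::field) mpoly"
  assumes G: "down_closed G" "finite G" "G \<subseteq> {m. keys m \<subseteq> {..<r}}"
    and card: "card (graded G j) \<le> card (graded G k)" and ninj: "\<not> lef_inj r G P j"
  shows "\<not> lef_surj r G P j k"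
proof
  assume surj: "lef_surj r G P j k"
  obtain f0 m0 where f0: "f0 \<in> forms r j" "\<And>m. m \<in> G \<Longrightarrow> lookup (P * f0) m = 0"
    and m0: "m0 \<in> G" "lookup f0 m0 \<noteq> 0" using ninj unfolding lef_inj_def by blast
  have "\<exists>f\<in>forms r j. \<forall>m\<in>G. lookup (P * f) m = lookup (single t 1) m" if "t \<in> graded G k" for t
  proof -
    have "single t 1 \<in> forms r k" using that G(3) by (intro forms_single) (auto simp: graded_def)
    then show ?thesis using surj unfolding lef_surj_def by blast
  qed
  then obtain f where f: "\<And>t. t \<in> graded G k \<Longrightarrow> f t \<in> forms r j"
    "\<And>t m. t \<in> graded G k \<Longrightarrow> m \<in> G \<Longrightarrow> lookup (P * f t) m = lookup (single t 1) m" by metis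
  define S where "S = insert None (Some ` graded G k)"
  have finG: "finite (graded G i)" for i using G(2) by (simp add: graded_def)
  then have S: "finite S" "card (graded G j) < card S" using card by (auto simp: S_def card_image)
  define h where "h t = (case t of None \<Rightarrow> f0 | Some t \<Rightarrow> f t)" for t
  have h: "h t \<in> forms r j" if "t \<in> S" for t using that f0 f by (auto simp: h_def S_def)
  obtain c where c: "\<exists>t\<in>S. c t \<noteq> 0" "\<forall>m\<in>graded G j. (\<Sum>t\<in>S. lookup (h t) m * c t) = 0"
    using homogeneous_system_nontrivial[OF finG S, of "\<lambda>m t. lookup (h t) m"] by blast
  define F where "F = (\<Sum>t\<in>S. single 0 (c t) * h t)"
  have Ff: "F \<in> forms r j" unfolding F_def by (intro forms_sum scale_forms h)
  have F0: "lookup F m = 0" if "m \<in> G" for m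
  proof (cases "mono_degree m = j")
    case True
    then have "m \<in> graded G j" using that by (simp add: graded_def)
    then have "(\<Sum>t\<in>S. lookup (h t) m * c t) = 0" using c(2) by blast
    then show ?thesis unfolding F_def lookup_sum scale_lookup by (simp add: mult.commute)
  next
    case False
    then show ?thesis by (rule forms_lookup_0[OF Ff])
  qed
  have PF: "lookup (P * F) m = 0" if "m \<in> G" for m
    using lookup_times_vanishes[OF G(1), of F m P] F0 that by (simp add: mult.commute)
  have "c (Some t) = 0" if t: "t \<in> graded G k" for t
  proof -
    have tG: "t \<in> G" using t by (simp add: graded_def)
    have "P * F = (\<Sum>u\<in>S. single 0 (c u) * (P * h u))" by (simp add: F_def sum_distrib_left mult.left_commute)
    then have "lookup (P * F) t = (\<Sum>u\<in>S. c u * lookup (P * h u) t)" by (simp add: lookup_sum scale_lookup)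
    also have "\<dots> = (\<Sum>u\<in>S. if u = Some t then c u else 0)"
      by (rule sum.cong) (auto simp: f(2) f0(2) tG S_def h_def lookup_single when_def)
    also have "\<dots> = c (Some t)" using t S(1) by (simp add: S_def)
    finally show ?thesis using PF[OF tG] by simp
  qed
  then have "F = single 0 (c None) * f0" and "c None \<noteq> 0"
    using c(1) finG by (auto simp: F_def S_def sum.reindex h_def)
  then show False using F0[OF m0(1)] m0(2) by (simp add: scale_lookup)
qed

text \<open>The standard monomials are bases of the graded parts, so the comparison of cardinalities
  says that there are at most as many equations as unknowns.\<close>

lemma lef_inj_imp_surj:
  fixes P :: "('k::field) mpoly"
  assumes G: "finite G" "G \<subseteq> {m. keys m \<subseteq> {..<r}}"
    and P: "P \<in> forms r s" and card: "card (graded G (j + s)) \<le> card (graded G j)" and inj: "lef_inj r G P j"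
  shows "lef_surj r G P j (j + s)"
  unfolding lef_surj_def
proof
  fix g :: "'k mpoly" assume g: "g \<in> forms r (j + s)"
  have fin: "finite (graded G i)" for i using G(1) by (simp add: graded_def)
  define F where "F c = (\<Sum>s\<in>graded G j. single s (c s))" for c :: "_ \<Rightarrow> 'k"
  have lF: "lookup (F c) m = (if m \<in> graded G j then c m else 0)" for c m
    using fin by (simp add: F_def lookup_sum lookup_single when_def)
  have Ff: "F c \<in> forms r j" for c
    unfolding F_def using G(2) by (intro forms_sum forms_single) (auto simp: graded_def)
  have PF: "lookup (P * F c) t = (\<Sum>s\<in>graded G j. lookup (P * single s 1) t * c s)" for c t
    by (subst lookup_times_expand[OF fin]) (auto simp: lF in_keys_iff split: if_splits)
  have PFf: "P * F c \<in> forms r (j + s)" for c using forms_mult[OF P Ff] by (simp add: add.commute)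
  have "\<exists>c. (\<forall>s. s \<notin> graded G j \<longrightarrow> c s = 0) \<and>
      (\<forall>t\<in>graded G (j + s). (\<Sum>s\<in>graded G j. lookup (P * single s 1) t * c s) = lookup g t)"
  proof (rule square_system_solvable[OF fin fin card])
    fix c assume *: "\<forall>t\<in>graded G (j + s). (\<Sum>s\<in>graded G j. lookup (P * single s 1) t * c s) = 0"
    have "lookup (P * F c) m = 0" if "m \<in> G" for m
      using * that forms_lookup_0[OF PFf] unfolding PF[symmetric] by (cases "mono_degree m = j + s") (auto simp: graded_def)
    then have "\<forall>m\<in>G. lookup (F c) m = 0" using inj Ff unfolding lef_inj_def by blast
    then show "\<forall>s\<in>graded G j. c s = 0" by (auto simp: lF graded_def)
  qed
  then obtain c where c: "\<forall>t\<in>graded G (j + s). lookup (P * F c) t = lookup g t" unfolding PF by blast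
  have "lookup (P * F c) m = lookup g m" if "m \<in> G" for m
    using c that forms_lookup_0[OF PFf] forms_lookup_0[OF g] by (cases "mono_degree m = j + s") (auto simp: graded_def)
  then show "\<exists>f\<in>forms r j. \<forall>m\<in>G. lookup (P * f) m = lookup g m" using Ff by blast
qed

subsection \<open>Boxes\<close>

text \<open>Multiplication by a linear form and the lowering operator of the tensor product of the irreducible
  \<open>sl\<^sub>2\<close>-modules with highest weights \<open>g i\<close>; their commutator acts on each degree by the weight.\<close>

definition raise :: "nat \<Rightarrow> (nat \<Rightarrow> 'k) \<Rightarrow> ((nat \<Rightarrow>\<^sub>0 nat) \<Rightarrow> 'k) \<Rightarrow> (nat \<Rightarrow>\<^sub>0 nat) \<Rightarrow> 'k::field"
  where "raise r a \<phi> m = (\<Sum>i<r. a i * (if lookup m i = 0 then 0 else \<phi> (m - single i 1)))"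

definition lower :: "nat \<Rightarrow> (nat \<Rightarrow> 'k) \<Rightarrow> (nat \<Rightarrow>\<^sub>0 nat) \<Rightarrow> ((nat \<Rightarrow>\<^sub>0 nat) \<Rightarrow> 'k) \<Rightarrow> (nat \<Rightarrow>\<^sub>0 nat) \<Rightarrow> 'k::field"
  where "lower r a g \<phi> m =
    (\<Sum>i<r. inverse (a i) * of_nat (lookup m i + 1) * (of_nat (lookup g i) - of_nat (lookup m i)) * \<phi> (m + single i 1))"

lemma lookup_lin_form_power_times: "lookup (lin_form r a ^ s * f) = (raise r a ^^ s) (lookup f)"
proof (induction s)
  case (Suc s)
  have "lookup (lin_form r a ^ Suc s * f) = lookup (lin_form r a * (lin_form r a ^ s * f))"
    by (simp add: mult.assoc)
  also have "\<dots> = raise r a (lookup (lin_form r a ^ s * f))"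
    by (rule ext) (simp add: lookup_lin_form_times raise_def)
  finally show ?case using Suc by simp
qed simp

lemma raise_linear: "raise r a (\<lambda>m. \<phi> m + c * \<psi> m) m = raise r a \<phi> m + c * raise r a \<psi> m"
  unfolding raise_def sum_distrib_left sum.distrib[symmetric] by (rule sum.cong) (auto simp: algebra_simps)

text \<open>Raising in one variable commutes with lowering in another, so these terms cancel. In a
  single variable the difference is \<open>(m + 1) * (g - m) - m * (g - m + 1) = g - 2 * m\<close>,
  the weight. The factor \<open>inverse (a i)\<close> removes the dependence on the linear
  form.\<close>

lemma lower_raise_commutator:
  fixes a :: "nat \<Rightarrow> 'k::field_char_0"
  assumes a: "\<forall>i<r. a i \<noteq> 0"
  shows "lower r a g (raise r a \<phi>) m =
    raise r a (lower r a g \<phi>) m + ((\<Sum>i<r. of_nat (lookup g i)) - 2 * (\<Sum>i<r. of_nat (lookup m i))) * \<phi> m"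
proof -
  define A where "A i l = inverse (a i) * of_nat (lookup m i + 1) * (of_nat (lookup g i) - of_nat (lookup m i)) *
    (a l * (if lookup (m + single i 1) l = 0 then 0 else \<phi> (m + single i 1 - single l 1)))" for i l
  define B where "B i l = a l * (if lookup m l = 0 then 0 else inverse (a i) * of_nat (lookup (m - single l 1) i + 1) *
    (of_nat (lookup g i) - of_nat (lookup (m - single l 1) i)) * \<phi> (m - single l 1 + single i 1))" for i l
  have AB: "A i l = B i l + (if l = i then (of_nat (lookup g i) - 2 * of_nat (lookup m i)) * \<phi> m else 0)"
    if "i < r" "l < r" for i l
  proof (cases "l = i")
    case True
    have *: "m + single i 1 - single i 1 = m" by (rule poly_mapping_eqI) (simp add: lookup_add lookup_minus)
    have **: "m - single i 1 + single i 1 = m" if "lookup m i \<noteq> 0"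
      using that by (intro poly_mapping_eqI) (auto simp: lookup_add lookup_minus lookup_single when_def)
    have A: "A i i = of_nat (lookup m i + 1) * (of_nat (lookup g i) - of_nat (lookup m i)) * \<phi> m"
      using a that(1) by (simp add: A_def * lookup_add)
    have B: "B i i = of_nat (lookup m i) * (of_nat (lookup g i) - of_nat (lookup m i) + 1) * \<phi> m"
    proof (cases "lookup m i")
      case (Suc n)
      then have "of_nat (lookup (m - single i 1) i + 1) = (of_nat (lookup m i) :: 'k)"
        "of_nat (lookup (m - single i 1) i) = (of_nat (lookup m i) - 1 :: 'k)"
        by (simp_all add: lookup_minus)
      then show ?thesis using a that(1) Suc ** by (simp add: B_def del: of_nat_add)
    qed (simp add: B_def)
    show ?thesis unfolding True A B by (simp add: algebra_simps)
  next
    case False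
    then have l: "lookup (m + single i 1) l = lookup m l" "lookup (m - single l 1) i = lookup m i"
      by (simp_all add: lookup_add lookup_minus lookup_single when_def)
    have "m + single i 1 - single l 1 = m - single l 1 + single i 1" if "lookup m l \<noteq> 0"
      using that False by (intro poly_mapping_eqI) (auto simp: lookup_add lookup_minus lookup_single when_def)
    with False show ?thesis unfolding A_def B_def l by simp
  qed
  have "lower r a g (raise r a \<phi>) m = (\<Sum>i<r. \<Sum>l<r. A i l)"
    unfolding lower_def raise_def A_def sum_distrib_left ..
  also have "\<dots> = (\<Sum>i<r. \<Sum>l<r. B i l + (if l = i then (of_nat (lookup g i) - 2 * of_nat (lookup m i)) * \<phi> m else 0))"
    by (intro sum.cong) (auto simp: AB)
  also have "\<dots> = (\<Sum>i<r. \<Sum>l<r. B i l) + (\<Sum>i<r. (of_nat (lookup g i) - 2 * of_nat (lookup m i)) * \<phi> m)"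
    by (simp add: sum.distrib)
  also have "(\<Sum>i<r. \<Sum>l<r. B i l) = raise r a (lower r a g \<phi>) m"
    unfolding raise_def lower_def by (subst sum.swap) (auto simp: B_def sum_distrib_left intro!: sum.cong simp del: One_nat_def)
  also have "(\<Sum>i<r. (of_nat (lookup g i) - 2 * of_nat (lookup m i)) * \<phi> m) =
      ((\<Sum>i<r. of_nat (lookup g i)) - 2 * (\<Sum>i<r. of_nat (lookup m i))) * \<phi> m"
    by (simp add: sum_distrib_right[symmetric] sum_subtractf sum_distrib_left[symmetric])
  finally show ?thesis .
qed

section \<open>Homogeneous functions and powers of the raising operator\<close>

definition homog :: "nat \<Rightarrow> nat \<Rightarrow> ((nat \<Rightarrow>\<^sub>0 nat) \<Rightarrow> 'k::zero) \<Rightarrow> bool"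
  where "homog r j \<phi> \<longleftrightarrow> (\<forall>m. \<phi> m \<noteq> 0 \<longrightarrow> (\<Sum>i<r. lookup m i) = j)"

lemma sum_lookup_add_single: "i < r \<Longrightarrow> (\<Sum>l<r. lookup (m + single i (1::nat)) l) = Suc (\<Sum>l<r. lookup m l)"
  for i r :: nat
proof -
  assume "i < r"
  have "(\<Sum>l<r. lookup (m + single i 1) l) = (\<Sum>l<r. lookup m l + (if l = i then 1 else 0))"
    by (rule sum.cong) (auto simp: lookup_add lookup_single when_def)
  also have "\<dots> = Suc (\<Sum>l<r. lookup m l)" using \<open>i < r\<close> by (simp add: sum.distrib)
  finally show ?thesis .
qed

lemma homog_raise:
  assumes "homog r j \<phi>" shows "homog r (Suc j) (raise r a \<phi>)"
  unfolding homog_def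
proof (intro allI impI)
  fix m assume "raise r a \<phi> m \<noteq> 0"
  then obtain i where i: "i < r" "lookup m i \<noteq> 0" "\<phi> (m - single i 1) \<noteq> 0"
    unfolding raise_def by (auto elim!: sum.not_neutral_contains_not_neutral split: if_splits)
  from i(2) obtain b where "m = single i 1 + b" using single_1_le_iff[of m i] by auto
  then have b: "m = b + single i 1" by (simp add: add.commute)
  then have "\<phi> b \<noteq> 0" using i(3) by simp
  then show "(\<Sum>i<r. lookup m i) = Suc j"
    using assms unfolding b sum_lookup_add_single[OF i(1)] homog_def by simp
qed

lemma homog_raise_pow: "homog r j \<phi> \<Longrightarrow> homog r (j + s) ((raise r a ^^ s) \<phi>)"
  by (induction s) (auto intro: homog_raise)

lemma homog_lower:
  assumes "homog r (Suc j) \<phi>" shows "homog r j (lower r a g \<phi>)"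
  unfolding homog_def
proof (intro allI impI)
  fix m assume "lower r a g \<phi> m \<noteq> 0"
  then obtain i where i: "i < r" "\<phi> (m + single i 1) \<noteq> 0"
    unfolding lower_def by (auto elim!: sum.not_neutral_contains_not_neutral)
  then show "(\<Sum>i<r. lookup m i) = j"
    using assms sum_lookup_add_single[OF i(1), of m] unfolding homog_def by fastforce
qed

lemma lower_homog_0:
  assumes "homog r 0 \<phi>" shows "lower r a g \<phi> m = 0"
proof -
  have "\<phi> (m + single i 1) = 0" if "i < r" for i
    using assms sum_lookup_add_single[OF that, of m] unfolding homog_def by fastforce
  then show ?thesis by (simp add: lower_def)
qed

lemma homog_weight:
  fixes \<phi> :: "(nat \<Rightarrow>\<^sub>0 nat) \<Rightarrow> 'k::field"
  assumes "homog r j \<phi>"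
  shows "(\<Sum>i<r. of_nat (lookup m i)) * \<phi> m = of_nat j * \<phi> m"
proof (cases "\<phi> m = 0")
  case False
  then have "(\<Sum>i<r. lookup m i) = j" using assms unfolding homog_def by blast
  then have "(\<Sum>i<r. of_nat (lookup m i)) = (of_nat j :: 'k)" by (simp flip: of_nat_sum)
  then show ?thesis by simp
qed simp

lemma lower_raise_homog:
  fixes a :: "nat \<Rightarrow> 'k::field_char_0"
  assumes a: "\<forall>i<r. a i \<noteq> 0" and \<phi>: "homog r j \<phi>"
  shows "lower r a g (raise r a \<phi>) m =
    raise r a (lower r a g \<phi>) m + (of_nat (\<Sum>i<r. lookup g i) - 2 * of_nat j) * \<phi> m"
  unfolding lower_raise_commutator[where a=a, OF a] of_nat_sum left_diff_distrib mult.assoc homog_weight[OF \<phi>] ..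

text \<open>The \<open>sl\<^sub>2\<close> identity
  \<open>F E^(s+1) = E^(s+1) F + (s+1) (w - s) E^s\<close> on vectors of weight \<open>w\<close>,
  which is here the degree of the box monomial minus \<open>2 * j\<close>.\<close>

lemma lower_raise_pow:
  fixes a :: "nat \<Rightarrow> 'k::field_char_0"
  assumes a: "\<forall>i<r. a i \<noteq> 0" and \<phi>: "homog r j \<phi>"
  shows "lower r a g ((raise r a ^^ Suc s) \<phi>) m = (raise r a ^^ Suc s) (lower r a g \<phi>) m +
    of_nat (Suc s) * (of_nat (\<Sum>i<r. lookup g i) - 2 * of_nat j - of_nat s) * (raise r a ^^ s) \<phi> m"
proof (induction s arbitrary: m)
  case 0
  show ?case using lower_raise_homog[where a=a and g=g, OF a \<phi>] by (simp del: of_nat_sum)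
next
  case (Suc s)
  let ?\<psi> = "(raise r a ^^ Suc s) \<phi>"
  let ?c = "of_nat (Suc s) * (of_nat (\<Sum>i<r. lookup g i) - 2 * of_nat j - of_nat s) :: 'k"
  have "lower r a g ((raise r a ^^ Suc (Suc s)) \<phi>) m = lower r a g (raise r a ?\<psi>) m" by simp
  also have "\<dots> = raise r a (lower r a g ?\<psi>) m + (of_nat (\<Sum>i<r. lookup g i) - 2 * of_nat (j + Suc s)) * ?\<psi> m"
    by (rule lower_raise_homog[where a=a, OF a homog_raise_pow[OF \<phi>]])
  also have "lower r a g ?\<psi> = (\<lambda>m. (raise r a ^^ Suc s) (lower r a g \<phi>) m + ?c * (raise r a ^^ s) \<phi> m)"
    by (rule ext) (rule Suc)
  also have "raise r a \<dots> m = (raise r a ^^ Suc (Suc s)) (lower r a g \<phi>) m + ?c * ?\<psi> m"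
    unfolding raise_linear by simp
  finally show ?case by (simp add: algebra_simps)
qed

lemma raise_vanishes:
  assumes "down_closed G" "\<forall>m\<in>G. \<phi> m = 0" shows "\<forall>m\<in>G. raise r a \<phi> m = 0"
proof
  fix m assume m: "m \<in> G"
  have "\<phi> (m - single i 1) = 0" if "lookup m i \<noteq> 0" for i
  proof -
    have "m = (m - single i 1) + single i 1"
      by (rule poly_mapping_eqI) (use that in \<open>auto simp: lookup_add lookup_minus lookup_single when_def\<close>)
    then have "m - single i 1 \<in> G" using m assms(1) unfolding down_closed_def by metis
    with assms(2) show ?thesis by blast
  qed
  then show "raise r a \<phi> m = 0" unfolding raise_def by (intro sum.neutral) auto
qed

lemma raise_pow_vanishes:
  "down_closed G \<Longrightarrow> \<forall>m\<in>G. \<phi> m = 0 \<Longrightarrow> \<forall>m\<in>G. (raise r a ^^ s) \<phi> m = 0"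
  by (induction s) (auto intro!: raise_vanishes[rule_format])

text \<open>Where \<open>m + single i 1\<close> leaves the box, the factor
  \<open>lookup g i - lookup m i\<close> is zero, so lowering respects the quotient by the monomials
  outside the box.\<close>

lemma lower_vanishes:
  assumes "\<forall>m\<in>below {g}. \<phi> m = 0" shows "\<forall>m\<in>below {g}. lower r a g \<phi> m = 0"
proof
  fix m assume m: "m \<in> below {g}"
  have "(of_nat (lookup g i) - of_nat (lookup m i)) * \<phi> (m + single i 1) = 0" for i
  proof (cases "lookup m i = lookup g i")
    case False
    with m have "m + single i 1 \<in> below {g}"
      by (auto simp: below_def lookup_add lookup_single when_def) (metis Suc_leI le_neq_implies_less)
    with assms show ?thesis by simp
  qed simp
  then have "inverse (a i) * of_nat (lookup m i + 1) * (of_nat (lookup g i) - of_nat (lookup m i)) * \<phi> (m + single i 1) = 0" for i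
    by (simp only: mult.assoc mult_zero_right)
  then show "lower r a g \<phi> m = 0" unfolding lower_def by (intro sum.neutral) blast
qed

text \<open>Outer induction on the degree, inner induction on the power. If the power
  \<open>Suc s\<close> kills \<open>\<phi>\<close>, one more \<open>raise\<close> applied to the
  commutator identity removes its scalar term, so the lowered function is killed by the power
  \<open>s + 2\<close> and vanishes by the outer hypothesis. What remains of the identity is a
  scalar times the power \<open>s\<close> of \<open>raise\<close> at \<open>\<phi>\<close>; the
  bound on \<open>2 * j + s\<close> makes the scalar a positive integer, nonzero in characteristic
  zero.\<close>

lemma raise_pow_injective_box:
  fixes a :: "nat \<Rightarrow> 'k::field_char_0"
  assumes a: "\<forall>i<r. a i \<noteq> 0"
    and "homog r j \<phi>" "2 * j + s \<le> (\<Sum>i<r. lookup g i)" "\<forall>m\<in>below {g}. (raise r a ^^ s) \<phi> m = 0"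
  shows "\<forall>m\<in>below {g}. \<phi> m = 0"
  using assms(2-)
proof (induction j arbitrary: \<phi> s)
  have dc: "down_closed (below {g})" by (rule down_closed_below)
  have step: "\<forall>m\<in>below {g}. (raise r a ^^ s) \<phi> m = 0"
    if "homog r j \<phi>" "2 * j + Suc s \<le> (\<Sum>i<r. lookup g i)" "\<forall>m\<in>below {g}. (raise r a ^^ Suc s) \<phi> m = 0"
      "\<forall>m\<in>below {g}. lower r a g \<phi> m = 0" for j s \<phi>
  proof
    fix m assume m: "m \<in> below {g}"
    have 1: "(raise r a ^^ Suc s) (lower r a g \<phi>) m = 0" using raise_pow_vanishes[OF dc that(4)] m by blast
    have 2: "lower r a g ((raise r a ^^ Suc s) \<phi>) m = 0" using lower_vanishes[OF that(3)] m by blast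
    define t where "t = (\<Sum>i<r. lookup g i) - (2 * j + Suc s)"
    have t: "(\<Sum>i<r. lookup g i) = 2 * j + s + Suc t" using that(2) by (simp add: t_def)
    have "of_nat (Suc s) * (of_nat (\<Sum>i<r. lookup g i) - 2 * of_nat j - of_nat s) = (of_nat (Suc s) * of_nat (Suc t) :: 'k)"
      unfolding t by simp
    then show "(raise r a ^^ s) \<phi> m = 0"
      using lower_raise_pow[where a=a and g=g and m=m and s=s, OF a that(1)] 1 2 by (simp del: of_nat_Suc of_nat_sum)
  qed
  {
    case 0
    show ?case using 0(2,3)
    proof (induction s)
      case (Suc s)
      show ?case by (rule Suc.IH) (use Suc.prems step[OF 0(1), of s] lower_homog_0[OF 0(1)] in auto)
    qed simp
  next
    case (Suc j)
    note IH = Suc.IH and hom = Suc.prems(1)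
    show ?case using Suc.prems(2,3)
    proof (induction s)
      case (Suc s)
      let ?c = "of_nat (Suc s) * (of_nat (\<Sum>i<r. lookup g i) - 2 * of_nat (Suc j) - of_nat s) :: 'k"
      let ?\<psi> = "lower r a g ((raise r a ^^ Suc s) \<phi>)"
      have eq: "?\<psi> = (\<lambda>m. (raise r a ^^ Suc s) (lower r a g \<phi>) m + ?c * (raise r a ^^ s) \<phi> m)"
        by (rule ext) (rule lower_raise_pow[where a=a, OF a hom])
      have "\<forall>m\<in>below {g}. raise r a ?\<psi> m = 0"
        by (rule raise_vanishes[OF dc lower_vanishes[OF Suc.prems(2)]])
      then have "\<forall>m\<in>below {g}. (raise r a ^^ Suc (Suc s)) (lower r a g \<phi>) m = 0"
        unfolding eq raise_linear using Suc.prems(2) by simp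
      then have low: "\<forall>m\<in>below {g}. lower r a g \<phi> m = 0"
        using Suc.prems(1) by (intro IH[OF homog_lower[OF hom], of "Suc (Suc s)"]) auto
      show ?case by (rule Suc.IH[OF _ step[OF hom Suc.prems low]]) (use Suc.prems in simp)
    qed simp
  }
qed


lemma forms_homog: "f \<in> forms r j \<Longrightarrow> homog r j (lookup f)"
  unfolding homog_def forms_iff by (metis in_keys_iff mono_degree_eq)

lemma box_injective:
  fixes a :: "nat \<Rightarrow> 'k::field_char_0"
  assumes a: "\<forall>i<r. a i \<noteq> 0" and g: "keys g \<subseteq> {..<r}" and n: "2 * j + s \<le> mono_degree g"
  shows "lef_inj r (below {g}) (lin_form r a ^ s) j"
  unfolding lef_inj_def
proof (intro ballI impI)
  fix f m assume "f \<in> forms r j" "\<forall>m\<in>below {g}. lookup (lin_form r a ^ s * f) m = 0" "m \<in> below {g}"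
  then show "lookup f m = 0"
    using raise_pow_injective_box[where a=a and g=g and s=s, OF a forms_homog[of f r j]] n
    unfolding lookup_lin_form_power_times mono_degree_eq[OF g] by blast
qed

text \<open>The duality of the box, pairing \<open>m\<close> with \<open>g - m\<close>.\<close>

lemma card_graded_box:
  assumes "k \<le> mono_degree g"
  shows "card (graded (below {g}) k) = card (graded (below {g}) (mono_degree g - k))"
proof (rule bij_betw_same_card[of "\<lambda>m. g - m"])
  have *: "g - m \<in> graded (below {g}) (mono_degree g - i)" "g - (g - m) = m"
    if "m \<in> graded (below {g}) i" for m i
  proof -
    have le: "\<And>i. lookup m i \<le> lookup g i" using that by (auto simp: graded_def below_def)
    then have "mono_degree g = mono_degree m + mono_degree (g - m)"
      using add_diff_if_le[of m g] mono_degree_add[of m "g - m"] by simp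
    then show "g - m \<in> graded (below {g}) (mono_degree g - i)"
      using that by (auto simp: graded_def below_def lookup_minus)
    show "g - (g - m) = m" using le by (intro poly_mapping_eqI) (simp add: lookup_minus)
  qed
  show "bij_betw (\<lambda>m. g - m) (graded (below {g}) k) (graded (below {g}) (mono_degree g - k))"
    by (rule bij_betwI[where g="\<lambda>m. g - m"]) (use * assms *(1)[of _ "mono_degree g - k"] in auto)
qed

lemma box_strong_lefschetz:
  fixes a :: "nat \<Rightarrow> 'k::field_char_0"
  assumes a: "\<forall>i<r. a i \<noteq> 0" and g: "keys g \<subseteq> {..<r}"
  shows "lef_inj r (below {g}) (lin_form r a ^ s) j \<or> lef_surj r (below {g}) (lin_form r a ^ s) j (j + s)"
proof -
  let ?L = "lin_form r a" and ?G = "below {g}"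
  have G: "finite ?G" "?G \<subseteq> {m. keys m \<subseteq> {..<r}}"
    using finite_below[of "{g}" r] below_keys[of "{g}" r] g by auto
  consider "2 * j + s \<le> mono_degree g" | "mono_degree g < j + s" | "mono_degree g < 2 * j + s" "j + s \<le> mono_degree g"
    by linarith
  then show ?thesis
  proof cases
    case 1
    then show ?thesis using box_injective[where a=a, OF a g] by blast
  next
    case 2
    have "lookup h m = 0" if "h \<in> forms r (j + s)" "m \<in> ?G" for h :: "'k mpoly" and m
      using that 2 mono_degree_mono[of m g] by (intro forms_lookup_0[OF that(1)]) (auto simp: below_def)
    then have "lef_surj r ?G (?L ^ s) j (j + s)" unfolding lef_surj_def
      by (intro ballI bexI[of _ 0]) auto
    then show ?thesis ..
  next
    case 3
    \<comment> \<open>\<open>i\<close> is the degree complementary to \<open>j + s\<close>. The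
      power \<open>t\<close> leads from \<open>i\<close> to \<open>j + s\<close> between spaces of
      equal dimension and is onto; it factors through degree \<open>j\<close>, so its last
      \<open>s\<close> factors are onto as well.\<close>
    define i where "i = mono_degree g - (j + s)"
    define t where "t = j + s - i"
    have it: "i + t = j + s" "i \<le> j" "t = s + (j - i)" "2 * i + t \<le> mono_degree g" "i = mono_degree g - (i + t)"
      using 3 by (auto simp: i_def t_def)
    have "lef_surj r ?G (?L ^ t) i (i + t)"
    proof (rule lef_inj_imp_surj[OF G forms_1_power[OF lin_form_in_forms] _ box_injective[where a=a, OF a g it(4)]])
      show "card (graded ?G (i + t)) \<le> card (graded ?G i)"
        using card_graded_box[of "i + t" g] it 3 by simp
    qed
    then have *: "lef_surj r ?G (?L ^ s * ?L ^ (j - i)) i (j + s)" unfolding it(1) unfolding it(3) power_add .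
    have "lef_surj r ?G (?L ^ s) j (j + s)"
      unfolding lef_surj_def
    proof
      fix h :: "'k mpoly" assume "h \<in> forms r (j + s)"
      then obtain f where f: "f \<in> forms r i" "\<forall>m\<in>?G. lookup (?L ^ s * ?L ^ (j - i) * f) m = lookup h m"
        using * unfolding lef_surj_def by blast
      moreover have "?L ^ (j - i) * f \<in> forms r j"
        using forms_mult[OF forms_1_power[OF lin_form_in_forms, of _ _ "j - i"] f(1)] it(2) by simp
      ultimately show "\<exists>f\<in>forms r j. \<forall>m\<in>?G. lookup (?L ^ s * f) m = lookup h m"
        by (intro bexI[of _ "?L ^ (j - i) * f"]) (simp_all add: mult.assoc)
    qed
    then show ?thesis ..
  qed
qed

subsection \<open>Transfer from the rationals\<close>

text \<open>\<open>k\<close> is viewed as a vector space over the rationals, and the independent set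
  consisting of \<open>v\<close> is extended to a basis. Such a functional commutes with all
  operators that have integer coefficients.\<close>

lemma rational_functional_exists:
  fixes v :: "'k::field_char_0"
  assumes "v \<noteq> 0"
  shows "\<exists>h :: 'k \<Rightarrow> rat. (\<forall>x y. h (x + y) = h x + h y) \<and> h v \<noteq> 0"
proof -
  interpret V: vector_space "\<lambda>(q::rat) (x::'k). of_rat q * x"
    by unfold_locales (auto simp: algebra_simps of_rat_add of_rat_mult)
  interpret W: vector_space "(*) :: rat \<Rightarrow> rat \<Rightarrow> rat"
    by unfold_locales (auto simp: algebra_simps)
  interpret VW: vector_space_pair "\<lambda>(q::rat) (x::'k). of_rat q * x" "(*) :: rat \<Rightarrow> rat \<Rightarrow> rat" ..
  have "V.independent {v}" using assms by simp
  from VW.linear_independent_extend[OF this, of "\<lambda>_. 1"]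
  obtain h where h: "Vector_Spaces.linear (\<lambda>(q::rat) (x::'k). of_rat q * x) (*) h" "h v = 1" by auto
  then have "h (x + y) = h x + h y" for x y by (simp add: Vector_Spaces.linear.axioms module_hom.add VW.linear_add)
  with h(2) show ?thesis by (intro exI[of _ h]) auto
qed

lemma additive_of_int:
  fixes h :: "'a::ring_1 \<Rightarrow> 'b::ring_1"
  assumes "\<And>x y. h (x + y) = h x + h y"
  shows "h 0 = 0" "h (of_int c * x) = of_int c * h x"
proof -
  show 0: "h 0 = 0" using assms[of 0 0] by simp
  have neg: "h (- x) = - h x" for x using assms[of x "- x"] 0 by (simp add: eq_neg_iff_add_eq_0 add.commute)
  have "h (of_nat n * x) = of_nat n * h x" for n x
    by (induction n) (simp_all add: 0 assms algebra_simps)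
  then show "h (of_int c * x) = of_int c * h x"
    by (cases c rule: int_diff_cases) (simp add: left_diff_distrib assms[of _ "- _", simplified] neg flip: diff_conv_add_uminus)
qed

lemma lookup_map_additive:
  "h 0 = 0 \<Longrightarrow> lookup (Poly_Mapping.map h p) m = h (lookup p m)"
  by (simp add: Poly_Mapping.map.rep_eq when_def)

lemma map_additive_forms: "h 0 = 0 \<Longrightarrow> f \<in> forms r j \<Longrightarrow> Poly_Mapping.map h f \<in> forms r j"
  unfolding forms_iff by (metis in_keys_iff lookup_map_additive)

lemma raise_additive:
  fixes h :: "'a::field \<Rightarrow> 'b::field"
  assumes h: "\<And>x y. h (x + y) = h x + h y"
  shows "raise r (\<lambda>i. of_int (a i)) (\<lambda>m. h (\<phi> m)) m = h (raise r (\<lambda>i. of_int (a i)) \<phi> m)"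
proof -
  have sum: "h (\<Sum>i\<in>S. F i) = (\<Sum>i\<in>S. h (F i))" for S :: "nat set" and F
    by (induction S rule: infinite_finite_induct) (simp_all add: h additive_of_int(1)[of h, OF h])
  show ?thesis unfolding raise_def sum
    by (rule sum.cong) (auto simp: additive_of_int[of h, OF h])
qed

lemma raise_pow_additive:
  fixes h :: "'a::field \<Rightarrow> 'b::field"
  assumes h: "\<And>x y. h (x + y) = h x + h y"
  shows "(raise r (\<lambda>i. of_int (a i)) ^^ s) (\<lambda>m. h (\<phi> m)) = (\<lambda>m. h ((raise r (\<lambda>i. of_int (a i)) ^^ s) \<phi> m))"
proof (induction s)
  case (Suc s)
  show ?case by (rule ext) (simp add: Suc raise_additive[of h, OF h])
qed simp

text \<open>A kernel element over \<open>k\<close> yields a rational one by applying to its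
  coefficients a functional that is nonzero at one of them. For the surjective side, rational
  preimages of the monomials are embedded into \<open>k\<close> and combined.\<close>

lemma maximal_rank_transfer:
  fixes a :: "nat \<Rightarrow> int"
  assumes G: "finite G" "G \<subseteq> {m. keys m \<subseteq> {..<r}}"
    and Q: "lef_inj r G (lin_form r (\<lambda>i. of_int (a i) :: rat) ^ s) j \<or>
      lef_surj r G (lin_form r (\<lambda>i. of_int (a i) :: rat) ^ s) j k"
  shows "lef_inj r G (lin_form r (\<lambda>i. of_int (a i) :: 'k::field_char_0) ^ s) j \<or>
      lef_surj r G (lin_form r (\<lambda>i. of_int (a i) :: 'k) ^ s) j k"
  using Q
proof
  assume inj: "lef_inj r G (lin_form r (\<lambda>i. of_int (a i) :: rat) ^ s) j"
  have "lef_inj r G (lin_form r (\<lambda>i. of_int (a i) :: 'k) ^ s) j"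
    unfolding lef_inj_def
  proof (intro ballI impI, rule ccontr)
    fix f :: "'k mpoly" and m
    assume f: "f \<in> forms r j" "\<forall>m\<in>G. lookup (lin_form r (\<lambda>i. of_int (a i)) ^ s * f) m = 0"
      and m: "m \<in> G" "lookup f m \<noteq> 0"
    obtain h :: "'k \<Rightarrow> rat" where h: "\<And>x y. h (x + y) = h x + h y" "h (lookup f m) \<noteq> 0"
      using rational_functional_exists[OF m(2)] by blast
    note h0 = additive_of_int(1)[of h, OF h(1)]
    let ?f = "Poly_Mapping.map h f"
    have lf: "lookup ?f = (\<lambda>m. h (lookup f m))" by (rule ext) (rule lookup_map_additive[of h, OF h0])
    have "\<forall>m\<in>G. lookup (lin_form r (\<lambda>i. of_int (a i)) ^ s * ?f) m = 0"
      using f(2) unfolding lookup_lin_form_power_times lf raise_pow_additive[of h, OF h(1)] by (simp add: h0)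
    then have "\<forall>m\<in>G. lookup ?f m = 0"
      using inj map_additive_forms[of h, OF h0 f(1)] unfolding lef_inj_def by blast
    with m(1) h(2) show False by (simp add: lf)
  qed
  then show ?thesis ..
next
  assume surj: "lef_surj r G (lin_form r (\<lambda>i. of_int (a i) :: rat) ^ s) j k"
  let ?h = "of_rat :: rat \<Rightarrow> 'k"
  have h: "?h (x + y) = ?h x + ?h y" for x y by (rule of_rat_add)
  have "\<exists>f\<in>forms r j. \<forall>m\<in>G. lookup (lin_form r (\<lambda>i. of_int (a i) :: rat) ^ s * f) m = lookup (single t 1) m"
    if "t \<in> graded G k" for t
  proof -
    have "single t 1 \<in> forms r k" using that G(2) by (intro forms_single) (auto simp: graded_def)
    then show ?thesis using surj unfolding lef_surj_def by blast
  qed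
  then obtain f where f: "\<And>t. t \<in> graded G k \<Longrightarrow> f t \<in> forms r j"
    "\<And>t m. t \<in> graded G k \<Longrightarrow> m \<in> G \<Longrightarrow> lookup (lin_form r (\<lambda>i. of_int (a i) :: rat) ^ s * f t) m = lookup (single t 1) m"
    by metis
  let ?L = "lin_form r (\<lambda>i. of_int (a i) :: 'k) ^ s"
  have "lef_surj r G ?L j k"
    unfolding lef_surj_def
  proof
    fix g :: "'k mpoly" assume g: "g \<in> forms r k"
    define F where "F = (\<Sum>t\<in>graded G k. single 0 (lookup g t) * Poly_Mapping.map ?h (f t))"
    have "F \<in> forms r j" unfolding F_def by (intro forms_sum scale_forms map_additive_forms f) auto
    moreover have "lookup (?L * F) m = lookup g m" if m: "m \<in> G" for m
    proof -
      have 1: "lookup (?L * Poly_Mapping.map ?h (f t)) m = ?h (lookup (single t 1) m)" if "t \<in> graded G k" for t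
      proof -
        have "lookup (Poly_Mapping.map ?h (f t)) = (\<lambda>m. ?h (lookup (f t) m))"
          by (rule ext) (rule lookup_map_additive, simp)
        then show ?thesis
          unfolding f(2)[OF that m, symmetric] lookup_lin_form_power_times by (simp add: raise_pow_additive[of ?h, OF h])
      qed
      have "?L * F = (\<Sum>t\<in>graded G k. single 0 (lookup g t) * (?L * Poly_Mapping.map ?h (f t)))"
        by (simp add: F_def sum_distrib_left mult.left_commute)
      then have "lookup (?L * F) m = (\<Sum>t\<in>graded G k. lookup g t * lookup (?L * Poly_Mapping.map ?h (f t)) m)"
        by (simp only: lookup_sum scale_lookup)
      also have "\<dots> = (\<Sum>t\<in>graded G k. if t = m then lookup g t else 0)"
        by (rule sum.cong) (auto simp: 1 lookup_single when_def)
      also have "\<dots> = lookup g m"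
        using m G(1) forms_lookup_0[OF g, of m] by (auto simp: graded_def)
      finally show ?thesis .
    qed
    ultimately show "\<exists>f\<in>forms r j. \<forall>m\<in>G. lookup (?L * f) m = lookup g m" by blast
  qed
  then show ?thesis ..
qed

subsection \<open>Sign alternations\<close>

text \<open>Multiplication by \<open>x - 1\<close> on coefficient sequences. Each application lengthens a sign alternation by one
  (Descartes), so many zero coefficients of \<open>(x - 1) ^ s * c\<close> force \<open>c = 0\<close>.\<close>

definition dl :: "(nat \<Rightarrow> 'a::ring_1) \<Rightarrow> nat \<Rightarrow> 'a"
  where "dl c i = (if i = 0 then 0 else c (i - 1)) - c i"

text \<open>A chain of \<open>n\<close> nonzero places with alternating signs, that is, at least
  \<open>n - 1\<close> sign changes. For \<open>n = 1\<close> it means that the sequence is nonzero;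
  \<open>n = 0\<close> says nothing, which is why passing to \<open>dl\<close> asks for
  \<open>n \<ge> 1\<close>.\<close>

definition alternates :: "(nat \<Rightarrow> 'a::linordered_idom) \<Rightarrow> nat \<Rightarrow> bool"
  where "alternates c n \<longleftrightarrow> (\<exists>g::nat \<Rightarrow> nat. (\<forall>a<n. c (g a) \<noteq> 0) \<and>
    (\<forall>a. Suc a < n \<longrightarrow> g a < g (Suc a) \<and> c (g a) * c (g (Suc a)) < 0))"

lemma alternates_1: "c i \<noteq> 0 \<Longrightarrow> alternates c 1"
  unfolding alternates_def by (intro exI[of _ "\<lambda>_. i"]) auto

lemma alternates_mono: "alternates c n \<Longrightarrow> m \<le> n \<Longrightarrow> alternates c m"
  unfolding alternates_def by (meson less_le_trans)

lemma alternates_extend: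
  assumes "alternates c n" "\<And>i. c i \<noteq> 0 \<Longrightarrow> c' i = c i"
  shows "alternates c' n"
proof -
  obtain g where g: "\<forall>a<n. c (g a) \<noteq> 0" "\<forall>a. Suc a < n \<longrightarrow> g a < g (Suc a) \<and> c (g a) * c (g (Suc a)) < 0"
    using assms(1) unfolding alternates_def by blast
  then have "c' (g a) = c (g a)" if "a < n" for a using assms(2) that by blast
  with g show ?thesis unfolding alternates_def by (intro exI[of _ g]) (auto dest: Suc_lessD)
qed

lemma chain_mono:
  fixes g :: "nat \<Rightarrow> nat"
  assumes "\<forall>a. Suc a < n \<longrightarrow> g a < g (Suc a)" "a + t < n"
  shows "g a + t \<le> g (a + t)"
  using assms(2)
proof (induction t)
  case (Suc t)
  then have "g (a + t) < g (Suc (a + t))" using assms(1) by simp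
  with Suc show ?case by simp
qed simp

lemma alternates_le_card:
  assumes "alternates c n" "finite Z" "\<And>i. c i \<noteq> 0 \<Longrightarrow> i \<in> Z"
  shows "n \<le> card Z"
proof -
  obtain g where g: "\<forall>a<n. c (g a) \<noteq> 0" "\<forall>a. Suc a < n \<longrightarrow> g a < g (Suc a)"
    using assms(1) unfolding alternates_def by blast
  have "inj_on g {..<n}"
  proof (rule linorder_inj_onI)
    fix a b assume "a < b" "a \<in> {..<n}" "b \<in> {..<n}"
    then show "g a \<noteq> g b" using chain_mono[OF g(2), of a "b - a"] by auto
  qed auto
  then have "card {..<n} \<le> card Z" by (rule card_inj_on_le) (use g assms in auto)
  then show ?thesis by simp
qed

text \<open>The \<open>k\<close> discarded places can carry at most \<open>k\<close> members of the
  chain, so its first \<open>n - k\<close> members lie before \<open>b\<close>.\<close>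

lemma alternates_truncate:
  assumes "alternates c n" "\<And>i. b + k \<le> i \<Longrightarrow> c i = 0"
  shows "alternates (\<lambda>i. if i < b then c i else 0) (n - k)"
proof -
  obtain g where g: "\<forall>a<n. c (g a) \<noteq> 0" "\<forall>a. Suc a < n \<longrightarrow> g a < g (Suc a)"
    "\<forall>a. Suc a < n \<longrightarrow> c (g a) * c (g (Suc a)) < 0"
    using assms(1) unfolding alternates_def by blast
  have "g a < b" if "a < n - k" for a
  proof (rule ccontr)
    assume "\<not> g a < b"
    then have "b + k \<le> g (a + k)" using chain_mono[OF g(2), of a k] that by linarith
    then show False using assms(2) g(1) that by (meson less_diff_conv)
  qed
  with g show ?thesis unfolding alternates_def by (intro exI[of _ g]) auto
qed

lemma sum_dl: "lo \<le> hi \<Longrightarrow> (\<Sum>i=lo..hi. dl c i) = (if lo = 0 then 0 else c (lo - 1)) - c hi"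
  by (induction hi rule: dec_induct) (auto simp: dl_def)

text \<open>A discrete form of Rolle's theorem. The places are cut into blocks that end at the
  members of the chain, with one more block behind the last. Over each block \<open>dl c\<close>
  telescopes to a value of known sign, so some entry in the block has this sign.\<close>

lemma alternates_dl:
  assumes alt: "alternates c n" and n: "n \<ge> 1" and supp: "\<And>i. N \<le> i \<Longrightarrow> c i = 0"
  shows "alternates (dl c) (Suc n)"
proof -
  obtain g where g: "\<forall>a<n. c (g a) \<noteq> 0" "\<forall>a. Suc a < n \<longrightarrow> g a < g (Suc a)"
    "\<forall>a. Suc a < n \<longrightarrow> c (g a) * c (g (Suc a)) < 0"
    using alt unfolding alternates_def by blast
  define lo where "lo a = (if a = 0 then 0 else Suc (g (a - 1)))" for a
  \<comment> \<open>The additional block ends beyond the support of \<open>c\<close>, so its sum is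
    the last chain value itself, opposite in sign to the block before.\<close>
  define hi where "hi a = (if a < n then g a else Suc (N + g (n - 1)))" for a
  define w where "w a = (if a < n then - c (g a) else c (g (n - 1)))" for a
  have ex: "\<exists>i. lo a \<le> i \<and> i \<le> hi a \<and> dl c i * w a > 0" if a: "a \<le> n" for a
  proof (rule ccontr)
    assume "\<nexists>i. lo a \<le> i \<and> i \<le> hi a \<and> dl c i * w a > 0"
    then have "(\<Sum>i=lo a..hi a. dl c i * w a) \<le> 0" by (intro sum_nonpos) (auto simp: not_less)
    moreover have "lo a \<le> hi a"
    proof (cases "a < n")
      case True
      then show ?thesis using g(2) by (cases a) (auto simp: lo_def hi_def)
    next
      case False
      then show ?thesis using a n by (auto simp: lo_def hi_def)
    qed
    ultimately have le: "((if a = 0 then 0 else c (g (a - 1))) - c (hi a)) * w a \<le> 0"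
      using sum_dl[of "lo a" "hi a" c] by (simp add: sum_distrib_right[symmetric] lo_def split: if_splits)
    show False
    proof (cases "a < n")
      case True
      have sq: "c (g a) * c (g a) > 0" using g(1) True by (auto simp: zero_less_mult_iff linorder_neq_iff)
      have "(if a = 0 then 0 else c (g (a - 1))) * c (g a) \<le> 0"
        using g(3) True by (cases a) (auto simp: less_imp_le)
      with sq le True show False by (simp add: w_def hi_def algebra_simps)
    next
      case False
      then have an: "a = n" using a by simp
      have "c (g (n - 1)) \<noteq> 0" using g(1) n by simp
      then have "c (g (n - 1)) * c (g (n - 1)) > 0" by (auto simp: zero_less_mult_iff linorder_neq_iff)
      moreover have "c (hi a) = 0" using False by (simp add: hi_def supp)
      ultimately show False using le n by (simp add: w_def an)
    qed
  qed
  then obtain i where i: "\<And>a. a \<le> n \<Longrightarrow> lo a \<le> i a \<and> i a \<le> hi a \<and> dl c (i a) * w a > 0" by metis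
  have "dl c (i a) \<noteq> 0" if "a < Suc n" for a using i[of a] that by auto
  moreover have "i a < i (Suc a)" if "Suc a < Suc n" for a
    using i[of a] i[of "Suc a"] that by (auto simp: lo_def hi_def)
  moreover have "dl c (i a) * dl c (i (Suc a)) < 0" if "Suc a < Suc n" for a
  proof -
    have "w a * w (Suc a) < 0"
    proof (cases "Suc a < n")
      case True
      then show ?thesis using g(3) by (simp add: w_def)
    next
      case False
      with that have an: "n = Suc a" by simp
      then have "c (g a) \<noteq> 0" using g(1) by simp
      then show ?thesis using an by (auto simp: w_def zero_less_mult_iff linorder_neq_iff)
    qed
    then show ?thesis using i[of a] i[of "Suc a"] that by (auto simp: zero_less_mult_iff mult_less_0_iff)
  qed
  ultimately show ?thesis unfolding alternates_def by (intro exI[of _ i]) auto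
qed

lemma dl_pow_upper: "(\<And>i. N \<le> i \<Longrightarrow> c i = 0) \<Longrightarrow> N + s \<le> i \<Longrightarrow> (dl ^^ s) c i = 0"
  by (induction s arbitrary: i) (auto simp: dl_def)

lemma dl_pow_lower: "(\<And>i. i < N \<Longrightarrow> c i = 0) \<Longrightarrow> i < N \<Longrightarrow> (dl ^^ s) c i = 0"
  by (induction s arbitrary: i) (auto simp: dl_def)

lemma dl_pow_least: "(\<And>i. i < N \<Longrightarrow> c i = 0) \<Longrightarrow> (dl ^^ s) c N = (- 1) ^ s * c N"
  by (induction s) (auto simp: dl_def dl_pow_lower[of N c])

lemma alternates_dl_pow:
  assumes "alternates c n" "n \<ge> 1" "\<And>i. N \<le> i \<Longrightarrow> c i = 0"
  shows "alternates ((dl ^^ s) c) (n + s)"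
proof (induction s)
  case (Suc s)
  then show ?case using alternates_dl[of "(dl ^^ s) c" "n + s" "N + s"] dl_pow_upper[of N c] assms(2,3) by simp
qed (simp add: assms)

lemma dl_pow_linear: "(dl ^^ s) (\<lambda>i. b i + x * c i) = (\<lambda>i. (dl ^^ s) b i + x * (dl ^^ s) (c :: nat \<Rightarrow> 'a::comm_ring_1) i)"
  by (induction s) (auto simp: dl_def fun_eq_iff algebra_simps)

text \<open>The matrix is read off from the unit sequences \<open>e i\<close>, so that an
  application only has to supply linearity, the count and a trivial kernel.\<close>

lemma linear_system_solvable:
  fixes \<Phi> :: "(nat \<Rightarrow> 'k::field) \<Rightarrow> 'b \<Rightarrow> 'k"
  assumes fin: "finite T" "finite S" and card: "card T \<le> card S"
    and lin: "\<And>b x c t. \<Phi> (\<lambda>i. b i + x * c i) t = \<Phi> b t + x * \<Phi> c t"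
    and inj: "\<And>c. (\<And>s. s \<notin> S \<Longrightarrow> c s = 0) \<Longrightarrow> (\<And>t. t \<in> T \<Longrightarrow> \<Phi> c t = 0) \<Longrightarrow> \<forall>s\<in>S. c s = 0"
  shows "\<exists>c. (\<forall>s. s \<notin> S \<longrightarrow> c s = 0) \<and> (\<forall>t\<in>T. \<Phi> c t = g t)"
proof -
  define e where "e i = (\<lambda>k::nat. if k = i then (1::'k) else 0)" for i
  have z: "\<Phi> (\<lambda>i. 0) t = 0" for t using lin[of "\<lambda>_. 0" "- 1" "\<lambda>_. 0" t] by simp
  have expand: "\<Phi> c t = (\<Sum>i\<in>K. \<Phi> (e i) t * c i)" if "finite K" "\<forall>i. i \<notin> K \<longrightarrow> c i = 0" for K c t
    using that
  proof (induction K arbitrary: c rule: finite_induct)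
    case empty
    then have "c = (\<lambda>i. 0)" by auto
    then show ?case by (simp add: z)
  next
    case (insert k K)
    have c: "c = (\<lambda>i. (if i = k then 0 else c i) + c k * e k i)" by (auto simp: e_def)
    have "\<Phi> c t = \<Phi> (\<lambda>i. if i = k then 0 else c i) t + c k * \<Phi> (e k) t" by (subst c) (rule lin)
    also have "\<Phi> (\<lambda>i. if i = k then 0 else c i) t = (\<Sum>i\<in>K. \<Phi> (e i) t * (if i = k then 0 else c i))"
      by (rule insert.IH) (use insert.prems in auto)
    also have "\<dots> = (\<Sum>i\<in>K. \<Phi> (e i) t * c i)" using insert.hyps by (intro sum.cong) auto
    finally show ?case using insert.hyps by (simp add: mult.commute)
  qed
  have "\<exists>c. (\<forall>s. s \<notin> S \<longrightarrow> c s = 0) \<and> (\<forall>t\<in>T. (\<Sum>s\<in>S. \<Phi> (e s) t * c s) = g t)"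
  proof (rule square_system_solvable[OF fin card])
    fix c assume c: "\<forall>s. s \<notin> S \<longrightarrow> c s = 0" "\<forall>t\<in>T. (\<Sum>s\<in>S. \<Phi> (e s) t * c s) = 0"
    show "\<forall>s\<in>S. c s = 0" by (rule inj) (use c expand[OF fin(2) c(1)] in auto)
  qed
  then show ?thesis using expand[OF fin(2)] by metis
qed

subsection \<open>Two variables\<close>

text \<open>The bounds are additive instead of using truncated subtraction: for \<open>m > n\<close>
  the condition \<open>n < i + m\<close> still has the right meaning, namely that the sequence
  vanishes.\<close>

lemma dl_pow_support: "(\<And>i. n < i + m \<Longrightarrow> c i = 0) \<Longrightarrow> n + s < i + m \<Longrightarrow> (dl ^^ s) c i = 0"
proof (induction s arbitrary: i)
  case (Suc s)
  then have "(dl ^^ s) c i = 0" "i \<noteq> 0 \<Longrightarrow> (dl ^^ s) c (i - 1) = 0" by auto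
  then show ?case unfolding funpow.simps o_apply by (subst dl_def) simp
qed simp

text \<open>Dehomogenising with respect to the second variable turns multiplication by \<open>x - y\<close> into \<^const>\<open>dl\<close>.\<close>

definition coeffs2 :: "nat \<Rightarrow> 'k mpoly \<Rightarrow> nat \<Rightarrow> 'k::field"
  where "coeffs2 j f t = (if t \<le> j then lookup f (single 0 t + single 1 (j - t)) else 0)"

lemma exponent2_eq: "keys m \<subseteq> {..<2} \<Longrightarrow> m = single 0 (lookup m 0) + single 1 (lookup m 1)"
  for m :: "nat \<Rightarrow>\<^sub>0 nat"
proof (rule poly_mapping_eqI)
  fix i assume *: "keys m \<subseteq> {..<2}"
  show "lookup m i = lookup (single 0 (lookup m 0) + single 1 (lookup m 1)) i"
  proof (cases "i < 2")
    case True
    then have "i = 0 \<or> i = 1" by auto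
    then show ?thesis by (auto simp: lookup_add lookup_single)
  next
    case False
    then have "i \<notin> keys m" using * by auto
    then show ?thesis using False by (simp add: lookup_add lookup_single in_keys_iff when_def)
  qed
qed

lemma coeffs2_times:
  fixes f :: "('k::field) mpoly"
  shows "coeffs2 (Suc j) (lin_form 2 (\<lambda>i. if i = 0 then 1 else - 1) * f) = dl (coeffs2 j f)"
proof
  fix t
  show "coeffs2 (Suc j) (lin_form 2 (\<lambda>i. if i = 0 then 1 else - 1) * f) t = dl (coeffs2 j f) t"
  proof (cases "t \<le> Suc j")
    case True
    let ?m = "single 0 t + single 1 (Suc j - t) :: nat \<Rightarrow>\<^sub>0 nat"
    have 2: "{..<2} = {0, 1::nat}" by auto
    have l: "lookup ?m 0 = t" "lookup ?m 1 = Suc j - t" by (simp_all add: lookup_add lookup_single)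
    have m0: "?m - single 0 1 = single 0 (t - 1) + single 1 (j - (t - 1))" if "t \<noteq> 0"
      using that by (intro poly_mapping_eqI) (auto simp: lookup_add lookup_minus lookup_single when_def)
    have m1: "?m - single 1 1 = single 0 t + single 1 (j - t)"
      by (intro poly_mapping_eqI) (auto simp: lookup_add lookup_minus lookup_single when_def)
    have "lookup (lin_form 2 (\<lambda>i. if i = 0 then 1 else - 1) * f) ?m =
      (if t = 0 then 0 else lookup f (?m - single 0 1)) - (if Suc j - t = 0 then 0 else lookup f (?m - single 1 1))"
      unfolding lookup_lin_form_times 2 using l by simp
    also have "\<dots> = dl (coeffs2 j f) t"
      unfolding m1 using True m0 by (auto simp: dl_def coeffs2_def)
    finally show ?thesis using True by (simp add: coeffs2_def)
  next
    case False
    then show ?thesis by (auto simp: dl_def coeffs2_def)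
  qed
qed

lemma coeffs2_power_times:
  "coeffs2 (j + s) (lin_form 2 (\<lambda>i. if i = 0 then 1 else - 1) ^ s * f) = (dl ^^ s) (coeffs2 j (f :: ('k::field) mpoly))"
proof (induction s)
  case (Suc s)
  have "coeffs2 (Suc (j + s)) (lin_form 2 (\<lambda>i. if i = 0 then 1 else - 1) * (lin_form 2 (\<lambda>i. if i = 0 then 1 else - 1) ^ s * f)) =
      dl (coeffs2 (j + s) (lin_form 2 (\<lambda>i. if i = 0 then 1 else - 1) ^ s * f))" by (rule coeffs2_times)
  then show ?case unfolding Suc by (simp add: mult.assoc)
qed simp

text \<open>A nonzero multiple of \<open>(x - 1) ^ s\<close> has at least \<open>s + 1\<close>
  nonzero coefficients. So the kernel is trivial as soon as at most \<open>s\<close> monomials of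
  the target degree \<open>n\<close> are missing from \<open>G\<close>.\<close>

lemma two_variables_rat:
  assumes G: "G \<subseteq> {m. keys m \<subseteq> {..<2}}"
  defines "L \<equiv> lin_form 2 (\<lambda>i. if i = 0 then 1 else - 1 :: rat)"
  shows "lef_inj 2 G (L ^ s) j \<or> lef_surj 2 G (L ^ s) j (j + s)"
proof -
  define n where "n = j + s"
  define T where "T = {t. t \<le> n \<and> single 0 t + single 1 (n - t) \<in> G}"
  have T: "T \<subseteq> {..n}" by (auto simp: T_def)
  have few_terms: "c = (\<lambda>_. 0)" if c: "\<And>i. j < i \<Longrightarrow> c i = 0" and Z: "Z \<subseteq> {..n}" "card Z \<le> s"
    and 0: "\<And>t. t \<in> {..n} - Z \<Longrightarrow> (dl ^^ s) c t = 0" for c :: "nat \<Rightarrow> rat" and Z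
  proof (rule ccontr)
    assume "c \<noteq> (\<lambda>_. 0)"
    then obtain i where "c i \<noteq> 0" by auto
    then have "alternates ((dl ^^ s) c) (1 + s)"
      by (intro alternates_dl_pow[OF alternates_1, where N="Suc j"] c) auto
    moreover have "i \<in> Z" if "(dl ^^ s) c i \<noteq> 0" for i
      using that 0[of i] dl_pow_upper[of "Suc j" c s i] c by (force simp: n_def)
    ultimately have "1 + s \<le> card Z" using Z finite_subset[OF Z(1)] by (intro alternates_le_card) auto
    with Z(2) show False by simp
  qed
  have eq0: "m = single 0 (lookup m 0) + single 1 (i - lookup m 0)" "lookup m 0 \<le> i"
    if "m \<in> graded G i" for m i
  proof -
    have k: "keys m \<subseteq> {..<2}" "mono_degree m = i" using that G by (auto simp: graded_def)
    then have "i = lookup m 0 + lookup m 1" using mono_degree_eq[OF k(1)] by (simp add: numeral_2_eq_2)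
    then show "m = single 0 (lookup m 0) + single 1 (i - lookup m 0)" "lookup m 0 \<le> i"
      using exponent2_eq[OF k(1)] by auto
  qed
  have mem: "lookup h m = coeffs2 i h (lookup m 0)" if "m \<in> graded G i" for h :: "rat mpoly" and m i
    using eq0[OF that] by (simp add: coeffs2_def)
  show ?thesis
  proof (cases "card ({..n} - T) \<le> s")
    case True
    have "lef_inj 2 G (L ^ s) j" unfolding lef_inj_def
    proof (intro ballI impI)
      fix f m assume f: "f \<in> forms 2 j" "\<forall>m\<in>G. lookup (L ^ s * f) m = 0" and m: "m \<in> G"
      have "coeffs2 j f = (\<lambda>_. 0)"
      proof (rule few_terms[OF _ _ True])
        fix t assume "t \<in> {..n} - ({..n} - T)"
        then have "lookup (L ^ s * f) (single 0 t + single 1 (n - t)) = 0" "t \<le> n" using f(2) by (auto simp: T_def)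
        then have "coeffs2 n (L ^ s * f) t = 0" by (simp add: coeffs2_def)
        then show "(dl ^^ s) (coeffs2 j f) t = 0" unfolding n_def L_def coeffs2_power_times .
      qed (auto simp: coeffs2_def)
      then show "lookup f m = 0"
        using mem[of m j f] m forms_lookup_0[OF f(1), of m] by (cases "mono_degree m = j") (auto simp: graded_def)
    qed
    then show ?thesis ..
  next
    case False
    \<comment> \<open>Leaving exactly \<open>s\<close> missing places free gives
      \<open>n + 1 - s = j + 1\<close> equations for \<open>j + 1\<close> unknowns. The values
      prescribed at the other missing places are harmless.\<close>
    then obtain Z where Z: "Z \<subseteq> {..n} - T" "card Z = s" by (meson nat_le_linear obtain_subset_with_card_n)
    have "lef_surj 2 G (L ^ s) j (j + s)" unfolding lef_surj_def
    proof
      fix g :: "rat mpoly" assume g: "g \<in> forms 2 (j + s)"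
      have "\<exists>c. (\<forall>i. i \<notin> {..j} \<longrightarrow> c i = 0) \<and> (\<forall>t\<in>{..n} - Z. (dl ^^ s) c t = coeffs2 n g t)"
      proof (rule linear_system_solvable)
        have "card ({..n} - Z) = Suc n - s" using Z by (subst card_Diff_subset) (auto intro: finite_subset)
        then show "card ({..n} - Z) \<le> card {..j}" by (simp add: n_def)
        fix c :: "nat \<Rightarrow> rat" assume "\<And>i. i \<notin> {..j} \<Longrightarrow> c i = 0" "\<And>t. t \<in> {..n} - Z \<Longrightarrow> (dl ^^ s) c t = 0"
        then have "c = (\<lambda>_. 0)" using Z by (intro few_terms[where Z=Z]) auto
        then show "\<forall>i\<in>{..j}. c i = 0" by simp
      qed (auto simp: dl_pow_linear)
      then obtain c where "\<forall>i. i \<notin> {..j} \<longrightarrow> c i = 0" "\<forall>t\<in>{..n} - Z. (dl ^^ s) c t = coeffs2 n g t" by blast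
      then have c: "\<And>i. j < i \<Longrightarrow> c i = 0" "\<And>t. t \<in> {..n} - Z \<Longrightarrow> (dl ^^ s) c t = coeffs2 n g t"
        by simp_all
      define f :: "rat mpoly" where "f = (\<Sum>t\<le>j. single (single 0 t + single 1 (j - t)) (c t))"
      have "f \<in> forms 2 j" unfolding f_def
        by (intro forms_sum forms_single) (auto simp: keys_add_nat mono_degree_add)
      moreover have "coeffs2 j f = c"
      proof
        fix t
        have inj: "single (0::nat) u + single 1 (j - u) = single 0 t + single (1::nat) (j - t) \<longleftrightarrow> u = t" for u
          by (auto dest!: arg_cong[where f="\<lambda>m. lookup m 0"] simp: lookup_add lookup_single)
        show "coeffs2 j f t = c t"
          using c(1)[of t] by (auto simp: coeffs2_def f_def lookup_sum lookup_single when_def inj simp del: One_nat_def)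
      qed
      then have cf: "coeffs2 n (L ^ s * f) = (dl ^^ s) c" unfolding n_def L_def coeffs2_power_times by simp
      have "lookup (L ^ s * f) m = lookup g m" if m: "m \<in> G" for m
      proof (cases "mono_degree m = n")
        case True
        then have mg: "m \<in> graded G n" using m by (simp add: graded_def)
        have "lookup m 0 \<in> T" using eq0[OF mg] m by (auto simp: T_def)
        then have "lookup m 0 \<in> {..n} - Z" using Z T by blast
        then show ?thesis unfolding mem[OF mg] cf by (rule c(2))
      next
        case False
        have Lf: "L ^ s * f \<in> forms 2 (s + j)"
          using forms_mult[OF forms_1_power[OF lin_form_in_forms] \<open>f \<in> forms 2 j\<close>] unfolding L_def by blast
        show ?thesis using False forms_lookup_0[OF Lf, of m] forms_lookup_0[OF g, of m] by (simp add: n_def add.commute)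
      qed
      ultimately show "\<exists>f\<in>forms 2 j. \<forall>m\<in>G. lookup (L ^ s * f) m = lookup g m" by blast
    qed
    then show ?thesis ..
  qed
qed

subsection \<open>Three variables and type two\<close>

text \<open>If \<open>u\<close> is nonzero, \<open>(x - 1) ^ q * u\<close> has an alternation of
  length \<open>q + 1\<close>; cutting it off at \<open>b1\<close> costs at most the number of
  places from \<open>b1\<close> to \<open>n - a3\<close>, and the factor \<open>(x - 1) ^ a3\<close>
  adds \<open>a3\<close>. The result exceeds \<open>card Z\<close>. If \<open>u\<close> vanishes,
  the same count for \<open>v\<close> takes place from \<open>b1\<close> on, which is why the upper
  part of \<open>Z\<close> is bounded separately.\<close>

lemma truncated_powers_independent:
  fixes u v :: "nat \<Rightarrow> 'a::linordered_idom"
  assumes u: "\<And>i. u i \<noteq> 0 \<Longrightarrow> i < b1 \<and> i + (a3 + q) \<le> n" and v: "\<And>i. v i \<noteq> 0 \<Longrightarrow> b1 \<le> i \<and> i + a3 \<le> n"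
    and Z: "finite Z" "\<And>t. (dl ^^ a3) (\<lambda>t. if t < b1 then (dl ^^ q) u t else v t) t \<noteq> 0 \<Longrightarrow> t \<in> Z"
    and card: "b1 + a3 \<le> n + 1 \<and> card Z \<le> a3 + b1 - min (n + 1 - (a3 + q)) b1 \<and> card (Z \<inter> {b1..}) \<le> a3 \<or>
      n + 1 \<le> b1 + a3 \<and> card Z \<le> a3 + q"
  shows "u i = 0 \<and> v i = 0"
proof -
  let ?H = "\<lambda>t. if t < b1 then (dl ^^ q) u t else v t"
  have uz: "u i = 0" if "n < i + (a3 + q)" for i using u[of i] that by fastforce
  have H: "?H i = 0" if "n < i + a3" for i
  proof (cases "i < b1")
    case True
    then show ?thesis using dl_pow_support[of n "a3 + q" u q i] uz that by simp
  next
    case False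
    then show ?thesis using v[of i] that by fastforce
  qed
  then have Hb: "?H i = 0" if "Suc n \<le> i" for i using that by simp
  have u0: "u i = 0" for i
  proof (rule ccontr)
    assume "u i \<noteq> 0"
    then have ex: "\<exists>i. u i \<noteq> 0" by blast
    have nb: "a3 + q \<le> n" using u ex by fastforce
    define i0 where "i0 = (LEAST i. u i \<noteq> 0)"
    have i0: "u i0 \<noteq> 0" "\<And>i. i < i0 \<Longrightarrow> u i = 0"
      using LeastI_ex[OF ex] not_less_Least[of _ "\<lambda>i. u i \<noteq> 0"] unfolding i0_def by blast+
    have ub: "u i = 0" if "Suc n \<le> i" for i using uz that by simp
    have alt: "alternates ((dl ^^ q) u) (1 + q)"
      by (rule alternates_dl_pow[OF alternates_1[of u i0, OF i0(1)], where N="Suc n"]) (use ub in auto)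
    show False
    proof (cases "b1 + a3 \<le> n + 1")
      case True
      \<comment> \<open>\<open>k\<close> is the number of places from \<open>b1\<close> to
        \<open>n - a3\<close>, the only ones where the truncation can remove something.\<close>
      define k where "k = n + 1 - a3 - b1"
      have 1: "alternates (\<lambda>i. if i < b1 then (dl ^^ q) u i else 0) (1 + q - k)"
        by (rule alternates_truncate[OF alt]) (use dl_pow_support[of n "a3 + q" u q] uz True in \<open>auto simp: k_def\<close>)
      \<comment> \<open>The least nonzero coefficient of \<open>u\<close> is below \<open>b1\<close>
        and survives up to sign, so an alternation of length 1 remains even if \<open>k\<close>
        exceeds \<open>q\<close>.\<close>
      have "(dl ^^ q) u i0 = (- 1) ^ q * u i0" by (rule dl_pow_least[OF i0(2)])
      then have "alternates (\<lambda>i. if i < b1 then (dl ^^ q) u i else 0) 1"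
        using i0(1) u[OF i0(1)] by (intro alternates_1[of _ i0]) auto
      moreover have "1 + (b1 - min (n + 1 - (a3 + q)) b1) \<le> 1 \<or> 1 + (b1 - min (n + 1 - (a3 + q)) b1) \<le> 1 + q - k"
        using nb True unfolding k_def by linarith
      ultimately have "alternates (\<lambda>i. if i < b1 then (dl ^^ q) u i else 0) (1 + (b1 - min (n + 1 - (a3 + q)) b1))"
        using 1 alternates_mono by blast
      then have "alternates ?H (1 + (b1 - min (n + 1 - (a3 + q)) b1))"
        by (rule alternates_extend) (auto split: if_splits)
      then have "alternates ((dl ^^ a3) ?H) (1 + (b1 - min (n + 1 - (a3 + q)) b1) + a3)"
        by (rule alternates_dl_pow[where N="Suc n"]) (simp, rule Hb)
      then have "1 + (b1 - min (n + 1 - (a3 + q)) b1) + a3 \<le> card Z" using Z by (rule alternates_le_card)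
      moreover have "card Z \<le> a3 + b1 - min (n + 1 - (a3 + q)) b1 \<or> card Z \<le> a3 + q \<and> n + 1 = b1 + a3"
        using card True by linarith
      ultimately show False using nb by (auto simp: min_def split: if_splits)
    next
      case False
      have "(dl ^^ q) u t = 0" if "b1 \<le> t" for t
        using dl_pow_support[of n "a3 + q" u q t] uz that False by auto
      then have "alternates ?H (1 + q)" by (intro alternates_extend[OF alt]) (metis not_le)
      then have "alternates ((dl ^^ a3) ?H) (1 + q + a3)"
        by (rule alternates_dl_pow[where N="Suc n"]) (simp, rule Hb)
      then have "1 + q + a3 \<le> card Z" using Z by (rule alternates_le_card)
      then show False using card False by auto
    qed
  qed
  moreover have "v i = 0" for i
  proof (rule ccontr)
    assume vi: "v i \<noteq> 0"
    \<comment> \<open>With \<open>u = 0\<close> only \<open>v\<close> is left, and every nonzero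
      place of its product with \<open>(x - 1) ^ a3\<close> is at least \<open>b1\<close>.\<close>
    have "(dl ^^ q) u = (\<lambda>_. 0)" using dl_pow_lower[of _ u _ q] u0 by blast
    then have "?H t = v t" for t using v[of t] by (cases "v t = 0") auto
    then have Hv: "?H = v" by blast
    have vb: "v i = 0" if "Suc n \<le> i" for i using v[of i] that by (cases "v i = 0") auto
    have "alternates ((dl ^^ a3) v) (1 + a3)"
      by (rule alternates_dl_pow[OF alternates_1[of v i, OF vi], where N="Suc n"]) (simp, rule vb)
    moreover have "t \<in> Z \<inter> {b1..}" if "(dl ^^ a3) v t \<noteq> 0" for t
      using that Z(2)[of t] dl_pow_lower[of b1 v t a3] v unfolding Hv by (meson IntI atLeast_iff leD leI)
    ultimately have "1 + a3 \<le> card (Z \<inter> {b1..})" using Z(1) by (intro alternates_le_card) auto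
    moreover have "b1 + a3 \<le> n" using v[OF vi] by simp
    ultimately show False using card by auto
  qed
  ultimately show ?thesis by blast
qed

section \<open>Slices of forms in three variables\<close>

lemma dl_cong: "(t \<noteq> 0 \<Longrightarrow> c (t - 1) = c' (t - 1)) \<Longrightarrow> c t = c' t \<Longrightarrow> dl c t = dl c' t"
  by (simp add: dl_def)

text \<open>The variables stay abstract because any of the three may have to play the distinguished
  role of \<open>vx\<close>.\<close>

locale three_variables =
  fixes vx vy vz :: nat
  assumes vars: "{..<3} = {vx, vy, vz}" and distinct: "vx \<noteq> vy" "vx \<noteq> vz" "vy \<noteq> vz"
begin

definition mon :: "nat \<Rightarrow> nat \<Rightarrow> nat \<Rightarrow> nat \<Rightarrow>\<^sub>0 nat"
  where "mon t u k = single vx t + single vy u + single vz k"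

lemma lookup_mon: "lookup (mon t u k) vx = t" "lookup (mon t u k) vy = u" "lookup (mon t u k) vz = k"
  using distinct by (simp_all add: mon_def lookup_add lookup_single when_def)

lemma mon_eq: "keys m \<subseteq> {..<3} \<Longrightarrow> m = mon (lookup m vx) (lookup m vy) (lookup m vz)"
proof (rule poly_mapping_eqI)
  fix i assume "keys m \<subseteq> {..<3}"
  then have "i \<notin> {vx, vy, vz} \<Longrightarrow> lookup m i = 0" unfolding vars by (auto simp: in_keys_iff)
  moreover have "i \<notin> {vx, vy, vz} \<Longrightarrow> lookup (mon (lookup m vx) (lookup m vy) (lookup m vz)) i = 0"
    by (simp add: mon_def lookup_add lookup_single when_def)
  ultimately show "lookup m i = lookup (mon (lookup m vx) (lookup m vy) (lookup m vz)) i"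
    using lookup_mon by (cases "i \<in> {vx, vy, vz}") auto
qed

lemma keys_mon: "keys (mon t u k) \<subseteq> {..<3}"
  unfolding vars mon_def keys_add_nat by auto

lemma degree_mon: "mono_degree (mon t u k) = t + u + k"
  by (simp add: mon_def mono_degree_add)

lemma degree3: "keys m \<subseteq> {..<3} \<Longrightarrow> mono_degree m = lookup m vx + lookup m vy + lookup m vz"
  using arg_cong[OF mon_eq, of m mono_degree] unfolding degree_mon .

lemma mon_inject: "mon t u k = mon t' u' k' \<longleftrightarrow> t = t' \<and> u = u' \<and> k = k'"
  using lookup_mon[of t u k] lookup_mon[of t' u' k'] by auto

text \<open>The slice of \<open>f\<close> at \<open>z\<close>-degree \<open>k\<close>, dehomogenised with respect to \<open>y\<close>.\<close>

definition level :: "nat \<Rightarrow> 'k mpoly \<Rightarrow> nat \<Rightarrow> nat \<Rightarrow> 'k::field"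
  where "level d f k t = (if t + k \<le> d then lookup f (mon t (d - t - k) k) else 0)"

lemma mon_in_below:
  assumes "keys A \<subseteq> {..<3}"
  shows "mon t u k \<in> below {A} \<longleftrightarrow> t \<le> lookup A vx \<and> u \<le> lookup A vy \<and> k \<le> lookup A vz"
proof
  assume "mon t u k \<in> below {A}"
  then have "lookup (mon t u k) i \<le> lookup A i" for i by (simp add: below_def)
  then show "t \<le> lookup A vx \<and> u \<le> lookup A vy \<and> k \<le> lookup A vz" using lookup_mon[of t u k] by metis
next
  assume *: "t \<le> lookup A vx \<and> u \<le> lookup A vy \<and> k \<le> lookup A vz"
  have "lookup (mon t u k) i \<le> lookup A i" for i
  proof (cases "i \<in> {vx, vy, vz}")
    case True
    then show ?thesis using * lookup_mon by auto
  next
    case False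
    then have "i \<notin> keys (mon t u k)" using keys_mon vars by blast
    then show ?thesis by (simp add: in_keys_iff)
  qed
  then show "mon t u k \<in> below {A}" by (simp add: below_def)
qed

text \<open>The \<open>x\<close>- and \<open>y\<close>-terms of the linear form stay within one
  slice and combine to \<open>dl\<close>; the \<open>z\<close>-term brings in the slice
  below.\<close>

lemma lookup_times_level:
  fixes f :: "('k::field) mpoly"
  assumes "t + k \<le> Suc d"
  shows "lookup (lin_form 3 (\<lambda>i. if i = vx then 1 else - 1) * f) (mon t (Suc d - t - k) k) =
    dl (level d f k) t - (if k = 0 then 0 else level d f (k - 1) t)"
proof -
  let ?m = "mon t (Suc d - t - k) k"
  have m: "?m - single vx 1 = mon (t - 1) (Suc d - t - k) k" "?m - single vy 1 = mon t (Suc d - t - k - 1) k"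
    "?m - single vz 1 = mon t (Suc d - t - k) (k - 1)"
    using distinct by (auto intro!: poly_mapping_eqI simp: mon_def lookup_add lookup_minus lookup_single when_def)
  have "lookup (lin_form 3 (\<lambda>i. if i = vx then 1 else - 1) * f) ?m =
    (if t = 0 then 0 else lookup f (?m - single vx 1)) - (if Suc d - t - k = 0 then 0 else lookup f (?m - single vy 1))
     - (if k = 0 then 0 else lookup f (?m - single vz 1))"
    unfolding lookup_lin_form_times vars using distinct by (simp add: lookup_mon)
  also have "(if t = 0 then 0 else lookup f (?m - single vx 1)) = (if t = 0 then 0 else level d f k (t - 1))"
    unfolding m using assms by (auto simp: level_def)
  also have "(if Suc d - t - k = 0 then 0 else lookup f (?m - single vy 1)) = level d f k t"
    unfolding m using assms by (auto simp: level_def)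
  also have "(if k = 0 then 0 else lookup f (?m - single vz 1)) = (if k = 0 then 0 else level d f (k - 1) t)"
    unfolding m using assms by (auto simp: level_def)
  finally show ?thesis by (simp add: dl_def)
qed

lemma level_exists:
  assumes "\<And>k t. d < t + k \<Longrightarrow> F k t = (0 :: 'k::field)"
  shows "\<exists>f\<in>forms 3 d. level d f = F"
proof -
  define S where "S = {(k, t). t + k \<le> d}"
  have "S \<subseteq> {..d} \<times> {..d}" by (auto simp: S_def)
  then have fin: "finite S" by (rule finite_subset) simp
  define f where "f = (\<Sum>(k, t)\<in>S. single (mon t (d - t - k) k) (F k t))"
  have "f \<in> forms 3 d" unfolding f_def
    by (intro forms_sum) (auto simp: S_def degree_mon intro!: forms_single keys_mon)
  moreover have "level d f k t = F k t" for k t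
  proof (cases "t + k \<le> d")
    case True
    have "lookup f (mon t (d - t - k) k) = (\<Sum>p\<in>S. if p = (k, t) then F k t else 0)"
      unfolding f_def lookup_sum
    proof (rule sum.cong)
      fix p assume "p \<in> S"
      obtain k' t' where p: "p = (k', t')" by (cases p)
      show "lookup (case p of (k, t) \<Rightarrow> single (mon t (d - t - k) k) (F k t)) (mon t (d - t - k) k) =
          (if p = (k, t) then F k t else 0)"
      proof (cases "p = (k, t)")
        case False
        then have "mon t' (d - t' - k') k' \<noteq> mon t (d - t - k) k" unfolding mon_inject p by blast
        with False show ?thesis by (auto simp: p lookup_single)
      qed simp
    qed simp
    also have "\<dots> = F k t" using fin True by (simp add: S_def)
    finally show ?thesis using True by (simp add: level_def)
  qed (use assms in \<open>simp add: level_def\<close>)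
  ultimately show ?thesis by (intro bexI[of _ f]) auto
qed

end

text \<open>For \<open>L = x - y - z\<close>, the equation \<open>L * f = 0\<close> expresses each slice of \<open>f\<close> as \<^const>\<open>dl\<close> of the slice above it. Hence \<open>f\<close> is
  determined by its top slices, at height \<open>b3 - 1\<close> over the base of \<open>B\<close> and at height \<open>a3 - 1\<close> over the rest of
  the base of \<open>A\<close>, and the remaining equation is \<open>(x - 1) ^ a3 * front c = 0\<close> on \<open>T\<close>, where \<open>c\<close> collects the
  coefficients of the top slices. The map is injective or surjective according to the size of the complement of \<open>T\<close>.\<close>

locale two_boxes = three_variables +
  fixes A B :: "nat \<Rightarrow>\<^sub>0 nat" and n :: nat
  assumes AB: "keys A \<subseteq> {..<3}" "keys B \<subseteq> {..<3}"
    and less: "lookup B vx < lookup A vx" "lookup A vy \<le> lookup B vy" "lookup A vz \<le> lookup B vz"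
    and late: "mono_degree B < 2 * n"
begin

abbreviation "G \<equiv> below {A, B}"

text \<open>\<open>a3\<close>, \<open>b1\<close>, \<open>b2\<close>, \<open>b3\<close> are side
  lengths, one more than the exponents; \<open>q\<close> is the height by which the box of
  \<open>B\<close> projects above that of \<open>A\<close>.\<close>

definition "a3 = Suc (lookup A vz)"
definition "b1 = Suc (lookup B vx)"
definition "b2 = Suc (lookup B vy)"
definition "b3 = Suc (lookup B vz)"
definition "q = lookup B vz - lookup A vz"

definition planar :: "nat \<Rightarrow> nat \<Rightarrow> bool"
  where "planar t u \<longleftrightarrow> t \<le> lookup A vx \<and> u \<le> lookup A vy \<or> t < b1 \<and> u < b2"

definition "T = {t. t \<le> n \<and> planar t (n - t)}"

text \<open>The number of free coefficients in the top slice over the base of \<open>B\<close>,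
  whose places \<open>i\<close> satisfy \<open>i < b1\<close> and
  \<open>i + b3 \<le> n\<close>.\<close>

definition "g = min (n + 1 - b3) b1"

lemma b3: "b3 = a3 + q" and a3_pos: "a3 \<ge> 1"
  using less by (simp_all add: a3_def b3_def q_def)

lemma mon_in_G: "mon t u k \<in> G \<longleftrightarrow> planar t u \<and> k < a3 \<or> t < b1 \<and> u < b2 \<and> k < b3"
proof -
  have "G = below {A} \<union> below {B}" by (auto simp: below_def)
  then have "mon t u k \<in> G \<longleftrightarrow> t \<le> lookup A vx \<and> u \<le> lookup A vy \<and> k \<le> lookup A vz \<or>
      t \<le> lookup B vx \<and> u \<le> lookup B vy \<and> k \<le> lookup B vz"
    by (simp add: mon_in_below[OF AB(1)] mon_in_below[OF AB(2)])
  then show ?thesis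
    unfolding planar_def a3_def b1_def b2_def b3_def less_Suc_eq_le using less(3) by (meson le_trans)
qed

lemma planar_imp: "planar t u \<Longrightarrow> t < b1 \<Longrightarrow> u < b2"
  using less(2) by (auto simp: planar_def b2_def)

lemma planar_mono: "planar t u \<Longrightarrow> t' \<le> t \<Longrightarrow> u' \<le> u \<Longrightarrow> planar t' u'"
  by (auto simp: planar_def)

text \<open>For \<open>t < n + 1 - b2\<close> the \<open>y\<close>-exponent \<open>n - t\<close> is
  too large for the box of \<open>B\<close>, and below \<open>b1\<close> the box of \<open>A\<close>
  does not help; \<open>late\<close> ensures that there are enough such places. This limits how many
  missing places can lie from \<open>b1\<close> on.\<close>

lemma low_count: "b1 - g \<le> card (({..n} - T) \<inter> {..<b1})"
proof -
  have "{..<min b1 (n + 1 - b2)} \<subseteq> ({..n} - T) \<inter> {..<b1}"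
  proof
    fix t assume t: "t \<in> {..<min b1 (n + 1 - b2)}"
    then have "\<not> planar t (n - t)" using planar_imp[of t "n - t"] by auto
    with t show "t \<in> ({..n} - T) \<inter> {..<b1}" by (auto simp: T_def)
  qed
  then have "card {..<min b1 (n + 1 - b2)} \<le> card (({..n} - T) \<inter> {..<b1})" by (intro card_mono) simp_all
  moreover have "b1 + b2 + b3 \<le> 2 * n + 2" using late degree3[OF AB(2)] by (simp add: b1_def b2_def b3_def)
  ultimately show ?thesis unfolding g_def card_lessThan by linarith
qed

text \<open>Chosen so that \<open>n + 1 - bound\<close> is the number of unknowns in the top slices,
  \<open>g\<close> over the base of \<open>B\<close> and \<open>n + 1 - a3 - b1\<close> beyond it:
  leaving \<open>bound\<close> places free makes the system square. If
  \<open>n + 1 < b1 + a3\<close>, nothing lies beyond and the value is \<open>b3\<close>.\<close>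

definition bound :: nat
  where "bound = (if b1 + a3 \<le> n + 1 then a3 + b1 - g else b3)"

text \<open>The slice at height \<open>a3 - 1\<close> produced by the top coefficients
  \<open>c\<close>. Over the base of \<open>B\<close> the top slice lies \<open>q\<close> levels
  higher and picks up the factor \<open>(x - 1) ^ q\<close> on the way down; elsewhere
  \<open>c\<close> is the slice itself.\<close>

definition front :: "(nat \<Rightarrow> rat) \<Rightarrow> nat \<Rightarrow> rat"
  where "front c t = (if t < b1 then (dl ^^ q) (\<lambda>i. if i < b1 then c i else 0) t else c t)"

lemma front_injective:
  assumes c: "\<And>i. c i \<noteq> 0 \<Longrightarrow> i + (if i < b1 then b3 else a3) \<le> n"
    and Z: "finite Z" "\<And>t. (dl ^^ a3) (front c) t \<noteq> 0 \<Longrightarrow> t \<in> Z"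
    and card: "card Z \<le> bound" "b1 + a3 \<le> n + 1 \<Longrightarrow> card (Z \<inter> {b1..}) \<le> a3"
  shows "c i = 0"
proof -
  have "(\<lambda>i. if i < b1 then c i else 0) i = 0 \<and> (\<lambda>i. if i < b1 then 0 else c i) i = 0"
  proof (rule truncated_powers_independent[of _ b1 a3 q n _ Z])
    have "(\<lambda>t. if t < b1 then (dl ^^ q) (\<lambda>i. if i < b1 then c i else 0) t else if t < b1 then 0 else c t) = front c"
      by (auto simp: front_def)
    then show "t \<in> Z" if "(dl ^^ a3) (\<lambda>t. if t < b1 then (dl ^^ q) (\<lambda>i. if i < b1 then c i else 0) t
        else if t < b1 then 0 else c t) t \<noteq> 0" for t
      using Z(2) that by simp
    show "b1 + a3 \<le> n + 1 \<and> card Z \<le> a3 + b1 - min (n + 1 - (a3 + q)) b1 \<and> card (Z \<inter> {b1..}) \<le> a3 \<or>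
      n + 1 \<le> b1 + a3 \<and> card Z \<le> a3 + q"
      using card by (auto simp: bound_def g_def b3 split: if_splits)
    show "i < b1 \<and> i + (a3 + q) \<le> n" if "(if i < b1 then c i else 0) \<noteq> 0" for i
      using c[of i] that unfolding b3 by (cases "i < b1") simp_all
    show "b1 \<le> i \<and> i + a3 \<le> n" if "(if i < b1 then 0 else c i) \<noteq> 0" for i
      using c[of i] that by (cases "i < b1") simp_all
  qed (rule Z(1))
  then show ?thesis by (cases "i < b1") simp_all
qed

lemma injective_case:
  assumes card: "card ({..n} - T) \<le> bound" and n: "n = Suc j"
  shows "lef_inj 3 G (lin_form 3 (\<lambda>i. if i = vx then 1 else - 1 :: rat)) j"
  unfolding lef_inj_def
proof (intro ballI impI)
  fix f :: "rat mpoly" and m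
  let ?L = "lin_form 3 (\<lambda>i. if i = vx then 1 else - 1 :: rat)"
  assume f: "f \<in> forms 3 j" "\<forall>m\<in>G. lookup (?L * f) m = 0" and m: "m \<in> G"
  define f' where "f' = restr G f"
  have f': "f' \<in> forms 3 j" using f(1) unfolding f'_def by (rule restr_forms)
  define F where "F = level j f'"
  have supp: "t + k \<le> j \<and> mon t (j - t - k) k \<in> G" if "F k t \<noteq> 0" for k t
    using that by (auto simp: F_def level_def f'_def lookup_restr split: if_splits)
  have eq: "dl (F k) t = (if k = 0 then 0 else F (k - 1) t)" if "t + k \<le> n" "mon t (n - t - k) k \<in> G" for k t
    using lookup_times_level[of t k j f'] that f(2) lookup_times_restr[OF down_closed_below that(2), of ?L f]
    by (simp add: n F_def f'_def)
  define c where "c i = (if i < b1 then F (b3 - 1) i else F (a3 - 1) i)" for i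
  define u where "u i = (if i < b1 then c i else 0)" for i
  have us: "u i = 0" if "n < i + b3" for i
    using supp[of "b3 - 1" i] that by (auto simp: u_def c_def n b3_def)
  have usp: "(dl ^^ s) u i = 0" if "n + s < i + b3" for s i
    by (rule dl_pow_support[OF us that])
  have front: "front c t = (if t < b1 then (dl ^^ q) u t else F (a3 - 1) t)" for t
    by (simp add: front_def u_def[abs_def] c_def)
  have fs: "front c i = 0" if "n < i + a3" for i
  proof (cases "i < b1")
    case True
    then show ?thesis using usp[of q i] that by (simp add: front b3)
  next
    case False
    have "F (a3 - 1) i = 0"
    proof (rule ccontr)
      assume "F (a3 - 1) i \<noteq> 0"
      then have "i + (a3 - 1) \<le> j" using supp by blast
      then show False using that a3_pos n by linarith
    qed
    then show ?thesis using False by (simp add: front)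
  qed
  have fsp: "(dl ^^ s) (front c) i = 0" if "n + s < i + a3" for s i
    by (rule dl_pow_support[OF fs that])
  have upper: "F (b3 - 1 - s) t = (dl ^^ s) u t"
    if "s \<le> q" "t < b1" "t + (b3 - 1 - s) \<le> j" "j - t - (b3 - 1 - s) < b2" for s t
    using that
  proof (induction s arbitrary: t)
    case 0
    then show ?case by (simp add: u_def c_def)
  next
    case (Suc s)
    define k where "k = b3 - 1 - s"
    have k: "k \<ge> 1" "k < b3" "k - 1 = b3 - 1 - Suc s" "k + s + 1 = b3"
      using Suc.prems(1) b3 a3_pos by (auto simp: k_def)
    have tk: "t + k \<le> n" "n - t - k < b2" using Suc.prems(3,4) k n by auto
    then have "F (k - 1) t = dl (F k) t" using eq[of t k] mon_in_G[of t "n - t - k" k] Suc.prems(2) k by simp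
    also have "\<dots> = dl ((dl ^^ s) u) t"
    proof -
      have "F k (t - 1) = (dl ^^ s) u (t - 1)" if "t \<noteq> 0"
        unfolding k_def by (rule Suc.IH) (use Suc.prems tk that n in \<open>auto simp: k_def\<close>)
      \<comment> \<open>The equations have degree \<open>n\<close>, one more than \<open>f\<close>,
        so \<open>t + k = n\<close> may occur; there both sides vanish by their supports.\<close>
      moreover have "F k t = (dl ^^ s) u t"
      proof (cases "t + k \<le> j")
        case True
        then show ?thesis unfolding k_def by (intro Suc.IH) (use Suc.prems tk n in \<open>auto simp: k_def\<close>)
      next
        case False
        then have "F k t = 0" using supp by blast
        moreover have "(dl ^^ s) u t = 0" using False k n by (intro usp) auto
        ultimately show ?thesis by simp
      qed
      ultimately show ?thesis unfolding dl_def by simp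
    qed
    finally show ?case using k by simp
  qed
  have lower: "F (a3 - 1 - s) t = (dl ^^ s) (front c) t"
    if "s < a3" "t + (a3 - 1 - s) \<le> j" "planar t (j - t - (a3 - 1 - s))" for s t
    using that
  proof (induction s arbitrary: t)
    case 0
    show ?case
    proof (cases "t < b1")
      case True
      then show ?thesis using upper[of q t] planar_imp 0 b3 by (simp add: front)
    qed (simp add: front)
  next
    case (Suc s)
    define k where "k = a3 - 1 - s"
    have k: "k \<ge> 1" "k < a3" "k - 1 = a3 - 1 - Suc s" "k + s + 1 = a3"
      using Suc.prems(1) by (auto simp: k_def)
    have "n - t - k = j - t - (a3 - 1 - Suc s)" using k n by simp
    then have tk: "t + k \<le> n" "planar t (n - t - k)" using Suc.prems(2,3) k n by auto
    then have "F (k - 1) t = dl (F k) t" using eq[of t k] mon_in_G[of t "n - t - k" k] k by simp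
    also have "\<dots> = dl ((dl ^^ s) (front c)) t"
    proof -
      have "F k (t - 1) = (dl ^^ s) (front c) (t - 1)" if "t \<noteq> 0"
        unfolding k_def by (rule Suc.IH)
          (use Suc.prems tk that n planar_mono[OF tk(2)] in \<open>auto simp: k_def\<close>)
      moreover have "F k t = (dl ^^ s) (front c) t"
      proof (cases "t + k \<le> j")
        case True
        then show ?thesis unfolding k_def
          by (intro Suc.IH) (use Suc.prems tk n planar_mono[OF tk(2)] in \<open>auto simp: k_def\<close>)
      next
        case False
        then have "F k t = 0" using supp by blast
        moreover have "(dl ^^ s) (front c) t = 0" using False k n by (intro fsp) auto
        ultimately show ?thesis by simp
      qed
      ultimately show ?thesis unfolding dl_def by simp
    qed
    finally show ?case using k by simp
  qed
  \<comment> \<open>At \<open>z\<close>-degree 0 there is no slice below, so the descent ends with a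
    condition on \<open>front c\<close> instead of determining another slice.\<close>
  have bottom: "(dl ^^ a3) (front c) t = 0" if t: "t \<le> n" "planar t (n - t)" for t
  proof -
    define s where "s = a3 - 1"
    have s: "a3 = Suc s" "s < a3" "a3 - 1 - s = 0" using a3_pos by (auto simp: s_def)
    have 1: "F 0 (t - 1) = (dl ^^ s) (front c) (t - 1)" if "t \<noteq> 0"
      using lower[OF s(2), of "t - 1"] planar_mono[OF t(2)] t n that unfolding s(3) by auto
    have 2: "F 0 t = (dl ^^ s) (front c) t"
    proof (cases "t \<le> j")
      case True
      then show ?thesis using lower[OF s(2), of t] planar_mono[OF t(2)] n unfolding s(3) by auto
    next
      case False
      then have "F 0 t = 0" using supp[of 0 t] by auto
      moreover have "(dl ^^ s) (front c) t = 0" using False s n by (intro fsp) auto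
      ultimately show ?thesis by simp
    qed
    have "(dl ^^ a3) (front c) t = dl ((dl ^^ s) (front c)) t" by (simp add: s(1))
    also have "\<dots> = dl (F 0) t" using 1 2 by (intro dl_cong) auto
    also have "\<dots> = 0" using eq[of t 0] t mon_in_G[of t "n - t" 0] a3_pos by simp
    finally show ?thesis .
  qed
  have c0: "c i = 0" for i
  proof (rule front_injective[of c "{..n} - T"])
    fix i assume "c i \<noteq> 0"
    then show "i + (if i < b1 then b3 else a3) \<le> n"
      using supp[of "b3 - 1" i] supp[of "a3 - 1" i] a3_pos b3 n by (auto simp: c_def split: if_splits)
  next
    fix t assume "(dl ^^ a3) (front c) t \<noteq> 0"
    then show "t \<in> {..n} - T" using bottom[of t] fsp[of a3 t] by (force simp: T_def)
  next
    \<comment> \<open>At least \<open>b1 - g\<close> of the at most \<open>a3 + b1 - g\<close>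
      missing places are below \<open>b1\<close>, so at most \<open>a3\<close> are left from
      \<open>b1\<close> on.\<close>
    assume *: "b1 + a3 \<le> n + 1"
    have "card (({..n} - T) \<inter> {b1..}) + card (({..n} - T) \<inter> {..<b1}) = card ({..n} - T)"
      by (subst card_Un_disjoint[symmetric]) (auto intro!: arg_cong[where f=card])
    with card low_count * show "card (({..n} - T) \<inter> {b1..}) \<le> a3"
      unfolding bound_def g_def by (simp split: if_splits)
  qed (use card in auto)
  then have u0: "(dl ^^ s) u t = 0" for s t by (intro dl_pow_lower[of "Suc t"]) (auto simp: u_def)
  have fr0: "front c t = 0" for t using u0 c0[of t] by (simp add: front c_def split: if_splits)
  then have fr: "(dl ^^ s) (front c) t = 0" for s t by (intro dl_pow_lower[of "Suc t"]) auto
  show "lookup f m = 0"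
  proof (cases "mono_degree m = j")
    case True
    have km: "keys m \<subseteq> {..<3}" using below_keys[of "{A, B}" 3] AB m by auto
    define t k where "t = lookup m vx" and "k = lookup m vz"
    have tk: "t + k \<le> j" "lookup m vy = j - t - k" using degree3[OF km] True by (auto simp: t_def k_def)
    then have m': "m = mon t (j - t - k) k" using mon_eq[OF km] by (simp add: t_def k_def)
    have "F k t = 0"
    proof (cases "k < a3")
      case True
      then have "planar t (j - t - k)" using m mon_in_G[of t "j - t - k" k] unfolding m' by (auto simp: planar_def)
      then show ?thesis using lower[of "a3 - 1 - k" t] True tk fr by simp
    next
      case False
      then have "t < b1" "j - t - k < b2" "k < b3" using m mon_in_G[of t "j - t - k" k] unfolding m' by auto
      then show ?thesis using upper[of "b3 - 1 - k" t] False tk u0 b3 by simp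
    qed
    then show ?thesis using tk m unfolding F_def level_def f'_def lookup_restr m' by simp
  qed (rule forms_lookup_0[OF f(1)])
qed

lemma front_linear: "front (\<lambda>i. b i + x * c i) = (\<lambda>t. front b t + x * front c t)"
proof
  fix t
  have "(\<lambda>i. if i < b1 then b i + x * c i else 0) = (\<lambda>i. (if i < b1 then b i else 0) + x * (if i < b1 then c i else 0))"
    by auto
  then show "front (\<lambda>i. b i + x * c i) t = front b t + x * front c t" by (simp add: front_def dl_pow_linear)
qed

text \<open>Exactly \<open>bound\<close> missing places form \<open>Z\<close> and are left free; at
  all other places up to \<open>n\<close> a value is prescribed, also outside \<open>T\<close>. The
  system is square, and \<open>front_injective\<close> for \<open>Z\<close> gives its trivial
  kernel.\<close>

lemma front_solvable:
  assumes card: "bound < card ({..n} - T)"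
  shows "\<exists>c. (\<forall>i. c i \<noteq> 0 \<longrightarrow> i + (if i < b1 then b3 else a3) \<le> n) \<and> (\<forall>t\<in>T. (dl ^^ a3) (front c) t = h t)"
proof -
  let ?Z = "{..n} - T"
  have "\<exists>Z \<subseteq> ?Z. card Z = bound \<and> (b1 + a3 \<le> n + 1 \<longrightarrow> card (Z \<inter> {b1..}) \<le> a3)"
  proof (cases "b1 + a3 \<le> n + 1")
    case False
    then show ?thesis using obtain_subset_with_card_n[of bound ?Z] card by (metis less_imp_le)
  next
    case True
    have bd: "bound = a3 + b1 - g" "g \<le> b1" using True by (auto simp: bound_def g_def)
    \<comment> \<open>From \<open>b1\<close> on as many places are taken as
      \<open>front_injective\<close> permits; \<open>low_count\<close> provides the remaining ones
      below \<open>b1\<close>.\<close>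
    define hi where "hi = min (card (?Z \<inter> {b1..})) a3"
    have split: "card (?Z \<inter> {b1..}) + card (?Z \<inter> {..<b1}) = card ?Z"
      by (subst card_Un_disjoint[symmetric]) (auto intro!: arg_cong[where f=card])
    have "bound - hi \<le> card (?Z \<inter> {..<b1})" using card split low_count bd unfolding hi_def by linarith
    then obtain Z1 where Z1: "Z1 \<subseteq> ?Z \<inter> {..<b1}" "card Z1 = bound - hi" using obtain_subset_with_card_n by metis
    obtain Z2 where Z2: "Z2 \<subseteq> ?Z \<inter> {b1..}" "card Z2 = hi"
      using obtain_subset_with_card_n[of hi "?Z \<inter> {b1..}"] by (metis hi_def min.cobounded1)
    have fin: "finite Z1" "finite Z2" using Z1 Z2 by (auto intro: finite_subset)
    have "hi \<le> bound" using bd by (auto simp: hi_def)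
    moreover have z: "\<forall>x\<in>Z1. x < b1" "\<forall>x\<in>Z2. b1 \<le> x" using Z1(1) Z2(1) by blast+
    then have "Z1 \<inter> Z2 = {}" by (meson disjoint_iff leD)
    ultimately have "card (Z1 \<union> Z2) = bound" using fin Z1 Z2 by (simp add: card_Un_disjoint)
    moreover have "(Z1 \<union> Z2) \<inter> {b1..} = Z2" using z by (auto simp: leD)
    then have "card ((Z1 \<union> Z2) \<inter> {b1..}) \<le> a3" using Z2 by (simp add: hi_def)
    ultimately show ?thesis using Z1 Z2 by (intro exI[of _ "Z1 \<union> Z2"]) auto
  qed
  then obtain Z where Z: "Z \<subseteq> ?Z" "card Z = bound" "b1 + a3 \<le> n + 1 \<Longrightarrow> card (Z \<inter> {b1..}) \<le> a3" by blast
  have finZ: "finite Z" using Z(1) by (rule finite_subset) simp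
  define K where "K = {..<g} \<union> {b1..<n + 1 - a3}"
  have gb: "g \<le> b1" by (simp add: g_def)
  then have cK: "card K = g + (n + 1 - a3 - b1)" unfolding K_def by (subst card_Un_disjoint) auto
  have Kiff: "i \<in> K \<longleftrightarrow> i + (if i < b1 then b3 else a3) \<le> n" for i
    using gb b3 by (auto simp: K_def g_def)
  have le: "bound \<le> n + 1" using card card_mono[of "{..n}" ?Z] by auto
  have cT: "card ({..n} - Z) = n + 1 - bound" using Z(1,2) finZ by (subst card_Diff_subset) auto
  have "\<exists>c. (\<forall>i. i \<notin> K \<longrightarrow> c i = 0) \<and> (\<forall>t\<in>{..n} - Z. (dl ^^ a3) (front c) t = h t)"
  proof (rule linear_system_solvable)
    show "card ({..n} - Z) \<le> card K"
      unfolding cT cK using le b3 a3_pos unfolding bound_def g_def by (auto split: if_splits)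
    show "(dl ^^ a3) (front (\<lambda>i. b i + x * c i)) t = (dl ^^ a3) (front b) t + x * (dl ^^ a3) (front c) t" for b x c t
      by (simp add: front_linear dl_pow_linear)
    fix c :: "nat \<Rightarrow> rat" assume c: "\<And>i. i \<notin> K \<Longrightarrow> c i = 0" "\<And>t. t \<in> {..n} - Z \<Longrightarrow> (dl ^^ a3) (front c) t = 0"
    have "(if i < b1 then c i else 0) = 0" if "n < i + b3" for i using c(1)[of i] Kiff[of i] that by (cases "i < b1") auto
    then have sup: "(dl ^^ q) (\<lambda>i. if i < b1 then c i else 0) i = 0" if "n + q < i + b3" for i
      using that by (rule dl_pow_support)
    have fs: "front c i = 0" if "n < i + a3" for i
    proof (cases "i < b1")
      case True
      then show ?thesis using sup[of i] that by (simp add: front_def b3)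
    next
      case False
      then show ?thesis using c(1)[of i] Kiff[of i] that by (simp add: front_def)
    qed
    have "c i = 0" for i
    proof (rule front_injective[of c Z])
      show "i + (if i < b1 then b3 else a3) \<le> n" if "c i \<noteq> 0" for i using that c(1) Kiff by blast
      show "t \<in> Z" if "(dl ^^ a3) (front c) t \<noteq> 0" for t
        using that c(2)[of t] dl_pow_support[of n a3 "front c" a3 t] fs by force
    qed (use Z finZ in auto)
    then show "\<forall>i\<in>K. c i = 0" by blast
  qed (auto simp: K_def)
  then obtain c where c: "\<forall>i. i \<notin> K \<longrightarrow> c i = 0" "\<forall>t\<in>{..n} - Z. (dl ^^ a3) (front c) t = h t" by blast
  moreover have "T \<subseteq> {..n} - Z" using Z(1) by (auto simp: T_def)
  ultimately show ?thesis using Kiff by (intro exI[of _ c]) blast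
qed

lemma surjective_case:
  assumes card: "bound < card ({..n} - T)" and n: "n = Suc j"
  shows "lef_surj 3 G (lin_form 3 (\<lambda>i. if i = vx then 1 else - 1 :: rat)) j n"
  unfolding lef_surj_def
proof
  fix h :: "rat mpoly" assume h: "h \<in> forms 3 n"
  let ?L = "lin_form 3 (\<lambda>i. if i = vx then 1 else - 1 :: rat)"
  \<comment> \<open>\<open>e s\<close> is the slice at \<open>z\<close>-degree \<open>n - s\<close>
    of a particular solution: it is zero at the top, since \<open>f\<close> has degree
    \<open>j\<close>, and each equation of positive \<open>z\<close>-degree defines the next slice.
    Only the equation at \<open>z\<close>-degree 0 may fail, and \<open>c\<close> corrects
    it.\<close>
  define e where "e = rec_nat (\<lambda>_. 0) (\<lambda>s c t. dl c t - level n h (n - s) t)"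
  have e: "e 0 = (\<lambda>_. 0)" "e (Suc s) = (\<lambda>t. dl (e s) t - level n h (n - s) t)" for s by (simp_all add: e_def)
  have es: "e s t = 0" if "s \<le> n" "s \<le> t" for s t
    using that by (induction s arbitrary: t) (auto simp: e dl_def level_def)
  obtain c where c: "\<And>i. c i \<noteq> 0 \<Longrightarrow> i + (if i < b1 then b3 else a3) \<le> n"
    "\<And>t. t \<in> T \<Longrightarrow> (dl ^^ a3) (front c) t = level n h 0 t - dl (e n) t"
    using front_solvable[OF card, of "\<lambda>t. level n h 0 t - dl (e n) t"] by blast
  define u where "u i = (if i < b1 then c i else 0)" for i
  have us: "u i = 0" if "n < i + b3" for i using c(1)[of i] that by (cases "c i = 0") (auto simp: u_def)
  have usp: "(dl ^^ s) u i = 0" if "n + s < i + b3" for s i by (rule dl_pow_support[OF us that])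
  have front: "front c t = (if t < b1 then (dl ^^ q) u t else c t)" for t
    by (simp add: front_def u_def[abs_def])
  have fs: "front c i = 0" if "n < i + a3" for i
  proof (cases "i < b1")
    case True
    then show ?thesis using usp[of q i] that by (simp add: front b3)
  next
    case False
    then show ?thesis using c(1)[of i] that by (cases "c i = 0") (simp_all add: front)
  qed
  have fsp: "(dl ^^ s) (front c) i = 0" if "n + s < i + a3" for s i by (rule dl_pow_support[OF fs that])
  \<comment> \<open>The correction, spread downwards from the top coefficients so that it solves the
    homogeneous equations of positive \<open>z\<close>-degree at the monomials of
    \<open>G\<close>.\<close>
  define F1 where "F1 k t = (if k < a3 then (dl ^^ (a3 - 1 - k)) (front c) t
    else if k < b3 \<and> t < b1 then (dl ^^ (b3 - 1 - k)) u t else 0)" for k t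
  define F where "F k t = e (n - k) t + F1 k t" for k t
  have "F k t = 0" if "j < t + k" for k t
  proof -
    have "e (n - k) t = 0" using that n by (intro es) auto
    moreover have "F1 k t = 0"
    proof -
      have "k < a3 \<Longrightarrow> (dl ^^ (a3 - 1 - k)) (front c) t = 0" using that n by (intro fsp) auto
      moreover have "k < b3 \<Longrightarrow> (dl ^^ (b3 - 1 - k)) u t = 0" using that n by (intro usp) auto
      ultimately show ?thesis by (simp add: F1_def)
    qed
    ultimately show ?thesis by (simp add: F_def)
  qed
  then obtain f where f: "f \<in> forms 3 j" "level j f = F" using level_exists[of j F] by blast
  have dlF: "dl (F k) t = dl (e (n - k)) t + dl (F1 k) t" for k t by (simp add: dl_def F_def)
  have main: "dl (F k) t - (if k = 0 then 0 else F (k - 1) t) = level n h k t"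
    if tk: "t + k \<le> n" "mon t (n - t - k) k \<in> G" for t k
  proof (cases "k = 0")
    case True
    obtain s where s: "a3 = Suc s" using a3_pos by (cases a3) auto
    have "t \<in> T" using tk mon_in_G[of t "n - t" 0] by (auto simp: T_def True planar_def)
    moreover have "dl (F1 0) t = (dl ^^ a3) (front c) t" by (simp add: F1_def[abs_def] s dl_def[of "F1 0"])
    ultimately show ?thesis using c(2)[of t] by (simp add: True dlF)
  next
    case False
    have "e (n - (k - 1)) t = dl (e (n - k)) t - level n h k t"
      using e(2)[of "n - k"] tk(1) False by (simp add: Suc_diff_le Suc_diff_Suc)
    moreover have "dl (F1 k) t = F1 (k - 1) t"
    proof (cases "k < a3")
      case True
      then have k1: "a3 - 1 - (k - 1) = Suc (a3 - 1 - k)" "k - 1 < a3" using False by simp_all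
      have "F1 k = (dl ^^ (a3 - 1 - k)) (front c)" using True by (simp add: F1_def fun_eq_iff)
      moreover have "F1 (k - 1) t = (dl ^^ (a3 - 1 - (k - 1))) (front c) t" using k1(2) by (simp add: F1_def)
      ultimately show ?thesis unfolding k1(1) by simp
    next
      case a3k: False
      then have tb: "t < b1" "k < b3" using tk(2) mon_in_G[of t "n - t - k" k] by auto
      have 1: "dl (F1 k) t = (dl ^^ Suc (b3 - 1 - k)) u t"
        using tb a3k by (simp add: F1_def dl_def)
      have 2: "b3 - 1 - (k - 1) = Suc (b3 - 1 - k)" using False tb by simp
      \<comment> \<open>At \<open>k = a3\<close> the slices over the base of \<open>B\<close> join
        \<open>front c\<close>, with which the next one agrees below \<open>b1\<close>.\<close>
      show ?thesis
      proof (cases "k = a3")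
        case True
        then have "Suc (b3 - 1 - k) = q" using tb b3 by simp
        then show ?thesis unfolding 1 using True False tb by (simp add: F1_def front del: funpow.simps)
      next
        case False
        then have "\<not> k - 1 < a3" "k - 1 < b3" using a3k tb by auto
        then have "F1 (k - 1) t = (dl ^^ (b3 - 1 - (k - 1))) u t" using tb(1) by (simp add: F1_def)
        then show ?thesis unfolding 1 2 ..
      qed
    qed
    ultimately show ?thesis using False by (simp add: dlF) (simp add: F_def)
  qed
  have "lookup (?L * f) m = lookup h m" if m: "m \<in> G" for m
  proof (cases "mono_degree m = n")
    case True
    have km: "keys m \<subseteq> {..<3}" using below_keys[of "{A, B}" 3] AB m by auto
    define t k where "t = lookup m vx" and "k = lookup m vz"
    have tk: "t + k \<le> n" "lookup m vy = n - t - k" using degree3[OF km] True by (auto simp: t_def k_def)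
    then have m': "m = mon t (n - t - k) k" using mon_eq[OF km] by (simp add: t_def k_def)
    show ?thesis using main[OF tk(1)] m lookup_times_level[of t k j f] tk(1)
      unfolding m' f(2) n by (simp add: level_def)
  next
    case False
    have Lf: "?L * f \<in> forms 3 (1 + j)" by (rule forms_mult[OF lin_form_in_forms f(1)])
    show ?thesis using False forms_lookup_0[OF Lf, of m] forms_lookup_0[OF h, of m] n by simp
  qed
  then show "\<exists>f\<in>forms 3 j. \<forall>m\<in>G. lookup (?L * f) m = lookup h m" using f(1) by blast
qed

end

subsection \<open>Lefschetz properties that hold\<close>

text \<open>If the target degree is at most half the socle degree, multiplication is injective on
  each box and therefore on the union, as vanishing on \<open>below {A, B}\<close> means vanishing
  on both boxes. Larger degrees are those covered by the locale.\<close>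

lemma two_boxes_rat:
  assumes "three_variables vx vy vz" and AB: "keys A \<subseteq> {..<3}" "keys B \<subseteq> {..<3}"
    and deg: "mono_degree A = mono_degree B"
    and less: "lookup B vx < lookup A vx" "lookup A vy \<le> lookup B vy" "lookup A vz \<le> lookup B vz"
  shows "lef_inj 3 (below {A, B}) (lin_form 3 (\<lambda>i. if i = vx then 1 else - 1 :: rat)) j \<or>
    lef_surj 3 (below {A, B}) (lin_form 3 (\<lambda>i. if i = vx then 1 else - 1 :: rat)) j (j + 1)"
proof (cases "mono_degree B < 2 * Suc j")
  case True
  interpret three_variables vx vy vz by fact
  interpret two_boxes vx vy vz A B "Suc j"
    by unfold_locales (use AB less True in auto)
  show ?thesis
    using injective_case[OF _ refl] surjective_case[OF _ refl] by (cases "card ({..Suc j} - T) \<le> bound") auto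
next
  case False
  have AB': "below {A, B} = below {A} \<union> below {B}" by (auto simp: below_def)
  have "lef_inj 3 (below {g}) (lin_form 3 (\<lambda>i. if i = vx then 1 else - 1 :: rat)) j" if "g = A \<or> g = B" for g
    using box_injective[of 3 "\<lambda>i. if i = vx then 1 else - 1 :: rat" g j 1] that AB deg False by auto
  from this[of A] this[of B] show ?thesis unfolding lef_inj_def AB' by blast
qed

text \<open>The monomials differ but have equal degree, so one of them strictly exceeds the other in
  exactly one variable, which becomes \<open>vx\<close>. The resulting form does not depend on
  \<open>j\<close>, as the Lefschetz property demands.\<close>

lemma type_two_max_rank:
  assumes C: "card C = 2" "C \<subseteq> {m. keys m \<subseteq> {..<3} \<and> mono_degree m = e}"
  shows "\<exists>a. \<forall>j. lef_inj 3 (below C) (lin_form 3 a :: ('k::field_char_0) mpoly) j \<or>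
    lef_surj 3 (below C) (lin_form 3 a :: 'k mpoly) j (j + 1)"
proof -
  obtain A B where AB: "C = {A, B}" "A \<noteq> B" using C(1) by (auto simp: card_2_iff)
  have A: "keys A \<subseteq> {..<3}" "mono_degree A = e" and B: "keys B \<subseteq> {..<3}" "mono_degree B = e"
    using C(2) AB by auto
  have tv: "three_variables 0 1 2" "three_variables 1 0 2" "three_variables 2 0 1"
    by unfold_locales auto
  have sum: "lookup A 0 + lookup A 1 + lookup A 2 = lookup B 0 + lookup B 1 + lookup B 2"
    using three_variables.degree3[OF tv(1) A(1)] three_variables.degree3[OF tv(1) B(1)] A B by simp
  have ne: "lookup A 0 \<noteq> lookup B 0 \<or> lookup A 1 \<noteq> lookup B 1 \<or> lookup A 2 \<noteq> lookup B 2"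
    using three_variables.mon_eq[OF tv(1) A(1)] three_variables.mon_eq[OF tv(1) B(1)] AB(2) by auto
  have main: ?thesis if "three_variables vx vy vz" "{P, Q} = C" "lookup Q vx < lookup P vx"
    "lookup P vy \<le> lookup Q vy" "lookup P vz \<le> lookup Q vz" for vx vy vz P Q
  proof -
    have PQ: "keys P \<subseteq> {..<3}" "keys Q \<subseteq> {..<3}" "mono_degree P = mono_degree Q" using that(2) C(2) by auto
    let ?a = "\<lambda>i. if i = vx then 1 else - 1 :: int"
    have fin: "finite (below C)" "below C \<subseteq> {m. keys m \<subseteq> {..<3}}"
      using finite_below[of C 3] below_keys[of C 3] C by (auto simp: AB)
    have eq: "(\<lambda>i. of_int (?a i) :: rat) = (\<lambda>i. if i = vx then 1 else - 1)" by auto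
    have "lef_inj 3 (below C) (lin_form 3 (\<lambda>i. of_int (?a i) :: rat) ^ 1) j \<or>
        lef_surj 3 (below C) (lin_form 3 (\<lambda>i. of_int (?a i) :: rat) ^ 1) j (j + 1)" for j
      using two_boxes_rat[OF that(1) PQ that(3-5), of j] unfolding eq that(2) by simp
    then have "lef_inj 3 (below C) (lin_form 3 (\<lambda>i. of_int (?a i) :: 'k) ^ 1) j \<or>
        lef_surj 3 (below C) (lin_form 3 (\<lambda>i. of_int (?a i) :: 'k) ^ 1) j (j + 1)" for j
      by (rule maximal_rank_transfer[OF fin])
    then show ?thesis unfolding power_one_right by blast
  qed
  have CBA: "{A, B} = C" "{B, A} = C" using AB(1) by auto
  show ?thesis
  proof (cases "lookup A 0 \<le> lookup B 0"; cases "lookup A 1 \<le> lookup B 1"; cases "lookup A 2 \<le> lookup B 2")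
    assume *: "lookup A 0 \<le> lookup B 0" "lookup A 1 \<le> lookup B 1" "lookup A 2 \<le> lookup B 2"
    then show ?thesis using sum ne by linarith
  next
    assume "lookup A 0 \<le> lookup B 0" "lookup A 1 \<le> lookup B 1" "\<not> lookup A 2 \<le> lookup B 2"
    then show ?thesis by (intro main[OF tv(3) CBA(1)]) auto
  next
    assume "lookup A 0 \<le> lookup B 0" "\<not> lookup A 1 \<le> lookup B 1" "lookup A 2 \<le> lookup B 2"
    then show ?thesis by (intro main[OF tv(2) CBA(1)]) auto
  next
    assume "lookup A 0 \<le> lookup B 0" "\<not> lookup A 1 \<le> lookup B 1" "\<not> lookup A 2 \<le> lookup B 2"
    then show ?thesis using sum by (intro main[OF tv(1) CBA(2)]) auto
  next
    assume "\<not> lookup A 0 \<le> lookup B 0" "lookup A 1 \<le> lookup B 1" "lookup A 2 \<le> lookup B 2"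
    then show ?thesis by (intro main[OF tv(1) CBA(1)]) auto
  next
    assume "\<not> lookup A 0 \<le> lookup B 0" "lookup A 1 \<le> lookup B 1" "\<not> lookup A 2 \<le> lookup B 2"
    then show ?thesis using sum by (intro main[OF tv(2) CBA(2)]) auto
  next
    assume "\<not> lookup A 0 \<le> lookup B 0" "\<not> lookup A 1 \<le> lookup B 1" "lookup A 2 \<le> lookup B 2"
    then show ?thesis using sum by (intro main[OF tv(3) CBA(2)]) auto
  next
    assume "\<not> lookup A 0 \<le> lookup B 0" "\<not> lookup A 1 \<le> lookup B 1" "\<not> lookup A 2 \<le> lookup B 2"
    then show ?thesis using sum by linarith
  qed
qed

lemma two_variables_max_rank:
  assumes G: "finite G" "G \<subseteq> {m. keys m \<subseteq> {..<2}}"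
  defines "L \<equiv> lin_form 2 (\<lambda>i. of_int (if i = 0 then 1 else - 1)) :: ('k::field_char_0) mpoly"
  shows "lef_inj 2 G (L ^ s) j \<or> lef_surj 2 G (L ^ s) j (j + s)"
proof -
  have eq: "(\<lambda>i. of_int (if i = 0 then 1 else - 1) :: rat) = (\<lambda>i::nat. if i = 0 then 1 else - 1)" by auto
  have "lef_inj 2 G (lin_form 2 (\<lambda>i. of_int (if i = 0 then 1 else - 1) :: rat) ^ s) j \<or>
      lef_surj 2 G (lin_form 2 (\<lambda>i. of_int (if i = 0 then 1 else - 1) :: rat) ^ s) j (j + s)"
    using two_variables_rat[OF G(2), of s j] unfolding eq .
  from maximal_rank_transfer[OF G this] show ?thesis unfolding L_def .
qed

lemma strong_imp_weak: "strong_lefschetz r I \<Longrightarrow> weak_lefschetz r I"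
  unfolding strong_lefschetz_def weak_lefschetz_def by (meson order_refl)

lemma strong_lefschetz_positive:
  fixes I :: "('k::field_char_0) mpoly set"
  assumes I: "monomial_artinian_level r d I" and "r \<ge> 1" "d \<ge> 1" and rd: "r = 1 \<or> r = 2 \<or> d = 1"
  shows "strong_lefschetz r I"
proof -
  obtain C e where C: "finite C" "card C = d" "C \<subseteq> {m. keys m \<subseteq> {..<r} \<and> mono_degree m = e}"
    and I': "I = avoiding r (below C)" using level_imp_below[OF I \<open>r \<ge> 1\<close>] by blast
  have dc: "down_closed (below C)" by (rule down_closed_below)
  show ?thesis
  proof (cases "r = 2")
    case True
    have G: "finite (below C)" "below C \<subseteq> {m. keys m \<subseteq> {..<2}}"
      using finite_below[of C 2] below_keys[of C 2] C True by auto
    show ?thesis unfolding strong_lefschetz_def I' True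
      using maximal_rank_iff[OF dc lin_form_in_forms] two_variables_max_rank[OF G, where 'k='k] lin_form_in_forms by blast
  next
    case False
    have "\<exists>g. C = {g}"
    proof (cases "d = 1")
      case True
      then show ?thesis using C(2) by (simp add: card_1_singleton_iff)
    next
      case False
      with rd \<open>r \<noteq> 2\<close> have r: "r = 1" by simp
      \<comment> \<open>In one variable there is only one monomial of each degree, so this case is a
        box too.\<close>
      have "m = single 0 e" if "m \<in> C" for m
      proof (rule poly_mapping_eqI)
        fix i
        have m: "keys m \<subseteq> {..<1}" "mono_degree m = e" using that C(3) r by auto
        then have "lookup m 0 = e" using mono_degree_eq[OF m(1)] by simp
        moreover have "i \<noteq> 0 \<Longrightarrow> lookup m i = 0" using m(1) by (auto simp: in_keys_iff)
        ultimately show "lookup m i = lookup (single 0 e) i" by (auto simp: lookup_single when_def)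
      qed
      moreover have "C \<noteq> {}" using C(2) \<open>d \<ge> 1\<close> by auto
      ultimately show ?thesis by (intro exI[of _ "single 0 e"]) auto
    qed
    then obtain g where g: "C = {g}" by blast
    then have "keys g \<subseteq> {..<r}" using C(3) by auto
    then have "lef_inj r (below C) (lin_form r (\<lambda>_. 1 :: 'k) ^ s) j \<or>
        lef_surj r (below C) (lin_form r (\<lambda>_. 1 :: 'k) ^ s) j (j + s)" for s j
      unfolding g by (intro box_strong_lefschetz) auto
    then show ?thesis unfolding strong_lefschetz_def I'
      using maximal_rank_iff[OF dc lin_form_in_forms] lin_form_in_forms by blast
  qed
qed

lemma weak_lefschetz_3_2:
  fixes I :: "('k::field_char_0) mpoly set"
  assumes I: "monomial_artinian_level 3 2 I"
  shows "weak_lefschetz 3 I"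
proof -
  obtain C e where C: "finite C" "card C = 2" "C \<subseteq> {m. keys m \<subseteq> {..<3} \<and> mono_degree m = e}"
    and I': "I = avoiding 3 (below C)" using level_imp_below[OF I] by auto
  have dc: "down_closed (below C)" by (rule down_closed_below)
  obtain a where a: "\<And>j. lef_inj 3 (below C) (lin_form 3 a :: 'k mpoly) j \<or>
    lef_surj 3 (below C) (lin_form 3 a :: 'k mpoly) j (j + 1)" using type_two_max_rank[OF C(2,3)] by blast
  then have "maximal_rank 3 I (lin_form 3 a) 1 j" for j
    unfolding I' maximal_rank_iff[OF dc lin_form_in_forms] by simp
  then show ?thesis unfolding weak_lefschetz_def using lin_form_in_forms by blast
qed

subsection \<open>Failure of the Weak Lefschetz Property\<close>

lemma lookup_lin_form_times_0:
  assumes "\<And>i. i < r \<Longrightarrow> l i \<noteq> 0 \<Longrightarrow> lookup t i \<noteq> 0 \<Longrightarrow> lookup f (t - single i 1) = 0"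
  shows "lookup (lin_form r l * f) t = 0"
  unfolding lookup_lin_form_times using assms by (intro sum.neutral) auto

lemma lookup_lin_form_times_single:
  assumes "lookup (lin_form r l * single s 1) t \<noteq> 0"
  shows "\<exists>i<r. l i \<noteq> 0 \<and> t = s + single i 1"
proof (rule ccontr)
  assume no: "\<not> (\<exists>i<r. l i \<noteq> 0 \<and> t = s + single i 1)"
  have "lookup (lin_form r l * single s 1) t = 0"
  proof (rule lookup_lin_form_times_0)
    fix i assume i: "i < r" "l i \<noteq> 0" "lookup t i \<noteq> 0"
    have "t = (t - single i 1) + single i 1"
      by (rule poly_mapping_eqI) (use i(3) in \<open>auto simp: lookup_add lookup_minus lookup_single when_def\<close>)
    then have "s \<noteq> t - single i 1" using no i by metis
    then show "lookup (single s 1) (t - single i 1) = 0" by (simp add: lookup_single)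
  qed
  with assms show False by simp
qed

lemma not_weak_lefschetz_avoiding:
  fixes G :: "(nat \<Rightarrow>\<^sub>0 nat) set"
  assumes "down_closed G"
    and "\<And>l :: nat \<Rightarrow> 'k::field. \<not> lef_inj r G (lin_form r l) j \<and> \<not> lef_surj r G (lin_form r l) j (Suc j)"
  shows "\<not> weak_lefschetz r (avoiding r G :: 'k mpoly set)"
proof
  assume "weak_lefschetz r (avoiding r G :: 'k mpoly set)"
  then obtain L :: "'k mpoly" where L: "L \<in> forms r 1" "maximal_rank r (avoiding r G) L 1 j"
    unfolding weak_lefschetz_def by blast
  then have "lef_inj r G L j \<or> lef_surj r G L j (Suc j)"
    using maximal_rank_iff[OF assms(1) L(1), of 1 j] by simp
  then show False using assms(2) linear_form_eq[OF L(1)] by metis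
qed

text \<open>The exponent of \<open>x\<^sub>0 ^ h 0 * \<dots> * x\<^sub>m\<^sub>-\<^sub>1 ^ h (m - 1) * y ^ u * z ^ v\<close>, where \<open>y\<close> and \<open>z\<close> are the last two variables.\<close>

definition ex :: "nat \<Rightarrow> (nat \<Rightarrow> nat) \<Rightarrow> nat \<Rightarrow> nat \<Rightarrow> nat \<Rightarrow>\<^sub>0 nat"
  where "ex m h u v = (\<Sum>i<m. single i (h i)) + single m u + single (Suc m) v"

lemma lookup_ex: "lookup (ex m h u v) i = (if i < m then h i else if i = m then u else if i = Suc m then v else 0)"
proof -
  have "lookup (\<Sum>k<m. single k (h k)) i = (\<Sum>k<m. if k = i then h i else 0)"
    by (auto simp: lookup_sum lookup_single when_def intro!: sum.cong)
  then show ?thesis by (auto simp: ex_def lookup_add lookup_single when_def)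
qed

lemma keys_ex: "keys (ex m h u v) \<subseteq> {..<m + 2}"
  by (auto simp: in_keys_iff lookup_ex split: if_splits)

lemma degree_m2: "keys t \<subseteq> {..<m + 2} \<Longrightarrow> mono_degree t = (\<Sum>i<m. lookup t i) + lookup t m + lookup t (Suc m)"
  by (simp add: mono_degree_eq)

lemma degree_ex: "mono_degree (ex m h u v) = (\<Sum>i<m. h i) + u + v"
  using degree_m2[OF keys_ex, of m h u v] by (simp add: lookup_ex)

lemma ex_inject: "ex m h u v = ex m h' u' v' \<Longrightarrow> u = u' \<and> v = v'"
  using lookup_ex[of m h u v m] lookup_ex[of m h' u' v' m] lookup_ex[of m h u v "Suc m"] lookup_ex[of m h' u' v' "Suc m"]
  by simp

lemma ex_eqI: "keys t \<subseteq> {..<m + 2} \<Longrightarrow> (\<And>i. i < m \<Longrightarrow> lookup t i = h i) \<Longrightarrow> lookup t m = u \<Longrightarrow> lookup t (Suc m) = v \<Longrightarrow> t = ex m h u v"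
proof (rule poly_mapping_eqI)
  fix i assume *: "keys t \<subseteq> {..<m + 2}" "\<And>i. i < m \<Longrightarrow> lookup t i = h i" "lookup t m = u" "lookup t (Suc m) = v"
  then have "\<not> i < m + 2 \<Longrightarrow> lookup t i = 0" by (metis in_keys_iff lessThan_iff subsetD)
  then show "lookup t i = lookup (ex m h u v) i" using * by (auto simp: lookup_ex)
qed

text \<open>The socle monomials are \<open>M = x\<^sub>0 * \<dots> * x\<^sub>m\<^sub>-\<^sub>1 * y ^ (2 * a - m) * z ^ (a + 1)\<close> and \<open>d - 1\<close> monomials in \<open>y\<close> and \<open>z\<close>,
  among them \<open>y ^ a * z ^ (2 * a + 1)\<close> and \<open>y ^ (2 * a + 1) * z ^ a\<close>. In degree \<open>2 * a\<close> the multiples of \<open>x\<^sub>0 * \<dots> * x\<^sub>m\<^sub>-\<^sub>1\<close>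
  map into a smaller space, while the pure \<open>y, z\<close> part of the next degree is reached only from a smaller space.\<close>

lemma many_generators_not_weak:
  assumes m: "m \<ge> 1" and d: "d \<ge> 3"
  shows "\<exists>I :: ('k::field) mpoly set. monomial_artinian_level (m + 2) d I \<and> \<not> weak_lefschetz (m + 2) I"
proof -
  \<comment> \<open>\<open>a\<close> only has to be large: \<open>2 * a - m = a + d\<close> exceeds
    \<open>a + 1\<close>, so that the exponents \<open>2 * a - m - k\<close> below are genuine, and
    enough monomials of degree \<open>3 * a + 1\<close> in \<open>y\<close> and \<open>z\<close> are
    available.\<close>
  define a where "a = m + d"
  define M where "M = ex m (\<lambda>_. 1) (2 * a - m) (a + 1)"
  define yz where "yz i = ex m (\<lambda>_. 0) i (3 * a + 1 - i)" for i
  have "\<exists>K. {a, 2 * a + 1} \<subseteq> K \<and> K \<subseteq> {..3 * a + 1} \<and> card K = d - 1"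
  proof -
    have "card ({..3 * a + 1} - {a, 2 * a + 1}) = 3 * a" by (subst card_Diff_subset) auto
    then have "d - 3 \<le> card ({..3 * a + 1} - {a, 2 * a + 1})" by (simp add: a_def)
    then obtain K where K: "K \<subseteq> {..3 * a + 1} - {a, 2 * a + 1}" "card K = d - 3" "finite K"
      by (rule obtain_subset_with_card_n)
    have "a \<notin> K" "2 * a + 1 \<notin> K" "a \<noteq> 2 * a + 1" using K(1) by auto
    then have "card (insert a (insert (2 * a + 1) K)) = d - 1" using K d by simp
    then show ?thesis using K(1) by (intro exI[of _ "insert a (insert (2 * a + 1) K)"]) auto
  qed
  then obtain K where K: "{a, 2 * a + 1} \<subseteq> K" "K \<subseteq> {..3 * a + 1}" "card K = d - 1" by blast
  have finK: "finite K" using K(2) by (rule finite_subset) simp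
  define C where "C = insert M (yz ` K)"
  have "inj yz" by (rule injI) (auto simp: yz_def dest: ex_inject)
  then have cyz: "card (yz ` K) = d - 1" using K(3) by (simp add: card_image inj_on_subset)
  have "lookup M 0 = 1" "lookup (yz i) 0 = 0" for i using m by (simp_all add: M_def yz_def lookup_ex)
  then have "M \<notin> yz ` K" by (metis imageE zero_neq_one)
  then have C: "finite C" "card C = d" using finK cyz d by (simp_all add: C_def)
  have "keys M \<subseteq> {..<m + 2}" "keys (yz i) \<subseteq> {..<m + 2}" for i
    unfolding M_def yz_def by (rule keys_ex)+
  moreover have "mono_degree M = 3 * a + 1" "i \<in> K \<Longrightarrow> mono_degree (yz i) = 3 * a + 1" for i
    using K(2) by (auto simp: M_def yz_def degree_ex a_def)
  ultimately have sub: "C \<subseteq> {t. keys t \<subseteq> {..<m + 2} \<and> mono_degree t = 3 * a + 1}"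
    unfolding C_def by blast
  have occ: "\<exists>c\<in>C. lookup c i \<noteq> 0" if "i < m + 2" for i
    using that m by (intro bexI[of _ M]) (auto simp: C_def M_def lookup_ex a_def)
  let ?G = "below C"
  have Gk: "?G \<subseteq> {t. keys t \<subseteq> {..<m + 2}}" using sub by (intro below_keys) auto
  have "\<not> lef_inj (m + 2) ?G (lin_form (m + 2) l) (2 * a) \<and> \<not> lef_surj (m + 2) ?G (lin_form (m + 2) l) (2 * a) (Suc (2 * a))"
    for l :: "nat \<Rightarrow> 'k"
  proof
    \<comment> \<open>There are \<open>a + 2\<close> of these in degree \<open>2 * a\<close>. One
      degree higher both ends are lost, as \<open>M\<close> is divisible neither by
      \<open>y ^ (2 * a - m + 1)\<close> nor by \<open>z ^ (a + 2)\<close>, and a square of another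
      variable does not divide \<open>M\<close> either; \<open>a + 1\<close> remain.\<close>
    define s where "s k = ex m (\<lambda>_. 1) (2 * a - m - k) k" for k
    define s' where "s' k = ex m (\<lambda>_. 1) (2 * a - m + 1 - k) k" for k
    show "\<not> lef_inj (m + 2) ?G (lin_form (m + 2) l) (2 * a)"
    proof (rule not_inj_by_count[of "s ` {..a + 1}" "s' ` {1..a + 1}"])
      have "inj s" by (rule injI) (auto simp: s_def dest: ex_inject)
      then have "card (s ` {..a + 1}) = a + 2" by (simp add: card_image inj_on_subset)
      moreover have "card (s' ` {1..a + 1}) \<le> a + 1" using card_image_le[of "{1..a + 1}" s'] by simp
      ultimately show "card (s' ` {1..a + 1}) < card (s ` {..a + 1})" by simp
      show "s ` {..a + 1} \<subseteq> graded ?G (2 * a)"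
      proof clarify
        fix k assume "k \<le> a + 1"
        then have "lookup (s k) i \<le> lookup M i" for i by (auto simp: s_def M_def lookup_ex)
        then have "s k \<in> ?G" unfolding below_def C_def by blast
        moreover have "mono_degree (s k) = 2 * a" using \<open>k \<le> a + 1\<close> d by (auto simp: s_def degree_ex a_def)
        ultimately show "s k \<in> graded ?G (2 * a)" by (simp add: graded_def)
      qed
      fix x t assume x: "x \<in> s ` {..a + 1}" and t: "t \<in> ?G - s' ` {1..a + 1}"
      show "lookup (lin_form (m + 2) l * single x 1) t = 0"
      proof (rule ccontr)
        assume "lookup (lin_form (m + 2) l * single x 1) t \<noteq> 0"
        then obtain i where i: "i < m + 2" "t = x + single i 1" using lookup_lin_form_times_single by blast
        obtain k where k: "k \<le> a + 1" "x = s k" using x by auto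
        obtain c where c: "c \<in> C" "\<And>i. lookup t i \<le> lookup c i" using t unfolding below_def by blast
        have "lookup t 0 \<noteq> 0" using m by (simp add: i(2) k(2) lookup_add s_def lookup_ex)
        then have "c = M" using c(1) c(2)[of 0] \<open>\<And>i. lookup (yz i) 0 = 0\<close> by (auto simp: C_def)
        then have le: "lookup (s k) j + lookup (single i 1) j \<le> lookup M j" for j
          using c(2)[of j] by (simp add: i(2) k(2) lookup_add)
        have "i \<ge> m" using le[of i] by (simp add: s_def M_def lookup_ex split: if_splits)
        then have "i = m \<or> i = Suc m" using i(1) by auto
        then have "t \<in> s' ` {1..a + 1}"
        proof
          assume im: "i = m"
          then have "k \<ge> 1" using le[of m] k(1) d by (simp add: s_def M_def lookup_ex a_def)
          moreover have "t = s' k" unfolding s'_def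
            by (rule ex_eqI) (use k d \<open>k \<ge> 1\<close> Gk t in \<open>auto simp: i(2) im s_def lookup_add lookup_ex lookup_single when_def a_def\<close>)
          ultimately show ?thesis using k(1) by auto
        next
          assume im: "i = Suc m"
          then have "k + 1 \<le> a + 1" using le[of "Suc m"] by (simp add: s_def M_def lookup_ex)
          moreover have "t = s' (k + 1)" unfolding s'_def
            by (rule ex_eqI) (use k d Gk t in \<open>auto simp: i(2) im s_def lookup_add lookup_ex lookup_single when_def a_def\<close>)
          ultimately show ?thesis by auto
        qed
        with t show False by blast
      qed
    qed (use Gk in auto)
    \<comment> \<open>The two special socle monomials put all \<open>2 * a + 2\<close> monomials of
      degree \<open>2 * a + 1\<close> in \<open>y\<close> and \<open>z\<close> into
      \<open>G\<close>, and these can be reached only from the \<open>2 * a + 1\<close> such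
      monomials of degree \<open>2 * a\<close>.\<close>
    define w where "w n i = ex m (\<lambda>_. 0) i (n - i)" for n i
    show "\<not> lef_surj (m + 2) ?G (lin_form (m + 2) l) (2 * a) (Suc (2 * a))"
    proof (rule not_surj_by_count[of "w (2 * a + 1) ` {..2 * a + 1}" "w (2 * a) ` {..2 * a}"])
      have "inj_on (w (2 * a + 1)) {..2 * a + 1}" by (rule inj_onI) (auto simp: w_def dest: ex_inject)
      from card_image[OF this] have "card (w (2 * a + 1) ` {..2 * a + 1}) = 2 * a + 2" by simp
      moreover have "card (w (2 * a) ` {..2 * a}) \<le> 2 * a + 1" using card_image_le[of "{..2 * a}" "w (2 * a)"] by simp
      ultimately show "card (w (2 * a) ` {..2 * a}) < card (w (2 * a + 1) ` {..2 * a + 1})" by simp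
      show "w (2 * a + 1) ` {..2 * a + 1} \<subseteq> graded ?G (Suc (2 * a))"
      proof clarify
        fix i assume i: "i \<le> 2 * a + 1"
        define k where "k = (if i \<le> a then a else 2 * a + 1)"
        have "yz k \<in> C" using K(1) by (auto simp: k_def C_def)
        moreover have "lookup (w (2 * a + 1) i) x \<le> lookup (yz k) x" for x
          using i by (auto simp: w_def yz_def lookup_ex k_def)
        ultimately have "w (2 * a + 1) i \<in> ?G" unfolding below_def by blast
        then show "w (2 * a + 1) i \<in> graded ?G (Suc (2 * a))" using i by (simp add: graded_def w_def degree_ex)
      qed
      fix f :: "'k mpoly" and t
      assume f: "\<forall>x\<in>w (2 * a) ` {..2 * a}. lookup f x = 0" and t: "t \<in> w (2 * a + 1) ` {..2 * a + 1}"
      obtain i where i: "i \<le> 2 * a + 1" "t = w (2 * a + 1) i" using t by auto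
      show "lookup (lin_form (m + 2) l * f) t = 0"
      proof (rule lookup_lin_form_times_0)
        fix v assume v: "v < m + 2" "lookup t v \<noteq> 0"
        then have "v = m \<or> v = Suc m" by (auto simp: i(2) w_def lookup_ex split: if_splits)
        then have "t - single v 1 \<in> w (2 * a) ` {..2 * a}"
        proof
          assume vm: "v = m"
          then have "i \<ge> 1" using v(2) by (simp add: i(2) w_def lookup_ex)
          have "t - single v 1 = w (2 * a) (i - 1)"
            by (rule poly_mapping_eqI) (use \<open>i \<ge> 1\<close> i(1) in \<open>auto simp: vm i(2) w_def lookup_ex lookup_minus lookup_single when_def\<close>)
          then show ?thesis using i(1) by auto
        next
          assume vm: "v = Suc m"
          then have "i \<le> 2 * a" using v(2) by (simp add: i(2) w_def lookup_ex)
          have "t - single v 1 = w (2 * a) i"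
            by (rule poly_mapping_eqI) (use \<open>i \<le> 2 * a\<close> in \<open>auto simp: vm i(2) w_def lookup_ex lookup_minus lookup_single when_def\<close>)
          then show ?thesis using \<open>i \<le> 2 * a\<close> by auto
        qed
        then show "lookup f (t - single v 1) = 0" using f by blast
      qed
    qed (use Gk in auto)
  qed
  then have "\<not> weak_lefschetz (m + 2) (avoiding (m + 2) ?G :: 'k mpoly set)"
    by (rule not_weak_lefschetz_avoiding[OF down_closed_below])
  then show ?thesis using level_below[OF C sub occ] by blast
qed

section \<open>Two socle monomials in at least four variables\<close>

lemma keys_lin_form_power:
  "t \<in> keys (lin_form r l ^ s) \<Longrightarrow> mono_degree t = s \<and> keys t \<subseteq> {i. i < r \<and> l i \<noteq> 0}"
proof (induction s arbitrary: t)
  case 0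
  then show ?case by (simp split: if_splits)
next
  case (Suc s)
  obtain x b where xb: "t = x + b" "x \<in> keys (lin_form r l)" "b \<in> keys (lin_form r l ^ s)"
    using Suc.prems keys_mult[of "lin_form r l" "lin_form r l ^ s"] by auto
  obtain i where "i < r" "x \<in> keys (single (single i 1) (l i))"
    using xb(2) keys_sum[of "\<lambda>i. single (single i 1) (l i)" "{..<r}"] unfolding lin_form_def by blast
  then have "x = single i 1" "l i \<noteq> 0" "i < r" by (auto split: if_splits)
  then show ?case using Suc.IH[OF xb(3)] by (auto simp: xb(1) keys_add_nat mono_degree_add)
qed

lemma geometric_sum_alternating:
  fixes x w :: "'a::comm_ring_1"
  shows "(x + w) * (\<Sum>s\<le>n. (- 1) ^ s * x ^ (n - s) * w ^ s) = x ^ Suc n + (- 1) ^ n * w ^ Suc n"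
proof (induction n)
  case (Suc n)
  have "(\<Sum>s\<le>Suc n. (- 1) ^ s * x ^ (Suc n - s) * w ^ s) =
      x * (\<Sum>s\<le>n. (- 1) ^ s * x ^ (n - s) * w ^ s) + (- 1) ^ Suc n * w ^ Suc n"
    by (auto simp: sum_distrib_left Suc_diff_le algebra_simps intro!: sum.cong)
  then have "(x + w) * (\<Sum>s\<le>Suc n. (- 1) ^ s * x ^ (Suc n - s) * w ^ s) =
      x * ((x + w) * (\<Sum>s\<le>n. (- 1) ^ s * x ^ (n - s) * w ^ s)) + (x + w) * ((- 1) ^ Suc n * w ^ Suc n)"
    by (simp add: algebra_simps)
  then show ?case unfolding Suc by (simp add: algebra_simps)
qed simp

lemma lookup_two_variable_power:
  fixes l :: "nat \<Rightarrow> 'k::field"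
  assumes "x < r" "y < r" "x \<noteq> y"
  shows "lookup (lin_form r l ^ k) (single x k) = l x ^ k"
    and "lookup (lin_form r l ^ Suc k) (single x k + single y 1) = of_nat (Suc k) * l x ^ k * l y"
proof -
  have step: "lookup (lin_form r l ^ Suc s) t = (\<Sum>i<r. l i * (if lookup t i = 0 then 0 else lookup (lin_form r l ^ s) (t - single i 1)))"
    for s t by (simp add: lookup_lin_form_times)
  have 1: "lookup (lin_form r l ^ k) (single x k) = l x ^ k" for k
  proof (induction k)
    case 0
    show ?case by (simp add: lookup_one)
  next
    case (Suc k)
    have "single x (Suc k) - single x 1 = single x k" by (rule poly_mapping_eqI) (auto simp: lookup_minus lookup_single when_def)
    then have "l i * (if lookup (single x (Suc k)) i = 0 then 0 else lookup (lin_form r l ^ k) (single x (Suc k) - single i 1)) =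
        (if i = x then l x * l x ^ k else 0)" for i
      using Suc by (auto simp: lookup_single when_def)
    then show ?case unfolding step using assms(1) by simp
  qed
  then show "lookup (lin_form r l ^ k) (single x k) = l x ^ k" .
  show "lookup (lin_form r l ^ Suc k) (single x k + single y 1) = of_nat (Suc k) * l x ^ k * l y"
  proof (induction k)
    case 0
    have "l i * (if lookup (single x 0 + single y (1::nat)) i = 0 then 0 else lookup (lin_form r l ^ 0) (single x 0 + single y 1 - single i 1)) =
        (if i = y then l y else 0)" for i
      by (auto simp: lookup_single when_def lookup_one)
    then show ?case unfolding step using assms(2) by simp
  next
    case (Suc k)
    let ?t = "single x (Suc k) + single y 1 :: nat \<Rightarrow>\<^sub>0 nat"
    have tx: "?t - single x 1 = single x k + single y 1" and ty: "?t - single y 1 = single x (Suc k)"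
      using assms(3) by (auto intro!: poly_mapping_eqI simp: lookup_add lookup_minus lookup_single when_def)
    have "l i * (if lookup ?t i = 0 then 0 else lookup (lin_form r l ^ Suc k) (?t - single i 1)) =
        (if i = x then l x * (of_nat (Suc k) * l x ^ k * l y) else 0) + (if i = y then l y * l x ^ Suc k else 0)" for i
    proof (cases "i = x \<or> i = y")
      case True
      then show ?thesis
      proof
        assume i: "i = x"
        have "lookup ?t x \<noteq> 0" by (simp add: lookup_add)
        then show ?thesis using assms(3) Suc unfolding i tx by simp
      next
        assume i: "i = y"
        have "lookup ?t y \<noteq> 0" by (simp add: lookup_add)
        then show ?thesis using assms(3) 1[of "Suc k"] unfolding i ty by simp
      qed
    next
      case False
      then show ?thesis by (simp add: lookup_add lookup_single)
    qed
    then have "lookup (lin_form r l ^ Suc (Suc k)) ?t = l x * (of_nat (Suc k) * l x ^ k * l y) + l y * l x ^ Suc k"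
      unfolding step using assms(1,2) by (simp add: sum.distrib)
    then show ?case by (simp add: algebra_simps)
  qed
qed

locale two_generators =
  fixes m :: nat
  assumes m: "m \<ge> 2"
begin

definition "q = 2 * m - 1"
text \<open>\<open>n\<close> is the degree of \<open>N\<close> and, as \<open>n = q + 1\<close>,
  also that of \<open>y * z ^ q\<close>. So \<open>n + 1\<close> is the first degree in which all
  monomials in the first \<open>m\<close> variables and all monomials in the last two lie outside
  \<open>G\<close>.\<close>

definition "n = 2 * m"
definition "C = {ex m (\<lambda>_. 2) 1 q, ex m (\<lambda>_. 2) q 1}"
abbreviation "G \<equiv> below C"

lemma in_G: "t \<in> G \<longleftrightarrow> keys t \<subseteq> {..<m + 2} \<and> (\<forall>i<m. lookup t i \<le> 2) \<and>
  (lookup t m \<le> 1 \<and> lookup t (Suc m) \<le> q \<or> lookup t m \<le> q \<and> lookup t (Suc m) \<le> 1)"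
proof -
  have *: "(\<forall>i. lookup t i \<le> lookup (ex m (\<lambda>_. 2) u v) i) \<longleftrightarrow>
      keys t \<subseteq> {..<m + 2} \<and> (\<forall>i<m. lookup t i \<le> 2) \<and> lookup t m \<le> u \<and> lookup t (Suc m) \<le> v" for u v
  proof
    assume le: "\<forall>i. lookup t i \<le> lookup (ex m (\<lambda>_. 2) u v) i"
    have "lookup t i = 0" if "\<not> i < m + 2" for i using le[rule_format, of i] that by (simp add: lookup_ex)
    then have "keys t \<subseteq> {..<m + 2}" by (force simp: in_keys_iff)
    moreover have "lookup t i \<le> 2" if "i < m" for i using le[rule_format, of i] that by (simp add: lookup_ex)
    moreover have "lookup t m \<le> u" "lookup t (Suc m) \<le> v"
      using le[rule_format, of m] le[rule_format, of "Suc m"] by (simp_all add: lookup_ex)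
    ultimately show "keys t \<subseteq> {..<m + 2} \<and> (\<forall>i<m. lookup t i \<le> 2) \<and> lookup t m \<le> u \<and> lookup t (Suc m) \<le> v" by blast
  next
    assume le: "keys t \<subseteq> {..<m + 2} \<and> (\<forall>i<m. lookup t i \<le> 2) \<and> lookup t m \<le> u \<and> lookup t (Suc m) \<le> v"
    show "\<forall>i. lookup t i \<le> lookup (ex m (\<lambda>_. 2) u v) i"
    proof
      fix i
      have "lookup t i = 0" if "\<not> i < m + 2" using le that by (metis in_keys_iff lessThan_iff subsetD)
      then show "lookup t i \<le> lookup (ex m (\<lambda>_. 2) u v) i" using le by (auto simp: lookup_ex)
    qed
  qed
  have "t \<in> G \<longleftrightarrow> (\<forall>i. lookup t i \<le> lookup (ex m (\<lambda>_. 2) 1 q) i) \<or> (\<forall>i. lookup t i \<le> lookup (ex m (\<lambda>_. 2) q 1) i)"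
    by (simp add: below_def C_def)
  then show ?thesis unfolding * by blast
qed

lemma sum_z_le: "t \<in> G \<Longrightarrow> (\<Sum>i<m. lookup t i) \<le> n"
  using sum_mono[of "{..<m}" "lookup t" "\<lambda>_. 2"] by (simp add: in_G n_def)

lemma degree_G: "t \<in> G \<Longrightarrow> mono_degree t = (\<Sum>i<m. lookup t i) + lookup t m + lookup t (Suc m)"
  by (intro degree_m2) (simp add: in_G)

lemma G_keys: "G \<subseteq> {t. keys t \<subseteq> {..<m + 2}}"
  using in_G by blast

lemma finite_G: "finite G"
proof (rule finite_below[of _ "m + 2"])
  show "C \<subseteq> {t. keys t \<subseteq> {..<m + 2}}" using keys_ex by (simp add: C_def)
qed (simp add: C_def)

text \<open>With \<open>L = x + w\<close>, where \<open>x\<close> and \<open>w\<close> are linear forms in the first \<open>m\<close> and in the last two variables,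
  both \<open>x ^ Suc n\<close> and \<open>w ^ Suc n\<close> vanish in the algebra.\<close>

lemma not_injective_generic:
  fixes l :: "nat \<Rightarrow> 'k::field_char_0"
  assumes l: "l m \<noteq> 0" "l (Suc m) \<noteq> 0"
  shows "\<not> lef_inj (m + 2) G (lin_form (m + 2) l) n"
proof
  assume inj: "lef_inj (m + 2) G (lin_form (m + 2) l) n"
  define x where "x = lin_form (m + 2) (\<lambda>i. if i < m then l i else 0)"
  define w where "w = lin_form (m + 2) (\<lambda>i. if i < m then 0 else l i)"
  have L: "lin_form (m + 2) l = x + w"
    unfolding x_def w_def lin_form_def sum.distrib[symmetric] by (rule sum.cong) auto
  define F where "F = (\<Sum>s\<le>n. (- 1) ^ s * x ^ (n - s) * w ^ s)"
  have m1: "(- 1 :: 'k mpoly) ^ s \<in> forms (m + 2) 0" for s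
    using forms_power[of "- 1 :: 'k mpoly" "m + 2" 0 s] by (simp add: forms_iff)
  have "x \<in> forms (m + 2) 1" "w \<in> forms (m + 2) 1" unfolding x_def w_def by (rule lin_form_in_forms)+
  then have summand: "(- 1) ^ s * x ^ (n - s) * w ^ s \<in> forms (m + 2) n" if "s \<le> n" for s
    using forms_mult[OF forms_mult[OF m1 forms_1_power[of x _ "n - s"]] forms_1_power[of w _ s]] that by simp
  then have F: "F \<in> forms (m + 2) n" unfolding F_def by (intro forms_sum) auto
  have x0: "lookup (x ^ Suc n) t = 0" if t: "t \<in> G" for t
  proof (rule ccontr)
    assume "lookup (x ^ Suc n) t \<noteq> 0"
    then have "t \<in> keys (x ^ Suc n)" by (simp add: in_keys_iff)
    from keys_lin_form_power[OF this[unfolded x_def]]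
    have "mono_degree t = Suc n" "keys t \<subseteq> {..<m}" by (auto split: if_splits)
    moreover have "lookup t m = 0" "lookup t (Suc m) = 0" using calculation(2) by (auto simp: in_keys_iff)
    ultimately show False using degree_G[OF t] sum_z_le[OF t] by simp
  qed
  have w0: "lookup (w ^ Suc n) t = 0" if t: "t \<in> G" for t
  proof (rule ccontr)
    assume "lookup (w ^ Suc n) t \<noteq> 0"
    then have "t \<in> keys (w ^ Suc n)" by (simp add: in_keys_iff)
    from keys_lin_form_power[OF this[unfolded w_def]]
    have "mono_degree t = Suc n" and k: "keys t \<inter> {..<m} = {}" by (auto split: if_splits)
    moreover have "(\<Sum>i<m. lookup t i) = 0" using k by (auto simp: in_keys_iff)
    ultimately have "lookup t m + lookup t (Suc m) = Suc n" using degree_G[OF t] by simp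
    then show False using t m by (auto simp: in_G n_def q_def)
  qed
  have "lookup (lin_form (m + 2) l * F) t = 0" if t: "t \<in> G" for t
  proof -
    have "lin_form (m + 2) l * F = x ^ Suc n + (- 1) ^ n * w ^ Suc n"
      unfolding L F_def by (rule geometric_sum_alternating)
    moreover have "even n" by (simp add: n_def)
    ultimately show ?thesis using x0[OF t] w0[OF t] by (simp add: lookup_add)
  qed
  then have 0: "\<forall>t\<in>G. lookup F t = 0" using inj F unfolding lef_inj_def by blast
  \<comment> \<open>The kernel element is nonzero at \<open>y ^ q * z\<close>: only the summand
    \<open>w ^ n\<close> contains this monomial, with \<open>n\<close> times a product of the two
    nonzero coefficients.\<close>
  define t where "t = single m q + single (Suc m) (1::nat)"
  have tG: "t \<in> G" using m by (auto simp: t_def in_G lookup_add lookup_single when_def q_def keys_add_nat)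
  have nq: "n = Suc q" using m by (simp add: n_def q_def)
  have "lookup ((- 1) ^ s * x ^ (n - s) * w ^ s) t = 0" if s: "s < n" for s
  proof (rule ccontr)
    assume "lookup ((- 1) ^ s * x ^ (n - s) * w ^ s) t \<noteq> 0"
    then have "t \<in> keys (x ^ (n - s) * ((- 1) ^ s * w ^ s))" by (simp add: in_keys_iff ac_simps)
    then obtain a b where ab: "t = a + b" "a \<in> keys (x ^ (n - s))" using keys_mult by blast
    from keys_lin_form_power[OF ab(2)[unfolded x_def]]
    have a: "mono_degree a = n - s" "keys a \<subseteq> {..<m}" by (auto split: if_splits)
    have "keys a \<subseteq> keys t" using ab(1) by (auto simp: keys_add_nat)
    also have "\<dots> \<subseteq> {m, Suc m}" by (auto simp: t_def keys_add_nat)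
    finally have "keys a \<subseteq> {m, Suc m} \<inter> {..<m}" using a(2) by blast
    then have "a = 0" by simp
    then show False using a(1) s by (simp add: mono_degree_def)
  qed
  then have "lookup F t = lookup ((- 1) ^ n * w ^ n) t"
    unfolding F_def lookup_sum lessThan_Suc_atMost[symmetric] by (simp add: sum.lessThan_Suc)
  also have "(- 1 :: 'k mpoly) ^ n = 1" by (simp add: n_def)
  also have "lookup (1 * w ^ n) t = lookup (w ^ Suc q) t" by (simp only: nq mult_1)
  also have "\<dots> = of_nat (Suc q) * l m ^ q * l (Suc m)"
    unfolding w_def t_def using lookup_two_variable_power(2)[of m "m + 2" "Suc m" "\<lambda>i. if i < m then 0 else l i" q] by simp
  also have "\<dots> \<noteq> 0" using l by (simp del: of_nat_Suc)
  finally show False using 0 tG by blast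
qed

text \<open>A form without the variable \<open>x\<close> preserves the span of the monomials free of
  \<open>x\<close>. Among these, division by \<open>y\<close> embeds degree \<open>n + 1\<close>
  into degree \<open>n\<close>, since the other variables contribute at most \<open>n\<close>, and
  it misses \<open>t0\<close>, whose exponent of \<open>y\<close> is already maximal.\<close>

lemma not_injective_degenerate:
  fixes l :: "nat \<Rightarrow> 'k::field"
  assumes vars: "(x, y) = (m, Suc m) \<or> (x, y) = (Suc m, m)" and l: "l x = 0"
  shows "\<not> lef_inj (m + 2) G (lin_form (m + 2) l) n"
proof -
  define S where "S = {t \<in> graded G n. lookup t x = 0}"
  define N where "N = {t \<in> graded G (Suc n). lookup t x = 0}"
  have fin: "finite S" "finite N" using finite_G by (simp_all add: S_def N_def graded_def)
  have xy: "x \<noteq> y" using vars by auto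
  have deg: "mono_degree t = (\<Sum>i<m. lookup t i) + lookup t x + lookup t y" if "t \<in> G" for t
    using degree_G[OF that] vars by auto
  define t0 where "t0 = single 0 1 + single y q"
  have t0: "t0 \<in> S" using m vars
    by (auto simp: t0_def S_def graded_def in_G lookup_add lookup_single when_def keys_add_nat mono_degree_add q_def n_def)
  have yq: "lookup t y \<le> q" if "t \<in> G" for t using that vars m by (auto simp: in_G q_def)
  have sh: "t - single y 1 \<in> S - {t0}" "t = (t - single y 1) + single y 1" if "t \<in> N" for t
  proof -
    have t: "t \<in> G" "mono_degree t = Suc n" "lookup t x = 0" using that by (auto simp: N_def graded_def)
    then have y: "lookup t y \<noteq> 0" using deg[OF t(1)] sum_z_le[OF t(1)] by auto
    show eq: "t = (t - single y 1) + single y 1"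
      by (rule poly_mapping_eqI) (use y in \<open>auto simp: lookup_add lookup_minus lookup_single when_def\<close>)
    have "t - single y 1 \<in> G" using t(1) eq down_closed_below unfolding down_closed_def by metis
    moreover have "mono_degree (t - single y 1) = n" using mono_degree_minus_single[OF y] t(2) by simp
    moreover have "lookup (t - single y 1) x = 0" using t(3) by (simp add: lookup_minus)
    moreover have "lookup (t - single y 1) y \<noteq> lookup t0 y"
      using yq[OF t(1)] y xy vars m by (auto simp: t0_def lookup_minus lookup_add lookup_single when_def q_def)
    then have "t - single y 1 \<noteq> t0" by metis
    ultimately show "t - single y 1 \<in> S - {t0}" by (simp add: S_def graded_def)
  qed
  have "card N \<le> card (S - {t0})"
    by (rule card_inj_on_le[of "\<lambda>t. t - single y 1"]) (use sh fin in \<open>auto intro!: inj_onI, metis\<close>)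
  also have "\<dots> < card S" using t0 fin(1) by (rule card_Diff1_less[rotated])
  finally have card: "card N < card S" .
  show ?thesis
  proof (rule not_inj_by_count[OF fin card])
    show "S \<subseteq> graded G n" by (auto simp: S_def)
    fix s t assume s: "s \<in> S" and t: "t \<in> G - N"
    show "lookup (lin_form (m + 2) l * single s 1) t = 0"
    proof (rule ccontr)
      assume "lookup (lin_form (m + 2) l * single s 1) t \<noteq> 0"
      then obtain i where i: "l i \<noteq> 0" "t = s + single i 1" using lookup_lin_form_times_single by blast
      then have "i \<noteq> x" using l by auto
      then have "t \<in> N" using s t i(2) by (auto simp: S_def N_def graded_def mono_degree_add lookup_add lookup_single)
      with t show False by blast
    qed
  qed (rule G_keys)
qed

text \<open>With this inequality failure of injectivity also excludes surjectivity. Multiplication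
  by \<open>z\<close> or \<open>y\<close> matches most monomials with some of degree
  \<open>n + 1\<close>. The exceptions are divisible by \<open>y ^ q\<close> or \<open>z ^ q\<close>
  and have, as \<open>n = q + 1\<close>, a single further variable, hence at most
  \<open>m + 1\<close> choices each; \<open>T3\<close> and \<open>T4\<close>, which the matching
  does not meet, make up for them.\<close>

lemma card_graded_le: "card (graded G n) \<le> card (graded G (Suc n))"
proof -
  have fin: "finite (graded G i)" for i using finite_G by (simp add: graded_def)
  have G: "t \<in> G \<and> mono_degree t = i" if "t \<in> graded G i" for t i using that by (simp add: graded_def)
  define E1 where "E1 = {t \<in> graded G n. lookup t m \<le> 1 \<and> lookup t (Suc m) < q}"
  define E2 where "E2 = {t \<in> graded G n. 2 \<le> lookup t m \<and> lookup t m < q}"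
  define E3 where "E3 = {t \<in> graded G n. lookup t (Suc m) = q}"
  define E4 where "E4 = {t \<in> graded G n. lookup t m = q}"
  define T1 where "T1 = {t \<in> graded G (Suc n). lookup t m \<le> 1 \<and> 1 \<le> lookup t (Suc m)}"
  define T2 where "T2 = {t \<in> graded G (Suc n). 3 \<le> lookup t m}"
  define T3 where "T3 = {t \<in> graded G (Suc n). 1 \<le> lookup t m \<and> lookup t m \<le> 2 \<and> lookup t (Suc m) = 0}"
  define T4 where "T4 = {t \<in> graded G (Suc n). lookup t m = 2 \<and> lookup t (Suc m) = 1}"
  have "graded G n \<subseteq> E1 \<union> E2 \<union> E3 \<union> E4"
    unfolding E1_def E2_def E3_def E4_def using m by (auto simp: graded_def in_G q_def)
  then have "card (graded G n) \<le> card (E1 \<union> E2 \<union> E3 \<union> E4)"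
    by (rule card_mono[rotated]) (simp add: E1_def E2_def E3_def E4_def fin)
  also have "\<dots> \<le> card E1 + card E2 + card E3 + card E4"
    using card_Un_le[of "E1 \<union> E2 \<union> E3" E4] card_Un_le[of "E1 \<union> E2" E3] card_Un_le[of E1 E2] by linarith
  finally have le: "card (graded G n) \<le> card E1 + card E2 + card E3 + card E4" .
  have add: "t + single v 1 \<in> graded G (Suc n)"
    if "t \<in> graded G n" "v = m \<and> 2 \<le> lookup t m \<and> lookup t m < q \<or> v = Suc m \<and> lookup t m \<le> 1 \<and> lookup t (Suc m) < q" for t v
    using that m by (auto simp: graded_def in_G lookup_add lookup_single when_def keys_add_nat mono_degree_add q_def)
  have 1: "card E1 \<le> card T1"
    by (rule card_inj_on_le[of "\<lambda>t. t + single (Suc m) 1"])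
      (use add fin in \<open>auto simp: E1_def T1_def lookup_add lookup_single intro!: inj_onI\<close>)
  have 2: "card E2 \<le> card T2"
    by (rule card_inj_on_le[of "\<lambda>t. t + single m 1"])
      (use add fin in \<open>auto simp: E2_def T2_def lookup_add intro!: inj_onI\<close>)
  have small: "card {t \<in> graded G n. lookup t v = q} \<le> m + 1" if v: "v = m \<and> v' = Suc m \<or> v = Suc m \<and> v' = m" for v v'
  proof -
    have "{t \<in> graded G n. lookup t v = q} \<subseteq> insert (single v q + single v' 1) ((\<lambda>i. single v q + single i 1) ` {..<m})"
    proof clarify
      fix t assume t: "t \<in> graded G n" "lookup t v = q" and no: "t \<notin> (\<lambda>i. single v q + single i 1) ` {..<m}"
      have eq: "t = single v q + (t - single v q)"
        by (rule add_diff_if_le) (auto simp: lookup_single when_def t(2))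
      then have "mono_degree t = q + mono_degree (t - single v q)" by (metis mono_degree_add mono_degree_single)
      moreover have "mono_degree t = Suc q" using t(1) m by (simp add: graded_def n_def q_def)
      ultimately have "mono_degree (t - single v q) = 1" by simp
      then obtain i where i: "t - single v q = single i 1" unfolding mono_degree_1_iff by blast
      then have ti: "t = single v q + single i 1" using eq by simp
      then have "i \<in> keys t" by (simp add: keys_add_nat)
      then have "i < m + 2" using t(1) G_keys by (auto simp: graded_def)
      moreover have "\<not> i < m" using no ti by auto
      moreover have "i \<noteq> v" using t(2) ti by (auto simp: lookup_add)
      ultimately have "i = v'" using v by auto
      then show "t = single v q + single v' 1" using ti by simp
    qed
    then have "card {t \<in> graded G n. lookup t v = q} \<le> card (insert (single v q + single v' 1) ((\<lambda>i. single v q + single i 1) ` {..<m}))"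
      by (rule card_mono[rotated]) simp
    also have "\<dots> \<le> Suc (card ((\<lambda>i. single v q + single i 1) ` {..<m}))" by (rule card_insert_le_m1) simp_all
    also have "\<dots> \<le> m + 1" using card_image_le[of "{..<m}" "\<lambda>i. single v q + single i (1::nat)"] by simp
    finally show ?thesis .
  qed
  define h3 where "h3 a = ex m (\<lambda>i. if i = a then 1 else 2) 2 0" for a
  define h4 where "h4 a = ex m (\<lambda>i. if i = a then 0 else 2) 2 1" for a
  \<comment> \<open>One member of \<open>T4\<close> beyond the \<open>h4 a\<close>: the two factors
    removed from \<open>N\<close> are taken from two different variables, which uses
    \<open>m \<ge> 2\<close>.\<close>
  define h5 where "h5 = ex m (\<lambda>i. if i < 2 then 1 else 2) 2 1"
  define h6 where "h6 = ex m (\<lambda>_. 2) 1 0"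
  have sum_but: "(\<Sum>i<m. if i = a then c else 2) = n - 2 + c" if "a < m" for a c :: nat
    using that m by (subst sum.remove[of _ a]) (auto simp: n_def)
  have sum_two: "(\<Sum>i<m. if i < 2 then 1 else 2) = n - (2::nat)"
  proof -
    obtain k where "m = Suc (Suc k)" using m by (metis Suc_le_D numeral_2_eq_2 Suc_le_mono)
    then show ?thesis unfolding n_def by (simp add: sum.lessThan_Suc_shift del: sum.lessThan_Suc)
  qed
  have mem: "h3 ` {..<m} \<subseteq> T3" "h6 \<in> T3" "h4 ` {..<m} \<subseteq> T4" "h5 \<in> T4"
  proof -
    have k: "keys (h3 a) \<subseteq> {..<m + 2}" "keys (h4 a) \<subseteq> {..<m + 2}" "keys h5 \<subseteq> {..<m + 2}" "keys h6 \<subseteq> {..<m + 2}" for a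
      unfolding h3_def h4_def h5_def h6_def by (rule keys_ex)+
    have g: "h3 a \<in> G" "h4 a \<in> G" "h5 \<in> G" "h6 \<in> G" for a
      unfolding in_G using k m by (simp_all add: h3_def h4_def h5_def h6_def lookup_ex q_def)
    have n2: "2 \<le> n" using m by (simp add: n_def)
    have "mono_degree h5 = Suc n" unfolding h5_def degree_ex using sum_two n2 by simp
    moreover have "mono_degree h6 = Suc n" unfolding h6_def degree_ex by (simp add: n_def)
    moreover have "mono_degree (h3 a) = Suc n" "mono_degree (h4 a) = Suc n" if "a < m" for a
      unfolding h3_def h4_def degree_ex using sum_but[OF that] n2 by simp_all
    ultimately have gr: "h5 \<in> graded G (Suc n)" "h6 \<in> graded G (Suc n)"
      "a < m \<Longrightarrow> h3 a \<in> graded G (Suc n)" "a < m \<Longrightarrow> h4 a \<in> graded G (Suc n)" for a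
      using g by (simp_all add: graded_def)
    have "h3 a \<in> T3" "h4 a \<in> T4" if "a < m" for a
      using gr(3,4)[OF that] by (simp_all add: T3_def T4_def h3_def h4_def lookup_ex)
    moreover show "h6 \<in> T3" "h5 \<in> T4"
      using gr(1,2) by (simp_all add: T3_def T4_def h5_def h6_def lookup_ex)
    ultimately show "h3 ` {..<m} \<subseteq> T3" "h4 ` {..<m} \<subseteq> T4" by auto
  qed
  have i3: "inj_on h3 {..<m}"
  proof (rule inj_onI)
    fix a b assume "a \<in> {..<m}" "b \<in> {..<m}" "h3 a = h3 b"
    then have "a < m" "lookup (h3 a) a = lookup (h3 b) a" by simp_all
    then show "a = b" by (simp add: h3_def lookup_ex split: if_splits)
  qed
  have i4: "inj_on h4 {..<m}"
  proof (rule inj_onI)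
    fix a b assume "a \<in> {..<m}" "b \<in> {..<m}" "h4 a = h4 b"
    then have "a < m" "lookup (h4 a) a = lookup (h4 b) a" by simp_all
    then show "a = b" by (simp add: h4_def lookup_ex split: if_splits)
  qed
  have "h6 \<notin> h3 ` {..<m}" by (auto simp: h3_def h6_def dest: ex_inject)
  then have "card (insert h6 (h3 ` {..<m})) = m + 1" using card_image[OF i3] by simp
  moreover have "card (insert h6 (h3 ` {..<m})) \<le> card T3" by (rule card_mono) (use mem fin in \<open>auto simp: T3_def\<close>)
  ultimately have 3: "card E3 \<le> card T3" using small[of "Suc m" m] by (simp add: E3_def)
  have "lookup h5 a \<noteq> lookup (h4 a) a" if "a < m" for a
    using that by (simp add: h4_def h5_def lookup_ex)
  then have "h5 \<notin> h4 ` {..<m}" by fastforce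
  then have "card (insert h5 (h4 ` {..<m})) = m + 1" using card_image[OF i4] by simp
  moreover have "card (insert h5 (h4 ` {..<m})) \<le> card T4" by (rule card_mono) (use mem fin in \<open>auto simp: T4_def\<close>)
  ultimately have 4: "card E4 \<le> card T4" using small[of m "Suc m"] by (simp add: E4_def)
  have finT: "finite T1" "finite T2" "finite T3" "finite T4" using fin by (auto simp: T1_def T2_def T3_def T4_def)
  have "card T1 + card T2 + card T3 + card T4 = card (T1 \<union> T2 \<union> T3 \<union> T4)"
  proof -
    have "T1 \<inter> T2 = {}" "(T1 \<union> T2) \<inter> T3 = {}" "(T1 \<union> T2 \<union> T3) \<inter> T4 = {}"
      by (auto simp: T1_def T2_def T3_def T4_def)
    then show ?thesis using finT by (simp add: card_Un_disjoint)
  qed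
  also have "\<dots> \<le> card (graded G (Suc n))"
    by (rule card_mono) (use fin in \<open>auto simp: T1_def T2_def T3_def T4_def\<close>)
  finally show ?thesis using le 1 2 3 4 by linarith
qed

lemma not_weak:
  "\<exists>I :: ('k::field_char_0) mpoly set. monomial_artinian_level (m + 2) 2 I \<and> \<not> weak_lefschetz (m + 2) I"
proof -
  have "\<not> lef_inj (m + 2) G (lin_form (m + 2) l) n" for l :: "nat \<Rightarrow> 'k"
    using not_injective_generic[of l] not_injective_degenerate[of m "Suc m" l] not_injective_degenerate[of "Suc m" m l]
    by blast
  then have "\<not> weak_lefschetz (m + 2) (avoiding (m + 2) G :: 'k mpoly set)"
    using not_inj_imp_not_surj[OF down_closed_below finite_G G_keys card_graded_le]
    by (intro not_weak_lefschetz_avoiding[OF down_closed_below, where j=n]) blast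
  moreover have "monomial_artinian_level (m + 2) 2 (avoiding (m + 2) G :: 'k mpoly set)"
  proof (rule level_below)
    have "ex m (\<lambda>_. 2) 1 q \<noteq> ex m (\<lambda>_. 2) q 1" using m by (auto simp: q_def dest: ex_inject)
    then show "card C = 2" by (simp add: C_def)
    show "C \<subseteq> {t. keys t \<subseteq> {..<m + 2} \<and> mono_degree t = 4 * m}"
      using keys_ex m by (simp add: C_def degree_ex q_def)
    show "\<exists>c\<in>C. lookup c i \<noteq> 0" if "i < m + 2" for i
      using that m by (intro bexI[of _ "ex m (\<lambda>_. 2) 1 q"]) (auto simp: C_def lookup_ex q_def)
  qed (simp add: C_def)
  ultimately show ?thesis by blast
qed

end

subsection \<open>Failure of the Strong Lefschetz Property\<close>

lemma lookup_lin_form_power_mult_0: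
  assumes "\<And>u. keys u \<subseteq> {i. i < r \<and> l i \<noteq> 0} \<Longrightarrow> mono_degree u = s \<Longrightarrow> \<exists>i. lookup t i < lookup u i"
  shows "lookup (lin_form r l ^ s * p) t = 0"
proof (rule ccontr)
  assume "lookup (lin_form r l ^ s * p) t \<noteq> 0"
  then have "t \<in> keys (lin_form r l ^ s * p)" by (simp add: in_keys_iff)
  then obtain u v where uv: "t = u + v" "u \<in> keys (lin_form r l ^ s)" using keys_mult by blast
  then obtain i where "lookup t i < lookup u i" using assms keys_lin_form_power by blast
  then show False by (simp add: uv(1) lookup_add)
qed

context three_variables
begin

text \<open>Degree 5 has at least as many monomials as degree 2, so a kernel element suffices. Let
  \<open>L = w + z\<close> with \<open>z\<close> the part in \<open>vz\<close>: in the algebra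
  \<open>z ^ 3 = 0\<close>, and \<open>w ^ 5 = 0\<close> because the exponents of \<open>vx\<close>
  and \<open>vy\<close> add up to at most 4.\<close>

lemma type_two_not_strong:
  "\<exists>I :: ('k::field_char_0) mpoly set. monomial_artinian_level 3 2 I \<and> \<not> strong_lefschetz 3 I"
proof -
  define C where "C = {mon 1 3 2, mon 3 1 2}"
  define G where "G = below C"
  have C: "finite C" "C \<subseteq> {m. keys m \<subseteq> {..<3}}" using keys_mon by (simp_all add: C_def)
  have G: "down_closed G" "finite G" "G \<subseteq> {m. keys m \<subseteq> {..<3}}"
    unfolding G_def using down_closed_below finite_below[OF C] below_keys[OF C(2)] by auto
  have "G = below {mon 1 3 2} \<union> below {mon 3 1 2}" by (auto simp: G_def C_def below_def)
  then have mon_G: "mon t u k \<in> G \<longleftrightarrow> (t \<le> 1 \<and> u \<le> 3 \<or> t \<le> 3 \<and> u \<le> 1) \<and> k \<le> 2" for t u k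
    by (simp add: mon_in_below keys_mon lookup_mon) blast
  have in_G: "(lookup t vx \<le> 1 \<and> lookup t vy \<le> 3 \<or> lookup t vx \<le> 3 \<and> lookup t vy \<le> 1) \<and> lookup t vz \<le> 2" if "t \<in> G" for t
    using mon_G mon_eq[of t] that G(3) by (metis (mono_tags, lifting) mem_Collect_eq subsetD)
  have card: "card (graded G 2) \<le> card (graded G 5)"
  proof -
    define S2 where "S2 = {mon 2 0 0, mon 0 2 0, mon 0 0 2, mon 1 1 0, mon 1 0 1, mon 0 1 1}"
    define S5 where "S5 = {mon 0 3 2, mon 1 3 1, mon 1 2 2, mon 3 0 2, mon 3 1 1, mon 2 1 2}"
    have "graded G 2 \<subseteq> S2"
    proof
      fix t assume "t \<in> graded G 2"
      then have t: "keys t \<subseteq> {..<3}" "mono_degree t = 2" using G(3) by (auto simp: graded_def)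
      define a b c where "a = lookup t vx" and "b = lookup t vy" and "c = lookup t vz"
      have abc: "t = mon a b c" "a + b + c = 2"
        using mon_eq[OF t(1)] degree3[OF t(1)] t(2) by (simp_all add: a_def b_def c_def)
      then have "a = 0 \<or> a = 1 \<or> a = 2" "b = 0 \<or> b = 1 \<or> b = 2" by auto
      then show "t \<in> S2" using abc(2) unfolding S2_def abc(1) by auto
    qed
    then have "card (graded G 2) \<le> card S2" by (rule card_mono[rotated]) (simp add: S2_def)
    also have "\<dots> = 6" by (simp add: S2_def mon_inject)
    also have "6 = card S5" by (simp add: S5_def mon_inject)
    also have "S5 \<subseteq> graded G 5" by (simp add: S5_def graded_def mon_G degree_mon)
    then have "card S5 \<le> card (graded G 5)" by (rule card_mono[rotated]) (simp add: graded_def G(2))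
    finally show ?thesis .
  qed
  have ninj: "\<not> lef_inj 3 G (lin_form 3 l ^ 3) 2" for l :: "nat \<Rightarrow> 'k"
  proof
    assume inj: "lef_inj 3 G (lin_form 3 l ^ 3) 2"
    have *: "\<exists>t\<in>G. lookup f t \<noteq> 0" if "f \<in> forms 3 2" "lookup f (single i 2) \<noteq> 0" "i < 3" for f :: "'k mpoly" and i
    proof -
      have "single i 2 = mon (if i = vx then 2 else 0) (if i = vy then 2 else 0) (if i = vz then 2 else 0)"
        using that(3) vars distinct by (auto simp: mon_def)
      then have "single i 2 \<in> G" using distinct by (simp add: mon_G)
      then show ?thesis using that(2) by blast
    qed
    define lw where "lw = (\<lambda>i. if i = vz then 0 else l i)"
    define lz where "lz = (\<lambda>i. if i = vz then l i else 0)"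
    define w where "w = lin_form 3 lw"
    define z where "z = lin_form 3 lz"
    have L: "lin_form 3 l = w + z"
      unfolding w_def z_def lin_form_def sum.distrib[symmetric] by (rule sum.cong) (auto simp: lw_def lz_def)
    have z0: "lookup (z ^ 3 * p) t = 0" if "t \<in> G" for t p
      unfolding z_def
    proof (rule lookup_lin_form_power_mult_0)
      fix u :: "nat \<Rightarrow>\<^sub>0 nat" assume u: "keys u \<subseteq> {i. i < 3 \<and> lz i \<noteq> 0}" "mono_degree u = 3"
      then have "keys u \<subseteq> {vz}" by (auto simp: lz_def split: if_splits)
      then have "vx \<notin> keys u" "vy \<notin> keys u" "keys u \<subseteq> {..<3}" using distinct vars by auto
      then have "lookup u vx = 0" "lookup u vy = 0" "keys u \<subseteq> {..<3}" by (simp_all add: in_keys_iff)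
      then have "lookup u vz = 3" using degree3[of u] u(2) by simp
      then show "\<exists>i. lookup t i < lookup u i" using in_G[OF that] by (intro exI[of _ vz]) simp
    qed
    have w0: "lookup (w ^ 5) t = 0" if t: "t \<in> G" for t
    proof (rule ccontr)
      assume "lookup (w ^ 5) t \<noteq> 0"
      then have "t \<in> keys (w ^ 5)" by (simp add: in_keys_iff)
      from keys_lin_form_power[OF this[unfolded w_def]]
      have "mono_degree t = 5" and k: "keys t \<subseteq> {..<3}" "vz \<notin> keys t" by (auto simp: lw_def)
      moreover have "lookup t vz = 0" using k(2) by (simp add: in_keys_iff)
      ultimately have "lookup t vx + lookup t vy = 5" using degree3[OF k(1)] by simp
      then show False using in_G[OF t] by auto
    qed
    show False
    proof (cases "l vx = 0 \<and> l vy = 0")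
      \<comment> \<open>Here \<open>L = z\<close>, so \<open>L ^ 3\<close> is zero in the algebra
        and the square of \<open>vx\<close> is in the kernel.\<close>
      case True
      then have "w = 0" unfolding w_def lin_form_def by (intro sum.neutral) (use vars in \<open>auto simp: lw_def\<close>)
      then have "\<forall>t\<in>G. lookup (lin_form 3 l ^ 3 * single (single vx 2) 1) t = 0" using z0 L by simp
      moreover have vx: "vx < 3" using vars by auto
      moreover from vx have "single (single vx 2) 1 \<in> (forms 3 2 :: 'k mpoly set)" by (intro forms_single) auto
      ultimately show False using inj *[of "single (single vx 2) 1" vx] unfolding lef_inj_def by auto
    next
      case False
      \<comment> \<open>The quadratic truncation of \<open>(w + z) ^ (- 3)\<close> in \<open>z / w\<close>, so that \<open>L ^ 3 * f\<close> is \<open>w ^ 5\<close> modulo \<open>z ^ 3\<close>.\<close>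
      define f where "f = w ^ 2 + z * (single 0 6 * z - single 0 3 * w)"
      have "w \<in> forms 3 1" "z \<in> forms 3 1" unfolding w_def z_def by (rule lin_form_in_forms)+
      then have "z * (single 0 6 * z - single 0 3 * w) \<in> forms 3 (1 + 1)"
        by (intro forms_mult forms_diff scale_forms)
      then have f: "f \<in> forms 3 2" unfolding f_def using forms_1_power[OF \<open>w \<in> forms 3 1\<close>, of 2]
        unfolding one_add_one by (intro forms_add)
      have "lin_form 3 l ^ 3 * f = w ^ 5 + z ^ 3 * (10 * w ^ 2 + 15 * w * z + 6 * z ^ 2)"
        unfolding f_def L single_numeral by (simp add: power_numeral_reduce algebra_simps)
      then have 0: "\<forall>t\<in>G. lookup (lin_form 3 l ^ 3 * f) t = 0" using w0 z0 by (simp add: lookup_add)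
      \<comment> \<open>The square of a variable with nonzero coefficient in \<open>w\<close> occurs
        in \<open>f\<close> only through \<open>w ^ 2\<close>, so \<open>f\<close> is nonzero in the
        algebra.\<close>
      obtain i where i: "i < 3" "i \<noteq> vz" "l i \<noteq> 0" using False vars distinct by (metis insertCI lessThan_iff)
      have "vz < 3" using vars by auto
      then have "lookup (w ^ 2) (single i 2) = lw i ^ 2"
        unfolding w_def using lookup_two_variable_power(1)[of i 3 vz lw 2] i by simp
      moreover have "lookup (z ^ 1 * (single 0 6 * z - single 0 3 * w)) (single i 2) = 0"
        unfolding z_def
      proof (rule lookup_lin_form_power_mult_0)
        fix u :: "nat \<Rightarrow>\<^sub>0 nat" assume u: "keys u \<subseteq> {i. i < 3 \<and> lz i \<noteq> 0}" "mono_degree u = 1"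
        then have "keys u \<subseteq> {vz}" by (auto simp: lz_def split: if_splits)
        moreover have "u \<noteq> 0" using u(2) by (auto simp: mono_degree_def)
        ultimately have "vz \<in> keys u" by (metis keys_eq_empty subset_singletonD insertI1)
        then show "\<exists>j. lookup (single i 2) j < lookup u j"
          using i(2) by (intro exI[of _ vz]) (auto simp: in_keys_iff lookup_single when_def)
      qed
      ultimately have "lookup f (single i 2) \<noteq> 0" using i by (simp add: f_def lookup_add lw_def)
      then show False using inj f 0 *[of f i] i(1) unfolding lef_inj_def by auto
    qed
  qed
  have "\<not> strong_lefschetz 3 (avoiding 3 G :: 'k mpoly set)"
  proof
    assume "strong_lefschetz 3 (avoiding 3 G :: 'k mpoly set)"
    then obtain L :: "'k mpoly" where L: "L \<in> forms 3 1" "maximal_rank 3 (avoiding 3 G) L 3 2"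
      unfolding strong_lefschetz_def by (meson one_le_numeral)
    then have "lef_inj 3 G (L ^ 3) 2 \<or> lef_surj 3 G (L ^ 3) 2 5"
      using maximal_rank_iff[OF G(1) L(1), of 3 2] by simp
    moreover obtain l where "L = lin_form 3 l" using linear_form_eq[OF L(1)] by blast
    ultimately show False using ninj[of l] not_inj_imp_not_surj[OF G card ninj[of l]] by blast
  qed
  moreover have "monomial_artinian_level 3 2 (avoiding 3 G :: 'k mpoly set)"
    unfolding G_def
  proof (rule level_below)
    show "C \<subseteq> {m. keys m \<subseteq> {..<3} \<and> mono_degree m = 6}" using C(2) by (auto simp: C_def degree_mon)
    show "\<exists>c\<in>C. lookup c i \<noteq> 0" if "i < 3" for i
    proof -
      have "i \<in> {vx, vy, vz}" using that vars by auto
      then have "lookup (mon 1 3 2) i \<noteq> 0" using lookup_mon[of 1 3 2] by auto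
      then show ?thesis by (auto simp: C_def)
    qed
  qed (simp_all add: C_def mon_inject)
  ultimately show ?thesis by blast
qed

end

theorem theorem7p17:
  fixes r d :: nat
  assumes "r \<ge> 1" and "d \<ge> 1"
  shows "((\<forall>I :: ('k::field_char_0) mpoly set. monomial_artinian_level r d I \<longrightarrow> weak_lefschetz r I)
            \<longleftrightarrow> (r = 1 \<or> r = 2) \<or> d = 1 \<or> (r = 3 \<and> d = 2)) \<and>
         ((\<forall>I :: 'k mpoly set. monomial_artinian_level r d I \<longrightarrow> strong_lefschetz r I)
            \<longleftrightarrow> (r = 1 \<or> r = 2) \<or> d = 1)"
proof -
  let ?weak = "\<forall>I :: 'k mpoly set. monomial_artinian_level r d I \<longrightarrow> weak_lefschetz r I"
  let ?strong = "\<forall>I :: 'k mpoly set. monomial_artinian_level r d I \<longrightarrow> strong_lefschetz r I"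
  have pos: ?strong if "r = 1 \<or> r = 2 \<or> d = 1"
    using strong_lefschetz_positive[OF _ assms that] by blast
  have sw: ?weak if ?strong using that strong_imp_weak by blast
  have pos32: ?weak if "r = 3 \<and> d = 2" using that weak_lefschetz_3_2 by blast
  \<comment> \<open>The remaining pairs have \<open>r \<ge> 3\<close> and \<open>d \<ge> 3\<close>,
    or \<open>r \<ge> 4\<close> and \<open>d = 2\<close>.\<close>
  have neg: "\<not> ?weak" if "\<not> (r = 1 \<or> r = 2)" "d \<noteq> 1" "\<not> (r = 3 \<and> d = 2)"
  proof (cases "d = 2")
    case True
    then interpret two_generators "r - 2" using that assms by unfold_locales auto
    have "r \<ge> 3" using that(1) assms(1) by auto
    then have "r - 2 + 2 = r" by simp
    then show ?thesis using not_weak[where 'k = 'k] True by auto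
  next
    case False
    then have "r - 2 \<ge> 1" "d \<ge> 3" "r - 2 + 2 = r" using that assms by auto
    then show ?thesis using many_generators_not_weak[of "r - 2" d, where 'k = 'k] by auto
  qed
  have "three_variables 0 1 2" by unfold_locales auto
  then have neg32: "\<not> ?strong" if "r = 3 \<and> d = 2"
    using three_variables.type_two_not_strong[of 0 1 2, where 'k = 'k] that by blast
  show ?thesis using pos sw pos32 neg neg32 by blast
qed

end
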